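(* Let $\nabla$ be a connection on $M$, regular at $x\in M$. Then $\nabla$ is locally metric at $x$ if and only if $\widetilde{W}_x$ contains a positive-definite bilinear form.
   Context: $M$ is a connected manifold; manifolds, connections and sections are smooth (the statement may equally be read with everything real analytic). A connection $\nabla$ on $M$ means a connection on $TM$, not necessarily symmetric (torsion-free). $\pi:W\to M$ is the vector bundle of symmetric elements of $T^*M\otimes T^*M$, with the induced connection, also denoted $\nabla$; $W_x=\pi^{-1}(x)$, and $R:TM\otimes TM\otimes W\to W$ is the curvature tensor of $\nabla$ on $W$. A metric is a positive-definite (Riemannian) metric; it is parallel if $\nabla g=0$. $\nabla$ is locally metric at $x\in M$ if there is a neighbourhood $U$ of $x$ and a metric on $U$ that is parallel with respect to $\nabla|_U$. Properties of a subset $W'\subseteq W$: (P1) for each $x\in M$, $W'_x:=W_x\cap W'$ is a linear subspace of $W_x$; (P2) for each $w\in W'$ there are an open neighbourhood $U$ of $\pi(w)$ and a smooth local section $X:U\to W$ with values in $W'$ such that $X(\pi(w))=w$. For $W'$ satisfying P1 and P2, the second fundamental 1-form $\alpha_{W'}:W'\to(W/W')\otimes T^*M$ (quotient taken fibrewise) is the fibrewise linear map sending $w\in W'$ to the class of $(\nabla X)(\pi(w))$ in $(W_{\pi(w)}/W'_{\pi(w)})\otimes T^*_{\pi(w)}M$, where $X$ is a local section with values in $W'$ and $X(\pi(w))=w$. For $V\subseteq W$ satisfying P1, $\mathcal{S}(V)$ is the set of $v\in V$ for which there is a smooth local section $X$ of $W$ near $\pi(v)$ with values in $V$ and $X(\pi(v))=v$.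 Derived flag: $V^{(0)}=\{w\in W: R(\cdot,\cdot)(w)=0\}$, $W^{(i)}=\mathcal{S}(V^{(i)})$, $V^{(i+1)}=\ker\alpha_{W^{(i)}}=\{w\in W^{(i)}:\alpha_{W^{(i)}}(w)=0\}$. The decreasing sequence $W\supseteq W^{(0)}\supseteq W^{(1)}\supseteq\cdots$ stabilizes: for some $k$, $W^{(l)}=W^{(k)}$ for all $l\ge k$. Define $\widetilde{W}=W^{(k)}$, with projection $\tilde\pi=\pi|_{\widetilde{W}}$ and fibres $\widetilde{W}_x=\widetilde{W}\cap W_x$. $\nabla$ is regular at $x\in M$ if there is an open neighbourhood $U$ of $x$ such that $\tilde\pi^{-1}(U)\subseteq\widetilde{W}$ is a vector bundle over $U$ (a subbundle of $W|_U$). *)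

theory Defs
  imports "HOL-Analysis.Analysis"
begin

text \<open>A manifold is a Hausdorff, second countable type \<open>'m\<close> together with a smooth atlas
  modelled on a Euclidean space \<open>'e\<close>; \<open>'m\<close> itself is the underlying set. The atlas need not be
  maximal.\<close>

section \<open>Smooth maps and manifolds\<close>

text \<open>Continuous differentiability of order k, for open \<open>S\<close>, through iterated
  directional derivatives.\<close>

primrec Ck_on :: "nat \<Rightarrow> ('a::real_normed_vector \<Rightarrow> 'b::real_normed_vector) \<Rightarrow> 'a set \<Rightarrow> bool" where
  "Ck_on 0 f S \<longleftrightarrow> continuous_on S f"
| "Ck_on (Suc k) f S \<longleftrightarrow>
     (\<forall>x\<in>S. f differentiable (at x)) \<and> (\<forall>v. Ck_on k (\<lambda>x. frechet_derivative f (at x) v) S)"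

definition smooth_on :: "('a::real_normed_vector \<Rightarrow> 'b::real_normed_vector) \<Rightarrow> 'a set \<Rightarrow> bool" where
  "smooth_on f S \<longleftrightarrow> (\<forall>k. Ck_on k f S)"

type_synonym ('m, 'e) chart = "'m set \<times> ('m \<Rightarrow> 'e)"
type_synonym ('m, 'e) atlas = "('m, 'e) chart set"

definition smooth_atlas ::
    "('m::{t2_space,second_countable_topology}, 'e::euclidean_space) atlas \<Rightarrow> bool" where
  "smooth_atlas A \<longleftrightarrow>
     (\<forall>(D, \<phi>)\<in>A. open D \<and> open (\<phi> ` D) \<and> homeomorphism D (\<phi> ` D) \<phi> (inv_into D \<phi>)) \<and>
     (\<Union>(D, \<phi>)\<in>A. D) = UNIV \<and>
     (\<forall>(D, \<phi>)\<in>A. \<forall>(E, \<psi>)\<in>A. smooth_on (\<psi> \<circ> inv_into D \<phi>) (\<phi> ` (D \<inter> E)))"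

definition smooth_fun ::
    "('m::topological_space, 'e::euclidean_space) atlas \<Rightarrow> 'm set \<Rightarrow> ('m \<Rightarrow> real) \<Rightarrow> bool" where
  "smooth_fun A U f \<longleftrightarrow> (\<forall>(D, \<phi>)\<in>A. smooth_on (f \<circ> inv_into D \<phi>) (\<phi> ` (D \<inter> U)))"

definition smooth_near ::
    "('m::topological_space, 'e::euclidean_space) atlas \<Rightarrow> 'm \<Rightarrow> ('m \<Rightarrow> real) \<Rightarrow> bool" where
  "smooth_near A x f \<longleftrightarrow> (\<exists>U. open U \<and> x \<in> U \<and> smooth_fun A U f)"

section \<open>Tangent vectors and vector fields\<close>

text \<open>A tangent vector at \<open>x\<close> is the operator \<open>f \<mapsto> \<Sum>i. e\<^sub>i \<partial>\<^sub>i f (x)\<close> in some chart, acting on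
  functions smooth near \<open>x\<close>. The value 0 on all other functions makes equality of operators
  coincide with equality of tangent vectors; the vector space operations are pointwise.\<close>

type_synonym 'm tvec = "('m \<Rightarrow> real) \<Rightarrow> real"

definition coord_vec ::
    "('m::topological_space, 'e::euclidean_space) atlas \<Rightarrow> ('m, 'e) chart \<Rightarrow> 'e \<Rightarrow> 'm \<Rightarrow> 'm tvec" where
  "coord_vec A c e x = (\<lambda>f. if smooth_near A x f
     then frechet_derivative (f \<circ> inv_into (fst c) (snd c)) (at (snd c x)) e else 0)"

definition tangent_space ::
    "('m::topological_space, 'e::euclidean_space) atlas \<Rightarrow> 'm \<Rightarrow> 'm tvec set" where
  "tangent_space A x = {coord_vec A c e x | c e. c \<in> A \<and> x \<in> fst c}"

definition tadd :: "'m tvec \<Rightarrow> 'm tvec \<Rightarrow> 'm tvec" where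
  "tadd v w = (\<lambda>f. v f + w f)"

definition tscale :: "real \<Rightarrow> 'm tvec \<Rightarrow> 'm tvec" where
  "tscale r v = (\<lambda>f. r * v f)"

definition tzero :: "'m tvec" where
  "tzero = (\<lambda>f. 0)"

definition vector_field ::
    "('m::topological_space, 'e::euclidean_space) atlas \<Rightarrow> 'm set \<Rightarrow> ('m \<Rightarrow> 'm tvec) \<Rightarrow> bool" where
  "vector_field A U X \<longleftrightarrow>
     (\<forall>x\<in>U. X x \<in> tangent_space A x) \<and>
     (\<forall>V f. open V \<and> V \<subseteq> U \<and> smooth_fun A V f \<longrightarrow> smooth_fun A V (\<lambda>x. X x f))"

definition lie_bracket ::
    "('m::topological_space, 'e::euclidean_space) atlas \<Rightarrow>
       ('m \<Rightarrow> 'm tvec) \<Rightarrow> ('m \<Rightarrow> 'm tvec) \<Rightarrow> 'm \<Rightarrow> 'm tvec" where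
  "lie_bracket A X Y x = (\<lambda>f. if smooth_near A x f
     then X x (\<lambda>y. Y y f) - Y x (\<lambda>y. X y f) else 0)"

section \<open>Connections on the tangent bundle\<close>

text \<open>\<open>\<nabla> x v Y\<close> is the derivative at \<open>x\<close>, in the direction \<open>v\<close>, of a vector field \<open>Y\<close> defined near
  \<open>x\<close>. It depends only on the germ of \<open>Y\<close>, so the same \<open>\<nabla>\<close> serves as its own restriction to
  every open set. Torsion is not assumed to vanish.\<close>

type_synonym 'm conn = "'m \<Rightarrow> 'm tvec \<Rightarrow> ('m \<Rightarrow> 'm tvec) \<Rightarrow> 'm tvec"

definition connection ::
    "('m::topological_space, 'e::euclidean_space) atlas \<Rightarrow> 'm conn \<Rightarrow> bool" where
  "connection A nabla \<longleftrightarrow>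
     (\<forall>U Y. open U \<and> vector_field A U Y \<longrightarrow>
        (\<forall>x\<in>U. \<forall>v\<in>tangent_space A x. nabla x v Y \<in> tangent_space A x) \<and>
        (\<forall>x\<in>U. \<forall>v\<in>tangent_space A x. \<forall>w\<in>tangent_space A x.
           nabla x (tadd v w) Y = tadd (nabla x v Y) (nabla x w Y)) \<and>
        (\<forall>x\<in>U. \<forall>v\<in>tangent_space A x. \<forall>r.
           nabla x (tscale r v) Y = tscale r (nabla x v Y)) \<and>
        (\<forall>Z. vector_field A U Z \<longrightarrow> (\<forall>x\<in>U. \<forall>v\<in>tangent_space A x.
           nabla x v (\<lambda>y. tadd (Y y) (Z y)) = tadd (nabla x v Y) (nabla x v Z))) \<and>
        (\<forall>f. smooth_fun A U f \<longrightarrow> (\<forall>x\<in>U. \<forall>v\<in>tangent_space A x.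
           nabla x v (\<lambda>y. tscale (f y) (Y y)) = tadd (tscale (v f) (Y x)) (tscale (f x) (nabla x v Y)))) \<and>
        (\<forall>Z. (\<forall>y\<in>U. Z y = Y y) \<longrightarrow> (\<forall>x\<in>U. \<forall>v\<in>tangent_space A x. nabla x v Z = nabla x v Y)) \<and>
        (\<forall>X. vector_field A U X \<longrightarrow> vector_field A U (\<lambda>x. nabla x (X x) Y)))"

section \<open>The bundle of symmetric bilinear forms\<close>

text \<open>Forms vanish outside the tangent space, so that equality of functions is equality of forms.
  Subsets of the total space \<open>W\<close> consist of pairs of a base point and a form.\<close>

type_synonym 'm form = "'m tvec \<Rightarrow> 'm tvec \<Rightarrow> real"

definition sym_forms ::
    "('m::topological_space, 'e::euclidean_space) atlas \<Rightarrow> 'm \<Rightarrow> 'm form set" where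
  "sym_forms A x = {h.
     (\<forall>a b. a \<notin> tangent_space A x \<or> b \<notin> tangent_space A x \<longrightarrow> h a b = 0) \<and>
     (\<forall>a\<in>tangent_space A x. \<forall>b\<in>tangent_space A x. h a b = h b a) \<and>
     (\<forall>a\<in>tangent_space A x. \<forall>a'\<in>tangent_space A x. \<forall>b\<in>tangent_space A x.
        h (tadd a a') b = h a b + h a' b) \<and>
     (\<forall>a\<in>tangent_space A x. \<forall>b\<in>tangent_space A x. \<forall>r. h (tscale r a) b = r * h a b)}"

definition pos_def ::
    "('m::topological_space, 'e::euclidean_space) atlas \<Rightarrow> 'm \<Rightarrow> 'm form \<Rightarrow> bool" where
  "pos_def A x h \<longleftrightarrow> (\<forall>a\<in>tangent_space A x. a \<noteq> tzero \<longrightarrow> h a a > 0)"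

definition W_bundle ::
    "('m::topological_space, 'e::euclidean_space) atlas \<Rightarrow> ('m \<times> 'm form) set" where
  "W_bundle A = {(x, h). h \<in> sym_forms A x}"

definition fibre :: "('m \<times> 'm form) set \<Rightarrow> 'm \<Rightarrow> 'm form set" where
  "fibre V x = {h. (x, h) \<in> V}"

definition W_section ::
    "('m::topological_space, 'e::euclidean_space) atlas \<Rightarrow> 'm set \<Rightarrow> ('m \<Rightarrow> 'm form) \<Rightarrow> bool" where
  "W_section A U h \<longleftrightarrow>
     (\<forall>x\<in>U. h x \<in> sym_forms A x) \<and>
     (\<forall>V X Y. open V \<and> V \<subseteq> U \<and> vector_field A V X \<and> vector_field A V Y \<longrightarrow>
        smooth_fun A V (\<lambda>x. h x (X x) (Y x)))"

text \<open>The induced connection on \<open>W\<close>: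
  \<open>(\<nabla>\<^sub>u h)(Y, Z) = u (h(Y, Z)) - h (\<nabla>\<^sub>u Y, Z) - h (Y, \<nabla>\<^sub>u Z)\<close>. The right-hand side depends only on
  the values of \<open>Y\<close> and \<open>Z\<close> at \<open>x\<close>, so the description is unique.\<close>

definition W_nabla ::
    "('m::topological_space, 'e::euclidean_space) atlas \<Rightarrow> 'm conn \<Rightarrow>
       'm \<Rightarrow> 'm tvec \<Rightarrow> ('m \<Rightarrow> 'm form) \<Rightarrow> 'm form" where
  "W_nabla A nabla x u h = (THE k. k \<in> sym_forms A x \<and>
     (\<forall>U Y Z. open U \<and> x \<in> U \<and> vector_field A U Y \<and> vector_field A U Z \<longrightarrow>
        k (Y x) (Z x) = u (\<lambda>y. h y (Y y) (Z y))
          - h x (nabla x u Y) (Z x) - h x (Y x) (nabla x u Z)))"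

text \<open>The curvature
  \<open>R(u, v) w = \<nabla>\<^sub>X \<nabla>\<^sub>Y h - \<nabla>\<^sub>Y \<nabla>\<^sub>X h - \<nabla>\<^bsub>[X,Y]\<^esub> h\<close> at \<open>x\<close>, for any local extensions
  \<open>X\<close>, \<open>Y\<close>, \<open>h\<close> of \<open>u\<close>, \<open>v\<close>, \<open>w\<close>.\<close>

definition W_curvature ::
    "('m::topological_space, 'e::euclidean_space) atlas \<Rightarrow> 'm conn \<Rightarrow>
       'm \<Rightarrow> 'm tvec \<Rightarrow> 'm tvec \<Rightarrow> 'm form \<Rightarrow> 'm form" where
  "W_curvature A nabla x u v w = (THE k.
     \<forall>U X Y h. open U \<and> x \<in> U \<and> vector_field A U X \<and> vector_field A U Y \<and> W_section A U h \<and>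
        X x = u \<and> Y x = v \<and> h x = w \<longrightarrow>
        k = (\<lambda>a b. W_nabla A nabla x (X x) (\<lambda>y. W_nabla A nabla y (Y y) h) a b
               - W_nabla A nabla x (Y x) (\<lambda>y. W_nabla A nabla y (X y) h) a b
               - W_nabla A nabla x (lie_bracket A X Y x) h a b))"

section \<open>The derived flag\<close>

definition S_op ::
    "('m::topological_space, 'e::euclidean_space) atlas \<Rightarrow> ('m \<times> 'm form) set \<Rightarrow> ('m \<times> 'm form) set" where
  "S_op A V = {(x, v). (x, v) \<in> V \<and>
     (\<exists>U X. open U \<and> x \<in> U \<and> W_section A U X \<and> (\<forall>y\<in>U. (y, X y) \<in> V) \<and> X x = v)}"

text \<open>An element of \<open>(W\<^sub>x / W'\<^sub>x) \<otimes> T\<^sub>x\<^sup>*\<close> is represented as the map sending a tangent vector to a coset of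
  \<open>W'\<^sub>x\<close> in \<open>W\<^sub>x\<close> (and everything else to the empty set).\<close>

definition quot_class ::
    "('m::topological_space, 'e::euclidean_space) atlas \<Rightarrow> ('m \<times> 'm form) set \<Rightarrow> 'm \<Rightarrow>
       ('m tvec \<Rightarrow> 'm form) \<Rightarrow> 'm tvec \<Rightarrow> 'm form set" where
  "quot_class A W' x L = (\<lambda>u. if u \<in> tangent_space A x
     then {k \<in> sym_forms A x. (\<lambda>a b. k a b - L u a b) \<in> fibre W' x} else {})"

text \<open>The second fundamental 1-form, as a relation: \<open>second_form A nabla W' x w c\<close> says that \<open>c\<close>
  is the class of \<open>(\<nabla>X)(x)\<close> for some local section \<open>X\<close> with values in \<open>W'\<close> and \<open>X(x) = w\<close>.
  Where the rank of \<open>W'\<close> is constant, \<open>c\<close> is determined by \<open>w\<close>. Where the rank jumps it need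
  not be: on the plane, let \<open>W'\<close> be spanned by \<open>(s, t)\<close> at each point \<open>(s, t)\<close> of a trivial
  bundle of rank 2; both the zero section and the section \<open>(s, t)\<close> pass through the zero vector
  over the origin. Formulated with the relation, the kernel is a linear subspace of each fibre
  in every case.\<close>

definition second_form ::
    "('m::topological_space, 'e::euclidean_space) atlas \<Rightarrow> 'm conn \<Rightarrow> ('m \<times> 'm form) set \<Rightarrow>
       'm \<Rightarrow> 'm form \<Rightarrow> ('m tvec \<Rightarrow> 'm form set) \<Rightarrow> bool" where
  "second_form A nabla W' x w c \<longleftrightarrow>
     (\<exists>U X. open U \<and> x \<in> U \<and> W_section A U X \<and> (\<forall>y\<in>U. (y, X y) \<in> W') \<and> X x = w \<and>
        c = quot_class A W' x (\<lambda>u. W_nabla A nabla x u X))"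

definition ker_second_form ::
    "('m::topological_space, 'e::euclidean_space) atlas \<Rightarrow> 'm conn \<Rightarrow> ('m \<times> 'm form) set \<Rightarrow>
       ('m \<times> 'm form) set" where
  "ker_second_form A nabla W' = {(x, w). (x, w) \<in> W' \<and>
     second_form A nabla W' x w (quot_class A W' x (\<lambda>u a b. 0))}"

definition ker_curvature ::
    "('m::topological_space, 'e::euclidean_space) atlas \<Rightarrow> 'm conn \<Rightarrow> ('m \<times> 'm form) set" where
  "ker_curvature A nabla = {(x, w). (x, w) \<in> W_bundle A \<and>
     (\<forall>u\<in>tangent_space A x. \<forall>v\<in>tangent_space A x. W_curvature A nabla x u v w = (\<lambda>a b. 0))}"

primrec W_flag ::
    "('m::topological_space, 'e::euclidean_space) atlas \<Rightarrow> 'm conn \<Rightarrow> nat \<Rightarrow> ('m \<times> 'm form) set" where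
  "W_flag A nabla 0 = S_op A (ker_curvature A nabla)"
| "W_flag A nabla (Suc i) = S_op A (ker_second_form A nabla (W_flag A nabla i))"

definition W_tilde ::
    "('m::topological_space, 'e::euclidean_space) atlas \<Rightarrow> 'm conn \<Rightarrow> ('m \<times> 'm form) set" where
  "W_tilde A nabla =
     W_flag A nabla (LEAST k. \<forall>l\<ge>k. W_flag A nabla l = W_flag A nabla k)"

section \<open>Regular and locally metric connections\<close>

text \<open>\<open>V\<close> restricts to a subbundle of \<open>W\<close> over \<open>U\<close>: near each point of \<open>U\<close> there is a smooth
  local frame \<open>s\<^sub>0, \<dots>, s\<^bsub>n-1\<^esub>\<close> identifying each fibre of \<open>V\<close> with the space of coefficient vectors.\<close>

definition subbundle_over ::
    "('m::topological_space, 'e::euclidean_space) atlas \<Rightarrow> ('m \<times> 'm form) set \<Rightarrow> 'm set \<Rightarrow> bool" where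
  "subbundle_over A V U \<longleftrightarrow>
     (\<forall>y\<in>U. \<exists>N n s. open N \<and> y \<in> N \<and> N \<subseteq> U \<and> (\<forall>i<n. W_section A N (s i)) \<and>
        (\<forall>z\<in>N. bij_betw (\<lambda>c a b. \<Sum>i<n. c i * s i z a b)
                 ({..<n::nat} \<rightarrow>\<^sub>E (UNIV::real set)) (fibre V z)))"

definition regular_at ::
    "('m::topological_space, 'e::euclidean_space) atlas \<Rightarrow> 'm conn \<Rightarrow> 'm \<Rightarrow> bool" where
  "regular_at A nabla x \<longleftrightarrow>
     (\<exists>U. open U \<and> x \<in> U \<and> subbundle_over A (W_tilde A nabla) U)"

definition metric_on ::
    "('m::topological_space, 'e::euclidean_space) atlas \<Rightarrow> 'm set \<Rightarrow> ('m \<Rightarrow> 'm form) \<Rightarrow> bool" where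
  "metric_on A U g \<longleftrightarrow> W_section A U g \<and> (\<forall>y\<in>U. pos_def A y (g y))"

definition parallel_on ::
    "('m::topological_space, 'e::euclidean_space) atlas \<Rightarrow> 'm conn \<Rightarrow> 'm set \<Rightarrow> ('m \<Rightarrow> 'm form) \<Rightarrow> bool" where
  "parallel_on A nabla U g \<longleftrightarrow>
     (\<forall>y\<in>U. \<forall>u\<in>tangent_space A y. W_nabla A nabla y u g = (\<lambda>a b. 0))"

definition locally_metric_at ::
    "('m::topological_space, 'e::euclidean_space) atlas \<Rightarrow> 'm conn \<Rightarrow> 'm \<Rightarrow> bool" where
  "locally_metric_at A nabla x \<longleftrightarrow>
     (\<exists>U g. open U \<and> x \<in> U \<and> metric_on A U g \<and> parallel_on A nabla U g)"

end

theory Submission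
  imports Defs
begin

text \<open>A parallel metric has zero curvature, and as a parallel section it stays in the kernel of every
  second fundamental form; so it takes values in every member of the derived flag, in particular
  in the last one \<open>V\<close>, which is \<open>W_tilde\<close> (\<open>parallel_section_in_W_flag\<close>). This gives one direction. It rests on the
  curvature of the induced connection being a tensor: \<open>W_curv_value\<close> expresses it by the curvature of
  \<open>\<nabla>\<close> on the tangent bundle, and \<open>curv_pointwise\<close> shows that the latter depends only on the values of the
  two vector fields.

  For the converse, \<open>V\<close> has to be closed under covariant differentiation, that is, the flag has to
  become stationary (\<open>W_flag_stabilizes\<close>). Where all ranks are locally constant, every strict
  inclusion lowers the rank, so stationarity after finitely many steps is clear there. The points of
  this kind are only dense. But each member of the flag is closed in the sense that a section with
  values in it over a dense set has values in it everywhere (\<open>section_closed_ker_curvature\<close>,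
  \<open>section_closed_ker_second_form\<close>), and each of its elements extends to such a section, so the
  coincidence on a dense open set propagates to all points.

  Near a regular point \<open>V\<close> has an orthogonal frame (\<open>subbundle_orthogonal_frame\<close>). As the second
  fundamental form of \<open>V\<close> vanishes, the connection restricts to \<open>V\<close>; as \<open>V\<close> lies in the kernel of
  the curvature, the restriction is flat. Parallel sections of a flat bundle solve a linear system
  of total differential equations, and the Frobenius theorem for such systems
  (\<open>flat_system_solution\<close>) yields a parallel section through any given element of \<open>V\<^sub>x\<close>
  (\<open>parallel_extension\<close>). If that element is positive definite, the section is so near \<open>x\<close>
  (\<open>pos_def_near\<close>), and it is the metric sought.

  The linear system is solved by Picard iteration along rays: each iterate is a radial primitive of
  the 1-form built from its predecessor. Such a form is not closed, so the gradient of the primitive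
  differs from it, but by flatness the difference is controlled by the distance and the defect of the
  two preceding iterates (\<open>curl_estimate\<close>). On a small ball the defects decay geometrically, and the limit
  solves the system. Only continuous differentiability of the iterates is involved; smoothness of the
  limit follows from the equation.\<close>

section \<open>Functions of class \<open>C\<^sup>k\<close> on open sets\<close>

lemma has_derivative_cong_open:
  assumes "open S" "x \<in> S" "\<And>y. y \<in> S \<Longrightarrow> f y = g y"
  shows "(f has_derivative D) (at x) \<longleftrightarrow> (g has_derivative D) (at x)"
  using has_derivative_transform_within_open[of f D x UNIV S g]
    has_derivative_transform_within_open[of g D x UNIV S f] assms by auto

lemma frechet_derivative_cong_open:
  assumes "open S" "x \<in> S" "\<And>y. y \<in> S \<Longrightarrow> f y = g y"
  shows "frechet_derivative f (at x) = frechet_derivative g (at x)"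
  unfolding frechet_derivative_def using has_derivative_cong_open[OF assms] by simp

lemma differentiable_cong_open:
  assumes "open S" "x \<in> S" "\<And>y. y \<in> S \<Longrightarrow> f y = g y"
  shows "f differentiable (at x) \<longleftrightarrow> g differentiable (at x)"
  unfolding differentiable_def using has_derivative_cong_open[OF assms] by simp

lemma Ck_on_cong:
  assumes "open S" "\<And>y. y \<in> S \<Longrightarrow> f y = g y"
  shows "Ck_on k f S \<longleftrightarrow> Ck_on k g S"
  using assms(2)
proof (induction k arbitrary: f g)
  case 0
  then show ?case by (simp cong: continuous_on_cong)
next
  case (Suc k)
  have "f differentiable (at x) \<longleftrightarrow> g differentiable (at x)" if "x \<in> S" for x
    using differentiable_cong_open[OF assms(1) that Suc.prems] .
  moreover have "Ck_on k (\<lambda>x. frechet_derivative f (at x) v) S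
      \<longleftrightarrow> Ck_on k (\<lambda>x. frechet_derivative g (at x) v) S" for v
    by (rule Suc.IH) (simp add: frechet_derivative_cong_open[OF assms(1) _ Suc.prems])
  ultimately show ?case by simp
qed

lemma Ck_on_subset: "Ck_on k f S \<Longrightarrow> T \<subseteq> S \<Longrightarrow> Ck_on k f T"
  by (induction k arbitrary: f) (auto intro: continuous_on_subset)

lemma Ck_on_Suc_imp: "Ck_on (Suc k) f S \<Longrightarrow> Ck_on k f S"
proof (induction k arbitrary: f)
  case 0
  then show ?case
    by (metis Ck_on.simps differentiable_imp_continuous_within continuous_at_imp_continuous_on)
next
  case (Suc k)
  then show ?case by (metis Ck_on.simps(2))
qed

lemma Ck_on_const: "Ck_on k (\<lambda>x. c) S"
proof (induction k arbitrary: c)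
  case (Suc k)
  then show ?case by (simp add: frechet_derivative_const)
qed simp

lemma Ck_on_SucI:
  assumes "open S" "\<And>x. x \<in> S \<Longrightarrow> (f has_derivative D x) (at x)"
    "\<And>v. Ck_on k (\<lambda>x. D x v) S"
  shows "Ck_on (Suc k) f S"
proof -
  have "Ck_on k (\<lambda>x. frechet_derivative f (at x) v) S \<longleftrightarrow> Ck_on k (\<lambda>x. D x v) S" for v
    by (rule Ck_on_cong[OF assms(1)]) (metis assms(2) frechet_derivative_at)
  then show ?thesis using assms by (auto simp: differentiable_def)
qed

lemma Ck_on_SucD:
  assumes "Ck_on (Suc k) f S" "x \<in> S"
  shows "(f has_derivative frechet_derivative f (at x)) (at x)"
  using assms frechet_derivative_works by auto

lemma Ck_on_add:
  assumes "open S" "Ck_on k f S" "Ck_on k g S"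
  shows "Ck_on k (\<lambda>x. f x + g x) S"
  using assms(2,3)
proof (induction k arbitrary: f g)
  case 0
  then show ?case by (simp add: continuous_on_add)
next
  case (Suc k)
  show ?case
    by (rule Ck_on_SucI[OF assms(1) has_derivative_add[OF Ck_on_SucD Ck_on_SucD]])
      (use Suc in auto)
qed

lemma Ck_on_mult:
  fixes f g :: "'a::real_normed_vector \<Rightarrow> real"
  assumes "open S" "Ck_on k f S" "Ck_on k g S"
  shows "Ck_on k (\<lambda>x. f x * g x) S"
  using assms(2,3)
proof (induction k arbitrary: f g)
  case 0
  then show ?case by (simp add: continuous_on_mult)
next
  case (Suc k)
  have "Ck_on k f S" "Ck_on k g S" using Suc.prems Ck_on_Suc_imp by blast+
  then show ?case
    by (intro Ck_on_SucI[OF assms(1) has_derivative_mult[OF Ck_on_SucD Ck_on_SucD]])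
      (use Suc in \<open>auto intro: Ck_on_add[OF assms(1)]\<close>)
qed

lemma Ck_on_inverse:
  fixes f :: "'a::real_normed_vector \<Rightarrow> real"
  assumes "open S" "Ck_on k f S" "\<And>x. x \<in> S \<Longrightarrow> f x \<noteq> 0"
  shows "Ck_on k (\<lambda>x. inverse (f x)) S"
  using assms(2)
proof (induction k)
  case 0
  then show ?case using assms(3) by (simp add: continuous_on_inverse)
next
  case (Suc k)
  have f: "Ck_on k f S" using Suc.prems Ck_on_Suc_imp by blast
  have "Ck_on k (\<lambda>x. -1 * (inverse (f x) * (frechet_derivative f (at x) v * inverse (f x)))) S" for v
    using Suc.prems
    by (intro Ck_on_mult[OF assms(1)] Suc.IH[OF f] Ck_on_const) simp
  then show ?case
    by (intro Ck_on_SucI[OF assms(1) Deriv.has_derivative_inverse[OF assms(3) Ck_on_SucD[OF Suc.prems]]])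
      (simp_all add: mult.assoc)
qed

lemma Ck_on_sum:
  assumes "open S" "finite I" "\<And>i. i \<in> I \<Longrightarrow> Ck_on k (f i) S"
  shows "Ck_on k (\<lambda>x. \<Sum>i\<in>I. f i x) S"
  using assms(2,3) by (induction I) (auto simp: Ck_on_const intro!: Ck_on_add[OF assms(1)])

lemma Ck_on_inner:
  fixes g :: "'a::real_normed_vector \<Rightarrow> 'b::real_inner"
  assumes "open S" "Ck_on k g S"
  shows "Ck_on k (\<lambda>x. g x \<bullet> b) S"
  using assms(2)
proof (induction k arbitrary: g)
  case 0
  then show ?case by (simp add: continuous_on_inner)
next
  case (Suc k)
  show ?case
    by (rule Ck_on_SucI[OF assms(1) has_derivative_inner_left[OF Ck_on_SucD[OF Suc.prems]]])
      (use Suc in auto)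
qed

lemma Ck_on_linear:
  assumes "open S" "bounded_linear f"
  shows "Ck_on k f S"
proof (cases k)
  case 0
  then show ?thesis using assms(2) by (simp add: linear_continuous_on)
next
  case (Suc m)
  show ?thesis unfolding Suc
    by (rule Ck_on_SucI[OF assms(1) bounded_linear_imp_has_derivative[OF assms(2)]])
      (rule Ck_on_const)
qed

text \<open>The chain rule writes a directional derivative of \<open>f \<circ> g\<close> as a sum of products of
  derivatives of the components of \<open>g\<close> with partial derivatives of \<open>f\<close> composed with \<open>g\<close>, so
  that the order of differentiability can be raised by induction.\<close>

lemma Ck_on_compose:
  fixes f :: "'b::euclidean_space \<Rightarrow> real" and g :: "'a::real_normed_vector \<Rightarrow> 'b"
  assumes "open S" "Ck_on k g S" "Ck_on k f T" "g ` S \<subseteq> T"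
  shows "Ck_on k (\<lambda>x. f (g x)) S"
  using assms(2-)
proof (induction k arbitrary: f)
  case 0
  then show ?case by (auto intro: continuous_on_compose2)
next
  case (Suc k)
  let ?D = "\<lambda>x v. \<Sum>b\<in>Basis. (frechet_derivative g (at x) v \<bullet> b) * frechet_derivative f (at (g x)) b"
  have "((\<lambda>x. f (g x)) has_derivative ?D x) (at x)" if "x \<in> S" for x
  proof -
    have f: "(f has_derivative frechet_derivative f (at (g x))) (at (g x))"
      using Suc.prems that by (intro Ck_on_SucD) auto
    have *: "((\<lambda>x. f (g x)) has_derivative
        (\<lambda>v. frechet_derivative f (at (g x)) (frechet_derivative g (at x) v))) (at x)"
      using Ck_on_SucD[OF Suc.prems(1) that] f has_derivative_compose by blast
    have rep: "frechet_derivative f (at (g x)) w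
        = (\<Sum>b\<in>Basis. (w \<bullet> b) * frechet_derivative f (at (g x)) b)" for w
    proof -
      interpret L: linear "frechet_derivative f (at (g x))"
        using f has_derivative_linear by blast
      have "frechet_derivative f (at (g x)) w
          = frechet_derivative f (at (g x)) (\<Sum>b\<in>Basis. (w \<bullet> b) *\<^sub>R b)"
        by (simp only: euclidean_representation)
      also have "\<dots> = (\<Sum>b\<in>Basis. (w \<bullet> b) * frechet_derivative f (at (g x)) b)"
        by (simp only: L.sum L.scale real_scaleR_def)
      finally show ?thesis .
    qed
    have "(\<lambda>v. frechet_derivative f (at (g x)) (frechet_derivative g (at x) v)) = ?D x"
      by (rule ext) (rule rep)
    with * show ?thesis by (rule back_subst)
  qed
  moreover have "Ck_on k (\<lambda>x. ?D x v) S" for v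
  proof (intro Ck_on_sum[OF assms(1)] Ck_on_mult[OF assms(1)] Ck_on_inner[OF assms(1)])
    show "Ck_on k (\<lambda>x. frechet_derivative g (at x) v) S" using Suc.prems by simp
    show "Ck_on k (\<lambda>x. frechet_derivative f (at (g x)) b) S" for b
      using Suc.prems Ck_on_Suc_imp[OF Suc.prems(1)]
      by (intro Suc.IH[of "\<lambda>y. frechet_derivative f (at y) b"]) auto
  qed simp
  ultimately show ?case by (intro Ck_on_SucI[OF assms(1)]) auto
qed

text \<open>Both iterated derivatives are limits of the second difference quotient of \<open>f\<close> along the
  parallelogram with sides \<open>h v\<close> and \<open>h w\<close>: two applications of the mean value theorem express
  it as a value of either of them near \<open>x\<close>.\<close>

lemma second_difference_mvt:
  fixes f :: "'a::real_normed_vector \<Rightarrow> real"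
  assumes f: "Ck_on 2 f S" and h: "h > 0"
    and sub: "\<And>s t. \<bar>s\<bar> \<le> h \<Longrightarrow> \<bar>t\<bar> \<le> h \<Longrightarrow> x + s *\<^sub>R v + t *\<^sub>R w \<in> S"
  shows "\<exists>s t. 0 < s \<and> s < h \<and> 0 < t \<and> t < h \<and>
     f (x + h *\<^sub>R v + h *\<^sub>R w) - f (x + h *\<^sub>R v) - f (x + h *\<^sub>R w) + f x =
       h * h * frechet_derivative (\<lambda>y. frechet_derivative f (at y) v) (at (x + s *\<^sub>R v + t *\<^sub>R w)) w"
proof -
  have f1: "Ck_on (Suc 1) f S" using f by (simp add: numeral_2_eq_2)
  define F where "F = (\<lambda>y. frechet_derivative f (at y) v)"
  have F1: "Ck_on (Suc 0) F S" using f1 unfolding F_def by simp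
  have lin: "(D has_derivative D') (at y) \<Longrightarrow> linear D'" for D D' and y :: 'a
    using has_derivative_linear by blast
  define g where "g = (\<lambda>s. f (x + s *\<^sub>R v + h *\<^sub>R w) - f (x + s *\<^sub>R v))"
  have g: "DERIV g s :> F (x + s *\<^sub>R v + h *\<^sub>R w) - F (x + s *\<^sub>R v)" if "0 \<le> s" "s \<le> h" for s
  proof -
    have "x + s *\<^sub>R v + h *\<^sub>R w \<in> S" "x + s *\<^sub>R v \<in> S" using sub[of s h] sub[of s 0] that h by auto
    note d = this[THEN Ck_on_SucD[OF f1]]
    have "((\<lambda>s. f (x + s *\<^sub>R v + h *\<^sub>R w)) has_derivative
        (\<lambda>r. frechet_derivative f (at (x + s *\<^sub>R v + h *\<^sub>R w)) (r *\<^sub>R v))) (at s)"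
      by (rule has_derivative_compose[where g = f and f = "\<lambda>s. x + s *\<^sub>R v + h *\<^sub>R w", OF _ d(1)]) (auto intro!: derivative_eq_intros)
    moreover have "((\<lambda>s. f (x + s *\<^sub>R v)) has_derivative
        (\<lambda>r. frechet_derivative f (at (x + s *\<^sub>R v)) (r *\<^sub>R v))) (at s)"
      by (rule has_derivative_compose[where g = f and f = "\<lambda>s. x + s *\<^sub>R v", OF _ d(2)]) (auto intro!: derivative_eq_intros)
    ultimately have "(g has_derivative (\<lambda>r. frechet_derivative f (at (x + s *\<^sub>R v + h *\<^sub>R w)) (r *\<^sub>R v)
        - frechet_derivative f (at (x + s *\<^sub>R v)) (r *\<^sub>R v))) (at s)"
      unfolding g_def by (rule has_derivative_diff)
    moreover have "frechet_derivative f (at (x + s *\<^sub>R v + h *\<^sub>R w)) (r *\<^sub>R v)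
        = r * F (x + s *\<^sub>R v + h *\<^sub>R w)"
      "frechet_derivative f (at (x + s *\<^sub>R v)) (r *\<^sub>R v) = r * F (x + s *\<^sub>R v)" for r
      using linear_scale[OF lin[OF d(1)]] linear_scale[OF lin[OF d(2)]] by (simp_all add: F_def)
    ultimately show ?thesis
      unfolding has_field_derivative_def by (simp add: right_diff_distrib[symmetric] mult.commute[of _ "_ - _"])
  qed
  obtain s where s: "0 < s" "s < h" "g h - g 0 = (h - 0) * (F (x + s *\<^sub>R v + h *\<^sub>R w) - F (x + s *\<^sub>R v))"
    using MVT2[OF h g] by auto
  define k where "k = (\<lambda>t. F (x + s *\<^sub>R v + t *\<^sub>R w))"
  have k: "DERIV k t :> frechet_derivative F (at (x + s *\<^sub>R v + t *\<^sub>R w)) w" if "0 \<le> t" "t \<le> h" for t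
  proof -
    have "x + s *\<^sub>R v + t *\<^sub>R w \<in> S" using sub[of s t] that s by auto
    note d = this[THEN Ck_on_SucD[OF F1]]
    have "(k has_derivative (\<lambda>r. frechet_derivative F (at (x + s *\<^sub>R v + t *\<^sub>R w)) (r *\<^sub>R w))) (at t)"
      unfolding k_def by (rule has_derivative_compose[where g = F and f = "\<lambda>t. x + s *\<^sub>R v + t *\<^sub>R w", OF _ d]) (auto intro!: derivative_eq_intros)
    then show ?thesis
      unfolding has_field_derivative_def using linear_scale[OF lin[OF d]] by (simp add: mult_commute_abs)
  qed
  obtain t where t: "0 < t" "t < h"
    "k h - k 0 = (h - 0) * frechet_derivative F (at (x + s *\<^sub>R v + t *\<^sub>R w)) w"
    using MVT2[OF h k] by blast
  have "g h - g 0 = h * h * frechet_derivative F (at (x + s *\<^sub>R v + t *\<^sub>R w)) w"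
    using s(3) t(3) by (simp add: k_def)
  then show ?thesis
    using s t unfolding g_def F_def by (intro exI[of _ s] exI[of _ t]) simp
qed

lemma second_derivative_symmetric:
  fixes f :: "'a::real_normed_vector \<Rightarrow> real"
  assumes S: "open S" "x \<in> S" and f: "Ck_on 2 f S"
  shows "frechet_derivative (\<lambda>y. frechet_derivative f (at y) v) (at x) w
       = frechet_derivative (\<lambda>y. frechet_derivative f (at y) w) (at x) v"
proof (rule ccontr)
  define a where "a = (\<lambda>x. frechet_derivative (\<lambda>y. frechet_derivative f (at y) v) (at x) w)"
  define b where "b = (\<lambda>x. frechet_derivative (\<lambda>y. frechet_derivative f (at y) w) (at x) v)"
  assume "\<not> ?thesis"
  then have ne: "\<bar>a x - b x\<bar> > 0" by (simp add: a_def b_def)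
  have "continuous_on S a" "continuous_on S b"
    using f by (simp_all add: numeral_2_eq_2 a_def b_def)
  then have "isCont a x" "isCont b x" using S continuous_on_eq_continuous_at by blast+
  then obtain d1 d2 where d: "d1 > 0" "d2 > 0"
    "\<And>y. dist y x < d1 \<Longrightarrow> dist (a y) (a x) < \<bar>a x - b x\<bar> / 2"
    "\<And>y. dist y x < d2 \<Longrightarrow> dist (b y) (b x) < \<bar>a x - b x\<bar> / 2"
    using ne unfolding continuous_at_eps_delta by (metis half_gt_zero)
  obtain d0 where d0: "d0 > 0" "ball x d0 \<subseteq> S" using S open_contains_ball by blast
  define d where "d = Min {d0, d1, d2}"
  define N where "N = norm v + norm w + 1"
  define h where "h = d / (2 * N)"
  have N: "N > 0" unfolding N_def by (simp add: add_nonneg_pos)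
  have dp: "d > 0" "d \<le> d0" "d \<le> d1" "d \<le> d2" using d d0 by (auto simp: d_def)
  have h: "h > 0" using N dp by (simp add: h_def)
  have near: "dist (x + s *\<^sub>R v + t *\<^sub>R w) x < d" if "\<bar>s\<bar> \<le> h" "\<bar>t\<bar> \<le> h" for s t
  proof -
    have "norm (s *\<^sub>R v + t *\<^sub>R w) \<le> \<bar>s\<bar> * norm v + \<bar>t\<bar> * norm w"
      by (metis norm_scaleR norm_triangle_ineq)
    also have "\<dots> \<le> h * norm v + h * norm w"
      using that by (intro add_mono mult_right_mono) auto
    also have "\<dots> \<le> h * N" using h by (simp add: N_def algebra_simps)
    also have "\<dots> < d" using N dp by (simp add: h_def)
    finally show ?thesis by (simp add: dist_norm add.assoc)
  qed
  then have sub: "x + s *\<^sub>R v + t *\<^sub>R w \<in> S" if "\<bar>s\<bar> \<le> h" "\<bar>t\<bar> \<le> h" for s t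
    using that d0 dp by (metis dist_commute mem_ball order_less_le_trans subsetD)
  have sub': "x + s *\<^sub>R w + t *\<^sub>R v \<in> S" if "\<bar>s\<bar> \<le> h" "\<bar>t\<bar> \<le> h" for s t
    using sub[OF that(2,1)] by (simp add: algebra_simps)
  obtain s t where st: "0 < s" "s < h" "0 < t" "t < h"
     "f (x + h *\<^sub>R v + h *\<^sub>R w) - f (x + h *\<^sub>R v) - f (x + h *\<^sub>R w) + f x = h * h * a (x + s *\<^sub>R v + t *\<^sub>R w)"
    using second_difference_mvt[OF f h sub] unfolding a_def by blast
  obtain s' t' where st': "0 < s'" "s' < h" "0 < t'" "t' < h"
     "f (x + h *\<^sub>R w + h *\<^sub>R v) - f (x + h *\<^sub>R w) - f (x + h *\<^sub>R v) + f x = h * h * b (x + s' *\<^sub>R w + t' *\<^sub>R v)"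
    using second_difference_mvt[OF f h sub'] unfolding b_def by blast
  have "h * h * a (x + s *\<^sub>R v + t *\<^sub>R w) = h * h * b (x + t' *\<^sub>R v + s' *\<^sub>R w)"
    using st(5) st'(5) by (simp add: algebra_simps)
  then have "a (x + s *\<^sub>R v + t *\<^sub>R w) = b (x + t' *\<^sub>R v + s' *\<^sub>R w)" using h by simp
  moreover have "dist (a (x + s *\<^sub>R v + t *\<^sub>R w)) (a x) < \<bar>a x - b x\<bar> / 2"
    by (rule d(3)) (use near[of s t] st dp in auto)
  moreover have "dist (b (x + t' *\<^sub>R v + s' *\<^sub>R w)) (b x) < \<bar>a x - b x\<bar> / 2"
    by (rule d(4)) (use near[of t' s'] st' dp in auto)
  ultimately show False by (simp add: dist_real_def abs_if split: if_splits)
qed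

section \<open>Flat linear systems\<close>

lemma differentiable_continuous_on:
  assumes "\<And>y. y \<in> S \<Longrightarrow> (f has_derivative f' y) (at y)"
  shows "continuous_on S f"
  by (rule has_derivative_continuous_on) (rule has_derivative_at_withinI[OF assms])

definition radial_primitive :: "'e::euclidean_space \<Rightarrow> ('e \<Rightarrow> 'e) \<Rightarrow> 'e \<Rightarrow> real" where
  "radial_primitive p \<eta> y = integral {0..1} (\<lambda>s. \<eta> (p + s *\<^sub>R (y - p)) \<bullet> (y - p))"

lemma radial_in_ball:
  fixes p :: "'e::real_normed_vector"
  assumes "y \<in> ball p R" "s \<in> {0..1::real}"
  shows "p + s *\<^sub>R (y - p) \<in> ball p R"
proof -
  have "\<bar>s\<bar> * norm (y - p) \<le> 1 * norm (y - p)" using assms by (intro mult_right_mono) auto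
  then show ?thesis using assms by (simp add: dist_norm norm_minus_commute)
qed

lemma continuous_on_radial:
  fixes p :: "'e::real_normed_vector"
  assumes "continuous_on (ball p R) f"
  shows "continuous_on (ball p R \<times> {0..1::real}) (\<lambda>z. f (p + snd z *\<^sub>R (fst z - p)))"
  by (rule continuous_on_compose2[OF assms]) (auto intro!: continuous_intros dest: radial_in_ball)

lemma continuous_on_radial_line:
  fixes p :: "'e::real_normed_vector"
  assumes "continuous_on (ball p R) f" "y \<in> ball p R"
  shows "continuous_on {0..1::real} (\<lambda>s. f (p + s *\<^sub>R (y - p)))"
  by (rule continuous_on_compose2[OF assms(1)]) (auto intro!: continuous_intros dest: radial_in_ball[OF assms(2)])

text \<open>The Poincare lemma with an error term: along each ray, the gradient of the radial primitive of
  the 1-form \<open>v \<mapsto> v \<bullet> \<eta> y\<close> differs from \<open>\<eta>\<close> by an integral of the exterior derivative of the form,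
  since \<open>\<eta>\<close> itself is the integral of the derivative of \<open>s *\<^sub>R \<eta> (p + s *\<^sub>R (y - p))\<close>.\<close>

lemma radial_primitive_gradient:
  fixes \<eta> :: "'e::euclidean_space \<Rightarrow> 'e"
  assumes d: "\<And>y. y \<in> ball p R \<Longrightarrow> (\<eta> has_derivative d\<eta> y) (at y)"
    and cd: "\<And>v. continuous_on (ball p R) (\<lambda>y. d\<eta> y v)"
  shows "\<exists>G. continuous_on (ball p R) G \<and>
    (\<forall>y\<in>ball p R. (radial_primitive p \<eta> has_derivative (\<lambda>v. v \<bullet> G y)) (at y)) \<and>
    (\<forall>M. (\<forall>z\<in>ball p R. \<forall>v w. \<bar>d\<eta> z v \<bullet> w - d\<eta> z w \<bullet> v\<bar> \<le> M * norm v * norm w) \<longrightarrow>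
       (\<forall>y\<in>ball p R. \<forall>v. \<bar>v \<bullet> G y - v \<bullet> \<eta> y\<bar> \<le> M * R * norm v))"
proof -
  let ?B = "ball p R"
  define z where "z = (\<lambda>y s. p + s *\<^sub>R (y - p))"
  define g where "g = (\<lambda>y s. \<eta> (z y s) + s *\<^sub>R (\<Sum>b\<in>Basis. (d\<eta> (z y s) b \<bullet> (y - p)) *\<^sub>R b))"
  define G where "G = (\<lambda>y. integral {0..1} (g y))"
  have zB: "z y s \<in> ?B" if "y \<in> ?B" "s \<in> {0..1}" for y s unfolding z_def by (rule radial_in_ball[OF that])
  have c\<eta>: "continuous_on ?B \<eta>"
    by (rule differentiable_continuous_on[OF d])
  have cg: "continuous_on (?B \<times> cbox 0 1) (\<lambda>(y, s). g y s)"
    unfolding g_def z_def case_prod_unfold cbox_interval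
    by (intro continuous_intros continuous_on_radial c\<eta> cd)
  have vg: "v \<bullet> g y s = v \<bullet> \<eta> (z y s) + s * (d\<eta> (z y s) v \<bullet> (y - p))" if y: "y \<in> ?B" "s \<in> {0..1}" for y s v
  proof -
    have l: "linear (d\<eta> (z y s))" using d[OF zB[OF y]] has_derivative_linear by blast
    have "d\<eta> (z y s) v = d\<eta> (z y s) (\<Sum>b\<in>Basis. (v \<bullet> b) *\<^sub>R b)" by (simp only: euclidean_representation)
    also have "\<dots> = (\<Sum>b\<in>Basis. (v \<bullet> b) *\<^sub>R d\<eta> (z y s) b)" by (simp only: linear_sum[OF l] linear_scale[OF l])
    finally have "d\<eta> (z y s) v \<bullet> (y - p) = (\<Sum>b\<in>Basis. (v \<bullet> b) * (d\<eta> (z y s) b \<bullet> (y - p)))"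
      by (simp add: inner_sum_left)
    then show ?thesis by (simp add: g_def inner_add_right inner_sum_right mult.commute)
  qed
  have cgy: "continuous_on {0..1} (g y)" if "y \<in> ?B" for y
    unfolding g_def z_def using that by (intro continuous_intros continuous_on_radial_line[OF _ that] c\<eta> cd)
  have ig: "g y integrable_on {0..1}" if "y \<in> ?B" for y
    by (rule integrable_continuous_real[OF cgy[OF that]])
  have vG: "v \<bullet> G y = integral {0..1} (\<lambda>s. v \<bullet> g y s)" if "y \<in> ?B" for y v
    using integral_linear[OF ig[OF that] bounded_linear_inner_right, of v] by (simp add: G_def comp_def)
  have contG: "continuous_on ?B G"
    using integral_continuous_on_param[OF cg] by (simp add: G_def)
  have der: "(radial_primitive p \<eta> has_derivative (\<lambda>v. v \<bullet> G y)) (at y)" if y: "y \<in> ?B" for y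
  proof -
    have "((\<lambda>y. integral (cbox 0 1) (\<lambda>s. \<eta> (z y s) \<bullet> (y - p))) has_derivative
        integral (cbox 0 1) (\<lambda>s. blinfun_inner_left (g y s))) (at y within ?B)"
    proof (rule leibniz_rule[OF _ _ _ y convex_ball])
      fix x and s :: real assume x: "x \<in> ?B" and s: "s \<in> cbox 0 1"
      have s': "s \<in> {0..1}" using s by simp
      have "((\<lambda>x. \<eta> (z x s)) has_derivative (\<lambda>v. d\<eta> (z x s) (s *\<^sub>R v))) (at x)"
        unfolding z_def
        by (rule has_derivative_compose[where g = \<eta> and f = "\<lambda>x. p + s *\<^sub>R (x - p)", OF _ d[OF zB[OF x s', unfolded z_def]]])
          (auto intro!: derivative_eq_intros)
      then have "((\<lambda>x. \<eta> (z x s) \<bullet> (x - p)) has_derivative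
          (\<lambda>v. \<eta> (z x s) \<bullet> v + d\<eta> (z x s) (s *\<^sub>R v) \<bullet> (x - p))) (at x)"
        by (auto intro!: derivative_eq_intros)
      moreover have "linear (d\<eta> (z x s))" using d[OF zB[OF x s']] has_derivative_linear by blast
      then have "(\<lambda>v. \<eta> (z x s) \<bullet> v + d\<eta> (z x s) (s *\<^sub>R v) \<bullet> (x - p)) = blinfun_apply (blinfun_inner_left (g x s))"
        using vg[OF x s'] by (intro ext) (simp add: linear_scale inner_commute)
      ultimately show "((\<lambda>x. \<eta> (z x s) \<bullet> (x - p)) has_derivative blinfun_apply (blinfun_inner_left (g x s))) (at x within ?B)"
        using has_derivative_at_withinI by simp
    next
      fix x assume x: "x \<in> ?B"
      show "(\<lambda>s. \<eta> (z x s) \<bullet> (x - p)) integrable_on cbox 0 1"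
        unfolding cbox_interval z_def
        by (intro integrable_continuous_real continuous_intros continuous_on_radial_line[OF c\<eta> x])
    next
      show "continuous_on (?B \<times> cbox 0 1) (\<lambda>(x, s). blinfun_inner_left (g x s))"
        using bounded_linear.continuous_on[OF bounded_linear_blinfun_inner_left cg] by (simp add: case_prod_unfold)
    qed
    moreover have "integral (cbox 0 1) (\<lambda>s. blinfun_inner_left (g y s)) = blinfun_inner_left (G y)"
      using integral_linear[OF ig[OF y] bounded_linear_blinfun_inner_left] by (simp add: comp_def G_def)
    moreover have "blinfun_apply (blinfun_inner_left (G y)) = (\<lambda>v. v \<bullet> G y)"
      by (rule ext) simp
    moreover have "(\<lambda>y. integral (cbox 0 1) (\<lambda>s. \<eta> (z y s) \<bullet> (y - p))) = radial_primitive p \<eta>"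
      by (rule ext) (simp add: radial_primitive_def z_def)
    ultimately show ?thesis using y at_within_open[OF y open_ball] by simp
  qed
  have err: "\<bar>v \<bullet> G y - v \<bullet> \<eta> y\<bar> \<le> M * R * norm v"
    if M: "\<And>z v w. z \<in> ?B \<Longrightarrow> \<bar>d\<eta> z v \<bullet> w - d\<eta> z w \<bullet> v\<bar> \<le> M * norm v * norm w" and y: "y \<in> ?B" for M y v
  proof -
    have M0: "0 \<le> M * norm v * norm (y - p)" using M[OF y, of v "y - p"] by linarith
    let ?h = "\<lambda>s. \<eta> (z y s) \<bullet> v + s * (d\<eta> (z y s) (y - p) \<bullet> v)"
    have "(?h has_integral (1 * (\<eta> (z y 1) \<bullet> v) - 0 * (\<eta> (z y 0) \<bullet> v))) {0..1}"
    proof (rule fundamental_theorem_of_calculus[where f = "\<lambda>s. s * (\<eta> (z y s) \<bullet> v)"])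
      fix s :: real assume s: "s \<in> {0..1}"
      have "((\<lambda>s. \<eta> (z y s)) has_derivative (\<lambda>r. d\<eta> (z y s) (r *\<^sub>R (y - p)))) (at s)"
        unfolding z_def
        by (rule has_derivative_compose[where g = \<eta> and f = "\<lambda>s. p + s *\<^sub>R (y - p)", OF _ d[OF zB[OF y s, unfolded z_def]]])
          (auto intro!: derivative_eq_intros)
      then have "((\<lambda>s. s * (\<eta> (z y s) \<bullet> v)) has_derivative
          (\<lambda>r. s * (d\<eta> (z y s) (r *\<^sub>R (y - p)) \<bullet> v) + r * (\<eta> (z y s) \<bullet> v))) (at s)"
        by (auto intro!: derivative_eq_intros)
      moreover have "linear (d\<eta> (z y s))" using d[OF zB[OF y s]] has_derivative_linear by blast
      then have "(\<lambda>r. s * (d\<eta> (z y s) (r *\<^sub>R (y - p)) \<bullet> v) + r * (\<eta> (z y s) \<bullet> v)) = (\<lambda>r. r *\<^sub>R ?h s)"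
        by (intro ext) (simp only: linear_scale inner_scaleR_left real_scaleR_def ring_distribs
            mult.left_commute add.commute)
      ultimately show "((\<lambda>s. s * (\<eta> (z y s) \<bullet> v)) has_vector_derivative ?h s) (at s within {0..1})"
        unfolding has_vector_derivative_def using has_derivative_at_withinI by simp
    qed simp
    then have h: "(?h has_integral (\<eta> y \<bullet> v)) {0..1}" by (simp add: z_def)
    have "((\<lambda>s. v \<bullet> g y s) has_integral (v \<bullet> G y)) {0..1}"
      unfolding vG[OF y] by (intro integrable_integral integrable_continuous_real continuous_intros cgy[OF y])
    then have "((\<lambda>s. v \<bullet> g y s - ?h s) has_integral (v \<bullet> G y - \<eta> y \<bullet> v)) (cbox 0 1)"
      using has_integral_diff[OF _ h] by simp
    then have "norm (v \<bullet> G y - \<eta> y \<bullet> v) \<le> (M * norm v * norm (y - p)) * measure lborel (cbox 0 (1::real))"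
    proof (rule has_integral_bound[OF M0])
      fix s :: real assume "s \<in> cbox 0 1"
      then have s: "s \<in> {0..1}" by simp
      have "norm (v \<bullet> g y s - ?h s) = \<bar>s\<bar> * \<bar>d\<eta> (z y s) v \<bullet> (y - p) - d\<eta> (z y s) (y - p) \<bullet> v\<bar>"
        unfolding vg[OF y s] by (simp add: inner_commute[of v] right_diff_distrib[symmetric] abs_mult)
      also have "\<dots> \<le> 1 * (M * norm v * norm (y - p))"
        using s by (intro mult_mono M zB[OF y s]) auto
      finally show "norm (v \<bullet> g y s - ?h s) \<le> M * norm v * norm (y - p)" by simp
    qed
    also have "\<dots> \<le> M * R * norm v"
    proof (cases "v = 0 \<or> y = p")
      case True
      then show ?thesis
      proof
        assume "y = p"
        obtain b :: 'e where b: "b \<in> Basis" using nonempty_Basis by blast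
        have "0 \<le> M" using M[OF y, of b b] b by (simp add: norm_Basis)
        moreover have "0 < R" using y by (metis ball_eq_empty empty_iff not_less)
        ultimately show ?thesis using \<open>y = p\<close> by simp
      qed simp
    next
      case False
      then have "0 \<le> M" using M0 by (simp add: zero_le_mult_iff)
      moreover have "norm (y - p) \<le> R" using y by (simp add: dist_norm norm_minus_commute)
      ultimately have "M * norm v * norm (y - p) \<le> M * norm v * R" by (intro mult_left_mono) auto
      then show ?thesis by (simp add: mult.commute mult.left_commute)
    qed
    finally show ?thesis by (simp add: inner_commute)
  qed
  show ?thesis
    using contG der err by (intro exI[of _ G]) blast
qed

lemma radial_primitive_diff_bound:
  assumes c: "continuous_on (ball p R) \<eta>" "continuous_on (ball p R) \<eta>'" and y: "y \<in> ball p R"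
    and b: "\<And>z. z \<in> ball p R \<Longrightarrow> norm (\<eta> z - \<eta>' z) \<le> M"
  shows "\<bar>radial_primitive p \<eta> y - radial_primitive p \<eta>' y\<bar> \<le> M * R"
proof -
  have M: "0 \<le> M" using b[OF y] norm_ge_zero order_trans by blast
  have R: "norm (y - p) \<le> R" using y by (simp add: dist_norm norm_minus_commute)
  have i: "((\<lambda>s. f (p + s *\<^sub>R (y - p)) \<bullet> (y - p)) has_integral radial_primitive p f y) {0..1}"
    if "continuous_on (ball p R) f" for f
    unfolding radial_primitive_def
    by (intro integrable_integral integrable_continuous_real continuous_intros continuous_on_radial_line[OF that y])
  have "((\<lambda>s. \<eta> (p + s *\<^sub>R (y - p)) \<bullet> (y - p) - \<eta>' (p + s *\<^sub>R (y - p)) \<bullet> (y - p)) has_integral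
      (radial_primitive p \<eta> y - radial_primitive p \<eta>' y)) (cbox 0 1)"
    using has_integral_diff[OF i[OF c(1)] i[OF c(2)]] by simp
  then have "norm (radial_primitive p \<eta> y - radial_primitive p \<eta>' y) \<le> (M * R) * measure lborel (cbox 0 (1::real))"
  proof (rule has_integral_bound[rotated])
    show "0 \<le> M * R" using M R norm_ge_zero order_trans by (metis mult_nonneg_nonneg)
    fix s :: real assume "s \<in> cbox 0 1"
    then have z: "p + s *\<^sub>R (y - p) \<in> ball p R" using radial_in_ball[OF y] by simp
    have "\<bar>(\<eta> (p + s *\<^sub>R (y - p)) - \<eta>' (p + s *\<^sub>R (y - p))) \<bullet> (y - p)\<bar>
        \<le> norm (\<eta> (p + s *\<^sub>R (y - p)) - \<eta>' (p + s *\<^sub>R (y - p))) * norm (y - p)"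
      by (rule Cauchy_Schwarz_ineq2)
    also have "\<dots> \<le> M * R" using b[OF z] R M by (intro mult_mono) auto
    finally show "norm (\<eta> (p + s *\<^sub>R (y - p)) \<bullet> (y - p) - \<eta>' (p + s *\<^sub>R (y - p)) \<bullet> (y - p)) \<le> M * R"
      by (simp add: inner_diff_left)
  qed
  then show ?thesis by simp
qed

text \<open>If the \<open>D i\<close> have almost the right gradient, the exterior derivative of the next 1-form is
  small. The flatness condition turns its main part into a term in \<open>D - D'\<close>.\<close>

lemma curl_estimate:
  fixes \<Omega> :: "nat \<Rightarrow> nat \<Rightarrow> 'e::real_inner" and g :: "nat \<Rightarrow> 'e" and D D' :: "nat \<Rightarrow> real"
  assumes flat: "\<And>i. i < n \<Longrightarrow> d\<Omega> i v \<bullet> w - d\<Omega> i w \<bullet> v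
      = (\<Sum>j<n. (\<Omega> i j \<bullet> v) * (\<Omega> j k \<bullet> w) - (\<Omega> i j \<bullet> w) * (\<Omega> j k \<bullet> v))"
    and K: "\<And>i j. i < n \<Longrightarrow> j < n \<Longrightarrow> norm (\<Omega> i j) \<le> K" and k: "k < n"
    and \<delta>: "\<And>i. i < n \<Longrightarrow> \<bar>D i - D' i\<bar> \<le> \<delta>"
    and \<epsilon>: "\<And>i u. i < n \<Longrightarrow> \<bar>u \<bullet> g i + u \<bullet> (\<Sum>j<n. D' j *\<^sub>R \<Omega> j i)\<bar> \<le> \<epsilon> * norm u"
  shows "\<bar>(\<Sum>i<n. (v \<bullet> g i) *\<^sub>R \<Omega> i k + D i *\<^sub>R d\<Omega> i v) \<bullet> w - (\<Sum>i<n. (w \<bullet> g i) *\<^sub>R \<Omega> i k + D i *\<^sub>R d\<Omega> i w) \<bullet> v\<bar>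
    \<le> (2 * real n * real n * K * K * \<delta> + 2 * real n * K * \<epsilon>) * norm v * norm w"
proof -
  define T where "T = (\<lambda>j i. (\<Omega> j i \<bullet> v) * (\<Omega> i k \<bullet> w) - (\<Omega> j i \<bullet> w) * (\<Omega> i k \<bullet> v))"
  define e where "e = (\<lambda>i u. u \<bullet> g i + u \<bullet> (\<Sum>j<n. D' j *\<^sub>R \<Omega> j i))"
  have K0: "0 \<le> K" using K[OF k k] norm_ge_zero order_trans by blast
  have g: "u \<bullet> g i = e i u - (\<Sum>j<n. D' j * (\<Omega> j i \<bullet> u))" for i u
    by (simp add: e_def inner_sum_right inner_commute)
  have "(\<Sum>i<n. (v \<bullet> g i) *\<^sub>R \<Omega> i k + D i *\<^sub>R d\<Omega> i v) \<bullet> w - (\<Sum>i<n. (w \<bullet> g i) *\<^sub>R \<Omega> i k + D i *\<^sub>R d\<Omega> i w) \<bullet> v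
    = (\<Sum>i<n. (v \<bullet> g i) * (\<Omega> i k \<bullet> w) - (w \<bullet> g i) * (\<Omega> i k \<bullet> v)) + (\<Sum>i<n. D i * (d\<Omega> i v \<bullet> w - d\<Omega> i w \<bullet> v))"
    by (simp add: inner_sum_left inner_add_left sum.distrib sum_subtractf algebra_simps)
  also have "(\<Sum>i<n. D i * (d\<Omega> i v \<bullet> w - d\<Omega> i w \<bullet> v)) = (\<Sum>i<n. \<Sum>j<n. D i * T i j)"
    by (intro sum.cong refl) (simp add: flat T_def sum_distrib_left)
  also have "\<dots> = (\<Sum>i<n. \<Sum>j<n. D j * T j i)" by (rule sum.swap)
  also have "(\<Sum>i<n. (v \<bullet> g i) * (\<Omega> i k \<bullet> w) - (w \<bullet> g i) * (\<Omega> i k \<bullet> v))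
      = (\<Sum>i<n. (e i v * (\<Omega> i k \<bullet> w) - e i w * (\<Omega> i k \<bullet> v)) - (\<Sum>j<n. D' j * T j i))"
  proof (rule sum.cong[OF refl])
    fix i
    have "(\<Sum>j<n. D' j * T j i) = (\<Sum>j<n. D' j * (\<Omega> j i \<bullet> v)) * (\<Omega> i k \<bullet> w) - (\<Sum>j<n. D' j * (\<Omega> j i \<bullet> w)) * (\<Omega> i k \<bullet> v)"
      by (simp add: T_def sum_distrib_right right_diff_distrib sum_subtractf mult.assoc)
    then show "(v \<bullet> g i) * (\<Omega> i k \<bullet> w) - (w \<bullet> g i) * (\<Omega> i k \<bullet> v)
        = (e i v * (\<Omega> i k \<bullet> w) - e i w * (\<Omega> i k \<bullet> v)) - (\<Sum>j<n. D' j * T j i)"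
      unfolding g by (simp add: left_diff_distrib)
  qed
  also have "\<dots> + (\<Sum>i<n. \<Sum>j<n. D j * T j i)
      = (\<Sum>i<n. (e i v * (\<Omega> i k \<bullet> w) - e i w * (\<Omega> i k \<bullet> v)) + (\<Sum>j<n. (D j - D' j) * T j i))"
    by (simp add: sum.distrib sum_subtractf left_diff_distrib)
  finally have eq: "(\<Sum>i<n. (v \<bullet> g i) *\<^sub>R \<Omega> i k + D i *\<^sub>R d\<Omega> i v) \<bullet> w - (\<Sum>i<n. (w \<bullet> g i) *\<^sub>R \<Omega> i k + D i *\<^sub>R d\<Omega> i w) \<bullet> v
    = (\<Sum>i<n. (e i v * (\<Omega> i k \<bullet> w) - e i w * (\<Omega> i k \<bullet> v)) + (\<Sum>j<n. (D j - D' j) * T j i))" .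
  have \<Omega>: "\<bar>\<Omega> i j \<bullet> u\<bar> \<le> K * norm u" if "i < n" "j < n" for i j u
  proof -
    have "\<bar>\<Omega> i j \<bullet> u\<bar> \<le> norm (\<Omega> i j) * norm u" by (rule Cauchy_Schwarz_ineq2)
    also have "\<dots> \<le> K * norm u" by (rule mult_right_mono[OF K[OF that]]) simp
    finally show ?thesis .
  qed
  have e: "\<bar>e i u * (\<Omega> i k \<bullet> u')\<bar> \<le> K * \<epsilon> * (norm u * norm u')" if "i < n" for i u u'
  proof -
    have "\<bar>e i u\<bar> * \<bar>\<Omega> i k \<bullet> u'\<bar> \<le> (\<epsilon> * norm u) * (K * norm u')"
      using \<epsilon>[OF that, of u] \<Omega>[OF that k, of u'] by (intro mult_mono) (auto simp: e_def)
    then show ?thesis by (simp add: abs_mult mult.commute mult.left_commute)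
  qed
  have T: "\<bar>T j i\<bar> \<le> 2 * K * K * (norm v * norm w)" if "i < n" "j < n" for i j
  proof -
    have "\<bar>\<Omega> j i \<bullet> v\<bar> * \<bar>\<Omega> i k \<bullet> w\<bar> \<le> (K * norm v) * (K * norm w)"
      "\<bar>\<Omega> j i \<bullet> w\<bar> * \<bar>\<Omega> i k \<bullet> v\<bar> \<le> (K * norm w) * (K * norm v)"
      using \<Omega> that k K0 by (auto intro!: mult_mono)
    then have "\<bar>T j i\<bar> \<le> (K * norm v) * (K * norm w) + (K * norm w) * (K * norm v)"
      unfolding T_def by (intro order_trans[OF abs_triangle_ineq4] add_mono) (simp_all add: abs_mult)
    then show ?thesis by (simp add: algebra_simps)
  qed
  have DT: "\<bar>\<Sum>j<n. (D j - D' j) * T j i\<bar> \<le> n * (\<delta> * (2 * K * K * (norm v * norm w)))" if "i < n" for i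
  proof -
    have "\<bar>(D j - D' j) * T j i\<bar> \<le> \<delta> * (2 * K * K * (norm v * norm w))" if "j \<in> {..<n}" for j
      unfolding abs_mult using \<delta>[of j] T[OF \<open>i < n\<close>, of j] that by (intro mult_mono) auto
    then have "\<bar>\<Sum>j<n. (D j - D' j) * T j i\<bar> \<le> card {..<n} * (\<delta> * (2 * K * K * (norm v * norm w)))"
      using sum_norm_bound[of "{..<n}" "\<lambda>j. (D j - D' j) * T j i"] by simp
    then show ?thesis by simp
  qed
  have "norm (\<Sum>i<n. (e i v * (\<Omega> i k \<bullet> w) - e i w * (\<Omega> i k \<bullet> v)) + (\<Sum>j<n. (D j - D' j) * T j i))
     \<le> card {..<n} * (2 * K * \<epsilon> * (norm v * norm w) + n * (\<delta> * (2 * K * K * (norm v * norm w))))"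
  proof (rule sum_norm_bound)
    fix i assume "i \<in> {..<n}"
    then have i: "i < n" by simp
    show "norm ((e i v * (\<Omega> i k \<bullet> w) - e i w * (\<Omega> i k \<bullet> v)) + (\<Sum>j<n. (D j - D' j) * T j i))
        \<le> 2 * K * \<epsilon> * (norm v * norm w) + n * (\<delta> * (2 * K * K * (norm v * norm w)))"
      using e[OF i, of v w] e[OF i, of w v] DT[OF i]
      by (simp add: mult.commute[of "norm w" "norm v"] abs_le_iff)
  qed
  then show ?thesis unfolding eq by (simp add: algebra_simps)
qed

text \<open>The Frobenius theorem on a ball so small that each Picard step at least halves both the
  difference of consecutive iterates and the defect of the gradient.\<close>

lemma flat_system_on_ball:
  fixes \<Omega> :: "nat \<Rightarrow> nat \<Rightarrow> 'e::euclidean_space \<Rightarrow> 'e"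
  assumes R: "R > 0"
    and d: "\<And>i k y. i < n \<Longrightarrow> k < n \<Longrightarrow> y \<in> ball p R \<Longrightarrow> (\<Omega> i k has_derivative d\<Omega> i k y) (at y)"
    and cd: "\<And>i k v. i < n \<Longrightarrow> k < n \<Longrightarrow> continuous_on (ball p R) (\<lambda>y. d\<Omega> i k y v)"
    and K: "\<And>i k y. i < n \<Longrightarrow> k < n \<Longrightarrow> y \<in> ball p R \<Longrightarrow> norm (\<Omega> i k y) \<le> K" and K0: "0 \<le> K"
    and flat: "\<And>i k y v w. i < n \<Longrightarrow> k < n \<Longrightarrow> y \<in> ball p R \<Longrightarrow> d\<Omega> i k y v \<bullet> w - d\<Omega> i k y w \<bullet> v
      = (\<Sum>j<n. (\<Omega> i j y \<bullet> v) * (\<Omega> j k y \<bullet> w) - (\<Omega> i j y \<bullet> w) * (\<Omega> j k y \<bullet> v))"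
    and small: "R * (2 * real n * real n * K * K + 2 * real n * K) \<le> 1 / 2"
  shows "\<exists>C. \<forall>k<n. C k p = c k \<and> (\<forall>y\<in>ball p R.
    (C k has_derivative (\<lambda>v. - (v \<bullet> (\<Sum>i<n. C i y *\<^sub>R \<Omega> i k y)))) (at y))"
proof -
  let ?B = "ball p R"
  define H where "H = (\<lambda>D k y. \<Sum>i<n. (D i y :: real) *\<^sub>R \<Omega> i k y)"
  define D where "D = rec_nat (\<lambda>k y. 0) (\<lambda>_ Dm k y. c k - radial_primitive p (H Dm k) y)"
  have D0: "D 0 = (\<lambda>k y. 0)" and DSuc: "D (Suc m) = (\<lambda>k y. c k - radial_primitive p (H (D m) k) y)" for m
    by (simp_all add: D_def)
  define C1 where "C1 = (\<lambda>m g. \<forall>k<n. continuous_on ?B (g k) \<and>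
    (\<forall>y\<in>?B. (D m k has_derivative (\<lambda>v. v \<bullet> g k y)) (at y)))"
  define dH where "dH = (\<lambda>m g k y v. \<Sum>i<n. (v \<bullet> g i y) *\<^sub>R \<Omega> i k y + D m i y *\<^sub>R d\<Omega> i k y v)"
  have c\<Omega>: "continuous_on ?B (\<Omega> i k)" if "i < n" "k < n" for i k
    by (rule differentiable_continuous_on) (rule d[OF that])
  have cD: "continuous_on ?B (D m k)" if "C1 m g" "k < n" for m g k
    by (rule differentiable_continuous_on[where f' = "\<lambda>y v. v \<bullet> g k y"]) (use that in \<open>auto simp: C1_def\<close>)
  have dH: "(H (D m) k has_derivative dH m g k y) (at y)" if "C1 m g" "k < n" "y \<in> ?B" for m g k y
  proof -
    have "((\<lambda>y. D m i y *\<^sub>R \<Omega> i k y) has_derivative (\<lambda>v. D m i y *\<^sub>R d\<Omega> i k y v + (v \<bullet> g i y) *\<^sub>R \<Omega> i k y)) (at y)"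
      if "i < n" for i
      using \<open>C1 m g\<close> \<open>k < n\<close> \<open>y \<in> ?B\<close> that d[OF that \<open>k < n\<close> \<open>y \<in> ?B\<close>]
      unfolding C1_def by (intro has_derivative_scaleR) auto
    then have "((\<lambda>y. \<Sum>i<n. D m i y *\<^sub>R \<Omega> i k y) has_derivative
        (\<lambda>v. \<Sum>i<n. D m i y *\<^sub>R d\<Omega> i k y v + (v \<bullet> g i y) *\<^sub>R \<Omega> i k y)) (at y)"
      by (intro has_derivative_sum) auto
    then show ?thesis by (simp add: H_def dH_def add.commute)
  qed
  have cdH: "continuous_on ?B (\<lambda>y. dH m g k y v)" if "C1 m g" "k < n" for m g k v
  proof -
    have "continuous_on ?B (g i)" if "i < n" for i using \<open>C1 m g\<close> that by (auto simp: C1_def)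
    then show ?thesis
      unfolding dH_def using that(2) by (intro continuous_intros c\<Omega> cd cD[OF that(1)]) auto
  qed
  \<comment> \<open>Each iterate has a continuous gradient, and that gradient is nearly \<open>- H\<close> of the previous one.\<close>
  have step: "\<exists>G. C1 (Suc m) G \<and> (\<forall>M. (\<forall>k<n. \<forall>z\<in>?B. \<forall>v w. \<bar>dH m g k z v \<bullet> w - dH m g k z w \<bullet> v\<bar> \<le> M * norm v * norm w) \<longrightarrow>
       (\<forall>k<n. \<forall>y\<in>?B. \<forall>v. \<bar>v \<bullet> G k y + v \<bullet> H (D m) k y\<bar> \<le> M * R * norm v))" if g: "C1 m g" for m g
  proof -
    have "\<forall>k. \<exists>G. k < n \<longrightarrow> continuous_on ?B G \<and>
      (\<forall>y\<in>?B. (radial_primitive p (H (D m) k) has_derivative (\<lambda>v. v \<bullet> G y)) (at y)) \<and>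
      (\<forall>M. (\<forall>z\<in>?B. \<forall>v w. \<bar>dH m g k z v \<bullet> w - dH m g k z w \<bullet> v\<bar> \<le> M * norm v * norm w) \<longrightarrow>
         (\<forall>y\<in>?B. \<forall>v. \<bar>v \<bullet> G y - v \<bullet> H (D m) k y\<bar> \<le> M * R * norm v))"
      using radial_primitive_gradient[OF dH[OF g] cdH[OF g]] by blast
    then obtain G where G: "\<And>k. k < n \<Longrightarrow> continuous_on ?B (G k) \<and>
      (\<forall>y\<in>?B. (radial_primitive p (H (D m) k) has_derivative (\<lambda>v. v \<bullet> G k y)) (at y)) \<and>
      (\<forall>M. (\<forall>z\<in>?B. \<forall>v w. \<bar>dH m g k z v \<bullet> w - dH m g k z w \<bullet> v\<bar> \<le> M * norm v * norm w) \<longrightarrow>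
         (\<forall>y\<in>?B. \<forall>v. \<bar>v \<bullet> G k y - v \<bullet> H (D m) k y\<bar> \<le> M * R * norm v))" by metis
    have "C1 (Suc m) (\<lambda>k y. - G k y)"
      unfolding C1_def DSuc
    proof (intro allI impI conjI ballI)
      fix k assume k: "k < n"
      show "continuous_on ?B (\<lambda>y. - G k y)" using G[OF k] by (intro continuous_intros) auto
      fix y assume "y \<in> ?B"
      then have "((\<lambda>y. c k - radial_primitive p (H (D m) k) y) has_derivative (\<lambda>v. 0 - v \<bullet> G k y)) (at y)"
        using G[OF k] by (intro has_derivative_diff has_derivative_const) auto
      then show "((\<lambda>y. c k - radial_primitive p (H (D m) k) y) has_derivative (\<lambda>v. v \<bullet> - G k y)) (at y)" by simp
    qed
    moreover have "\<bar>v \<bullet> - G k y + v \<bullet> H (D m) k y\<bar> = \<bar>v \<bullet> G k y - v \<bullet> H (D m) k y\<bar>" for v k y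
      by (simp add: abs_minus_commute)
    ultimately show ?thesis using G by (intro exI[of _ "\<lambda>k y. - G k y"]) auto
  qed
  have ex_C1: "\<exists>g. C1 m g" for m
  proof (induction m)
    case 0
    have "C1 0 (\<lambda>k y. 0)" by (simp add: C1_def D0)
    then show ?case by blast
  next
    case (Suc m)
    then show ?case using step by blast
  qed
  \<comment> \<open>\<open>q m\<close> bounds the difference of the iterates \<open>m\<close> and \<open>m + 1\<close> and the defect of the latter; the
    iteration starts from 0 so that its first defect vanishes.\<close>
  define \<gamma> where "\<gamma> = (\<Sum>k<n. \<bar>c k\<bar>)"
  have \<gamma>0: "0 \<le> \<gamma>" by (simp add: \<gamma>_def sum_nonneg)
  have \<gamma>: "\<bar>c k\<bar> \<le> \<gamma>" if "k < n" for k
    unfolding \<gamma>_def by (rule member_le_sum) (use that in auto)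
  have small': "R * (n * K) \<le> 1 / 2"
  proof -
    have "0 \<le> real n * K" "0 \<le> real n * real n * K * K" using K0 by simp_all
    then have "n * K \<le> 2 * real n * real n * K * K + 2 * real n * K" by linarith
    then have "R * (n * K) \<le> R * (2 * real n * real n * K * K + 2 * real n * K)" using R by (intro mult_left_mono) auto
    then show ?thesis using small by linarith
  qed
  define q where "q = (\<lambda>m. \<gamma> * (1 / 2) ^ m :: real)"
  have q0: "0 \<le> q m" for m using \<gamma>0 by (simp add: q_def)
  have qSuc: "q (Suc m) = q m / 2" for m by (simp add: q_def)
  define good where "good = (\<lambda>m g. C1 (Suc m) g \<and>
      (\<forall>k<n. \<forall>y\<in>?B. \<bar>D (Suc m) k y - D m k y\<bar> \<le> q m) \<and>
      (\<forall>k<n. \<forall>y\<in>?B. \<forall>v. \<bar>v \<bullet> g k y + v \<bullet> H (D m) k y\<bar> \<le> q m * norm v))"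
  have "\<exists>g. good m g" for m
  proof (induction m)
    case 0
    have "D (Suc 0) = (\<lambda>k y. c k)" by (simp add: DSuc D0 H_def radial_primitive_def)
    then have "good 0 (\<lambda>k y. 0)"
      using \<gamma> \<gamma>0 by (simp add: good_def C1_def D0 q_def H_def)
    then show ?case by blast
  next
    case (Suc m)
    then obtain g where g: "good m g" by blast
    then have C: "C1 (Suc m) g" by (simp add: good_def)
    obtain g0 where Cm: "C1 m g0" using ex_C1 by blast
    obtain G where G: "C1 (Suc (Suc m)) G" and err: "\<And>M. (\<forall>k<n. \<forall>z\<in>?B. \<forall>v w. \<bar>dH (Suc m) g k z v \<bullet> w - dH (Suc m) g k z w \<bullet> v\<bar>
        \<le> M * norm v * norm w) \<Longrightarrow> \<forall>k<n. \<forall>y\<in>?B. \<forall>v. \<bar>v \<bullet> G k y + v \<bullet> H (D (Suc m)) k y\<bar> \<le> M * R * norm v"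
      using step[OF C] by blast
    let ?M = "2 * real n * real n * K * K * q m + 2 * real n * K * q m"
    have "\<bar>dH (Suc m) g k z v \<bullet> w - dH (Suc m) g k z w \<bullet> v\<bar> \<le> ?M * norm v * norm w"
      if k: "k < n" and z: "z \<in> ?B" for k z v w
      unfolding dH_def
      by (rule curl_estimate[where D = "\<lambda>i. D (Suc m) i z" and D' = "\<lambda>i. D m i z"
          and \<Omega> = "\<lambda>i j. \<Omega> i j z" and d\<Omega> = "\<lambda>i. d\<Omega> i k z" and g = "\<lambda>i. g i z"])
        (use g k z flat K in \<open>auto simp: good_def H_def\<close>)
    then have "\<forall>k<n. \<forall>y\<in>?B. \<forall>v. \<bar>v \<bullet> G k y + v \<bullet> H (D (Suc m)) k y\<bar> \<le> ?M * R * norm v"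
      by (intro err) blast
    moreover have "?M * R \<le> q (Suc m)"
      using mult_right_mono[OF small q0[of m]] by (simp add: qSuc algebra_simps)
    ultimately have E: "\<forall>k<n. \<forall>y\<in>?B. \<forall>v. \<bar>v \<bullet> G k y + v \<bullet> H (D (Suc m)) k y\<bar> \<le> q (Suc m) * norm v"
      by (meson mult_right_mono norm_ge_zero order_trans)
    have "\<bar>D (Suc (Suc m)) k y - D (Suc m) k y\<bar> \<le> q (Suc m)" if k: "k < n" and y: "y \<in> ?B" for k y
    proof -
      have cH: "continuous_on ?B (H (D m') k)" if "C1 m' g'" for m' g'
        unfolding H_def using k by (intro continuous_intros c\<Omega> cD[OF that]) auto
      have "\<bar>radial_primitive p (H (D (Suc m)) k) y - radial_primitive p (H (D m) k) y\<bar> \<le> (n * (q m * K)) * R"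
      proof (rule radial_primitive_diff_bound[OF cH[OF C] cH[OF Cm] y])
        fix z assume z: "z \<in> ?B"
        have "norm (\<Sum>i<n. (D (Suc m) i z - D m i z) *\<^sub>R \<Omega> i k z) \<le> card {..<n} * (q m * K)"
        proof (rule sum_norm_bound)
          fix i assume "i \<in> {..<n}"
          then show "norm ((D (Suc m) i z - D m i z) *\<^sub>R \<Omega> i k z) \<le> q m * K"
            unfolding norm_scaleR real_norm_def using g z K k q0 by (intro mult_mono) (auto simp: good_def)
        qed
        then show "norm (H (D (Suc m)) k z - H (D m) k z) \<le> n * (q m * K)"
          by (simp add: H_def sum_subtractf scaleR_left_diff_distrib)
      qed
      also have "\<dots> \<le> q (Suc m)"
        using mult_right_mono[OF small' q0[of m]] by (simp add: qSuc algebra_simps)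
      finally show ?thesis by (simp add: DSuc abs_minus_commute)
    qed
    then have "good (Suc m) G" using G E by (simp add: good_def)
    then show ?case by blast
  qed
  then obtain g where g: "\<And>m. good m (g m)" by metis
  \<comment> \<open>The limit of the iterates, as the sum of their differences.\<close>
  define C where "C = (\<lambda>k y. \<Sum>m. D (Suc m) k y - D m k y)"
  have unif: "uniform_limit ?B (\<lambda>m. D m k) (C k) sequentially" if "k < n" for k
  proof -
    have "uniform_limit ?B (\<lambda>m y. \<Sum>j<m. D (Suc j) k y - D j k y) (C k) sequentially"
      unfolding C_def
    proof (rule Weierstrass_m_test)
      show "norm (D (Suc m) k y - D m k y) \<le> q m" if "y \<in> ?B" for m y
        using g[of m] that \<open>k < n\<close> by (simp add: good_def)
      show "summable q" unfolding q_def by (intro summable_mult summable_geometric) simp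
    qed
    moreover have "(\<Sum>j<m. D (Suc j) k y - D j k y) = D m k y" for m y
      by (simp add: sum_lessThan_telescope[of "\<lambda>j. D j k y"] D0)
    ultimately show ?thesis by simp
  qed
  have qlim: "q \<longlonglongrightarrow> 0" unfolding q_def by (intro tendsto_mult_right_zero LIMSEQ_power_zero) simp
  have lim: "(\<lambda>m. D m k y) \<longlonglongrightarrow> C k y" if "k < n" "y \<in> ?B" for k y
    by (rule tendsto_uniform_limitI[OF unif[OF that(1)] that(2)])
  have der: "(C k has_derivative (\<lambda>v. - (v \<bullet> H C k y))) (at y)" if k: "k < n" and y: "y \<in> ?B" for k y
  proof -
    have "\<exists>h. \<forall>x\<in>?B. (\<lambda>m. D (Suc m) k x) \<longlonglongrightarrow> h x \<and> (h has_derivative (\<lambda>v. - (v \<bullet> H C k x))) (at x within ?B)"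
    proof (rule has_derivative_sequence[where f' = "\<lambda>m x v. v \<bullet> g m k x" and l = "C k y"])
      show "(D (Suc m) k has_derivative (\<lambda>v. v \<bullet> g m k x)) (at x within ?B)" if "x \<in> ?B" for m x
        by (rule has_derivative_at_withinI) (use g[of m] k that in \<open>auto simp: good_def C1_def\<close>)
      show "(\<lambda>m. D (Suc m) k y) \<longlonglongrightarrow> C k y" using lim[OF k y] by (rule LIMSEQ_Suc)
      fix e :: real assume e: "e > 0"
      define X where "X = n * K + 1"
      define e' where "e' = e / 2 / X"
      have X: "0 < X" using K0 by (simp add: X_def add_nonneg_pos)
      have e': "e' > 0" using e X by (simp add: e'_def)
      have "\<forall>\<^sub>F m in sequentially. \<forall>i\<in>{..<n}. \<forall>x\<in>?B. dist (D m i x) (C i x) < e'"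
        using unif e' by (intro eventually_ball_finite) (auto simp: uniform_limit_iff)
      moreover have "\<forall>\<^sub>F m in sequentially. q m < e / 2"
        using order_tendstoD(2)[OF qlim, of "e / 2"] e by simp
      ultimately show "\<forall>\<^sub>F m in sequentially. \<forall>x\<in>?B. \<forall>v. norm (v \<bullet> g m k x - - (v \<bullet> H C k x)) \<le> e * norm v"
      proof eventually_elim
        case (elim m)
        show ?case
        proof (intro ballI allI)
          fix x v :: 'e assume x: "x \<in> ?B"
          have "norm (\<Sum>i<n. (C i x - D m i x) *\<^sub>R \<Omega> i k x) \<le> card {..<n} * (e' * K)"
          proof (rule sum_norm_bound)
            fix i assume i: "i \<in> {..<n}"
            then have "dist (D m i x) (C i x) < e'" using elim(1) x by blast
            then have "\<bar>C i x - D m i x\<bar> \<le> e'" by (simp add: dist_real_def abs_minus_commute)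
            then show "norm ((C i x - D m i x) *\<^sub>R \<Omega> i k x) \<le> e' * K"
              unfolding norm_scaleR real_norm_def using K x k i e' by (intro mult_mono) auto
          qed
          also have "\<dots> \<le> e' * X" using e' by (simp add: X_def algebra_simps)
          also have "\<dots> = e / 2" using X by (simp add: e'_def)
          finally have "norm (H C k x - H (D m) k x) \<le> e / 2"
            by (simp add: H_def sum_subtractf scaleR_left_diff_distrib)
          then have "norm v * norm (H C k x - H (D m) k x) \<le> norm v * (e / 2)" by (rule mult_left_mono) simp
          then have "\<bar>v \<bullet> (H C k x - H (D m) k x)\<bar> \<le> norm v * (e / 2)"
            using Cauchy_Schwarz_ineq2[of v "H C k x - H (D m) k x"] by linarith
          moreover have "\<bar>v \<bullet> g m k x + v \<bullet> H (D m) k x\<bar> \<le> q m * norm v"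
            using g[of m] k x by (simp add: good_def)
          moreover have "q m * norm v \<le> (e / 2) * norm v" using elim(2) by (intro mult_right_mono) auto
          ultimately have "\<bar>v \<bullet> g m k x + v \<bullet> H C k x\<bar> \<le> norm v * (e / 2) + (e / 2) * norm v"
            unfolding inner_diff_right by linarith
          then show "norm (v \<bullet> g m k x - - (v \<bullet> H C k x)) \<le> e * norm v" by (simp add: algebra_simps)
        qed
      qed
    qed (use y in auto)
    then obtain h where h: "\<And>x. x \<in> ?B \<Longrightarrow> (\<lambda>m. D (Suc m) k x) \<longlonglongrightarrow> h x"
      "\<And>x. x \<in> ?B \<Longrightarrow> (h has_derivative (\<lambda>v. - (v \<bullet> H C k x))) (at x within ?B)" by blast
    have "h x = C k x" if "x \<in> ?B" for x
      using LIMSEQ_unique[OF h(1)[OF that] LIMSEQ_Suc[OF lim[OF k that]]] .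
    then show ?thesis
      using has_derivative_cong_open[OF open_ball y, of h "C k"] h(2)[OF y] at_within_open[OF y open_ball] by auto
  qed
  have "C k p = c k" if k: "k < n" for k
  proof -
    have "D (Suc m) k p = c k" for m by (simp add: DSuc radial_primitive_def)
    then have "(\<lambda>m. D (Suc m) k p) \<longlonglongrightarrow> c k" by simp
    moreover have "p \<in> ?B" using R by simp
    ultimately show ?thesis using LIMSEQ_unique LIMSEQ_Suc[OF lim[OF k]] by blast
  qed
  then show ?thesis using der unfolding H_def by blast
qed

text \<open>The system with smooth coefficients. Once a solution is differentiable, the equation itself
  raises its order of differentiability.\<close>

lemma flat_system_solution:
  fixes \<Omega> :: "nat \<Rightarrow> nat \<Rightarrow> 'e::euclidean_space \<Rightarrow> 'e"
  assumes S: "open S" "p \<in> S"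
    and smooth: "\<And>i k b m. i < n \<Longrightarrow> k < n \<Longrightarrow> b \<in> Basis \<Longrightarrow> Ck_on m (\<lambda>y. \<Omega> i k y \<bullet> b) S"
    and flat: "\<And>i k y a b. i < n \<Longrightarrow> k < n \<Longrightarrow> y \<in> S \<Longrightarrow> a \<in> Basis \<Longrightarrow> b \<in> Basis \<Longrightarrow>
      frechet_derivative (\<lambda>y. \<Omega> i k y \<bullet> b) (at y) a - frechet_derivative (\<lambda>y. \<Omega> i k y \<bullet> a) (at y) b
      = (\<Sum>j<n. (\<Omega> i j y \<bullet> a) * (\<Omega> j k y \<bullet> b) - (\<Omega> i j y \<bullet> b) * (\<Omega> j k y \<bullet> a))"
  shows "\<exists>R>0. ball p R \<subseteq> S \<and> (\<exists>C. \<forall>k<n. C k p = c k \<and> (\<forall>m. Ck_on m (C k) (ball p R)) \<and>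
    (\<forall>y\<in>ball p R. (C k has_derivative (\<lambda>v. - (\<Sum>i<n. C i y * (\<Omega> i k y \<bullet> v)))) (at y)))"
proof -
  define d\<Omega> where "d\<Omega> = (\<lambda>i k y v. \<Sum>b\<in>Basis. frechet_derivative (\<lambda>y. \<Omega> i k y \<bullet> b) (at y) v *\<^sub>R b)"
  have f: "((\<lambda>y. \<Omega> i k y \<bullet> b) has_derivative frechet_derivative (\<lambda>y. \<Omega> i k y \<bullet> b) (at y)) (at y)"
    if "i < n" "k < n" "b \<in> Basis" "y \<in> S" for i k b y
    by (rule Ck_on_SucD[OF smooth[OF that(1,2,3), of "Suc 0"] that(4)])
  have d: "(\<Omega> i k has_derivative d\<Omega> i k y) (at y)" if "i < n" "k < n" "y \<in> S" for i k y
    unfolding has_derivative_componentwise_within[of "\<Omega> i k"] d\<Omega>_def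
    using f[OF that(1,2) _ that(3)] by simp
  have cd: "continuous_on S (\<lambda>y. d\<Omega> i k y v)" if "i < n" "k < n" for i k v
    unfolding d\<Omega>_def using smooth[OF that, of _ "Suc 0"] by (intro continuous_intros) simp
  have flat': "d\<Omega> i k y v \<bullet> w - d\<Omega> i k y w \<bullet> v
      = (\<Sum>j<n. (\<Omega> i j y \<bullet> v) * (\<Omega> j k y \<bullet> w) - (\<Omega> i j y \<bullet> w) * (\<Omega> j k y \<bullet> v))"
    if "i < n" "k < n" "y \<in> S" for i k y v w
  proof -
    have l: "linear (d\<Omega> i k y)" using d[OF that] has_derivative_linear by blast
    have "(\<lambda>v w. d\<Omega> i k y v \<bullet> w - d\<Omega> i k y w \<bullet> v)
        = (\<lambda>v w. \<Sum>j<n. (\<Omega> i j y \<bullet> v) * (\<Omega> j k y \<bullet> w) - (\<Omega> i j y \<bullet> w) * (\<Omega> j k y \<bullet> v))"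
    proof (rule bilinear_eq_stdbasis)
      show "bilinear (\<lambda>v w. d\<Omega> i k y v \<bullet> w - d\<Omega> i k y w \<bullet> v)"
        unfolding bilinear_def linear_iff
        by (simp add: linear_add[OF l] linear_scale[OF l] inner_add_left inner_add_right right_diff_distrib)
      show "bilinear (\<lambda>v w. \<Sum>j<n. (\<Omega> i j y \<bullet> v) * (\<Omega> j k y \<bullet> w) - (\<Omega> i j y \<bullet> w) * (\<Omega> j k y \<bullet> v))"
        unfolding bilinear_def linear_iff
        by (simp add: inner_add_right sum.distrib[symmetric] sum_distrib_left algebra_simps)
      show "d\<Omega> i k y a \<bullet> b - d\<Omega> i k y b \<bullet> a
          = (\<Sum>j<n. (\<Omega> i j y \<bullet> a) * (\<Omega> j k y \<bullet> b) - (\<Omega> i j y \<bullet> b) * (\<Omega> j k y \<bullet> a))"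
        if "a \<in> Basis" "b \<in> Basis" for a b
        using flat[OF \<open>i < n\<close> \<open>k < n\<close> \<open>y \<in> S\<close> that] that by (simp add: d\<Omega>_def)
    qed
    then show ?thesis by metis
  qed
  obtain r where r: "r > 0" "cball p r \<subseteq> S" using S open_contains_cball by blast
  have "\<exists>K. \<forall>y\<in>cball p r. \<forall>i<n. \<forall>k<n. norm (\<Omega> i k y) \<le> K"
  proof -
    have "continuous_on (cball p r) (\<Omega> i k)" if "i < n" "k < n" for i k
      by (rule differentiable_continuous_on) (use d[OF that] r in blast)
    then have "continuous_on (cball p r) (\<lambda>y. \<Sum>i<n. \<Sum>k<n. norm (\<Omega> i k y))"
      by (intro continuous_intros) auto
    then have "bounded ((\<lambda>y. \<Sum>i<n. \<Sum>k<n. norm (\<Omega> i k y)) ` cball p r)"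
      by (intro compact_imp_bounded compact_continuous_image) auto
    then obtain K where K: "\<And>y. y \<in> cball p r \<Longrightarrow> norm (\<Sum>i<n. \<Sum>k<n. norm (\<Omega> i k y)) \<le> K"
      unfolding bounded_iff by blast
    have "norm (\<Omega> i k y) \<le> K" if "y \<in> cball p r" "i < n" "k < n" for i k y
    proof -
      have "norm (\<Omega> i k y) \<le> (\<Sum>k<n. norm (\<Omega> i k y))"
        by (rule member_le_sum) (use that in auto)
      also have "\<dots> \<le> (\<Sum>i<n. \<Sum>k<n. norm (\<Omega> i k y))"
        by (rule member_le_sum[where f = "\<lambda>i. \<Sum>k<n. norm (\<Omega> i k y)"]) (use that in \<open>auto intro: sum_nonneg\<close>)
      finally show ?thesis using K[OF that(1)] by simp
    qed
    then show ?thesis by blast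
  qed
  then obtain K0 where K0: "\<And>y i k. y \<in> cball p r \<Longrightarrow> i < n \<Longrightarrow> k < n \<Longrightarrow> norm (\<Omega> i k y) \<le> K0" by blast
  define K where "K = max K0 0"
  define Q where "Q = 2 * real n * real n * K * K + 2 * real n * K + 1"
  define R where "R = min r (1 / (2 * Q))"
  have Q: "Q > 0" unfolding Q_def K_def by (intro add_nonneg_pos add_nonneg_nonneg mult_nonneg_nonneg) auto
  have R: "R > 0" "R \<le> r" "R * Q \<le> 1 / 2"
    using r Q by (auto simp: R_def min_def field_simps)
  have sub: "ball p R \<subseteq> S" "ball p R \<subseteq> cball p r" using r R by auto
  have "R * (2 * real n * real n * K * K + 2 * real n * K) \<le> 1 / 2"
    using R unfolding Q_def distrib_left[of R _ 1] by linarith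
  then have "\<exists>C. \<forall>k<n. C k p = c k \<and> (\<forall>y\<in>ball p R.
      (C k has_derivative (\<lambda>v. - (v \<bullet> (\<Sum>i<n. C i y *\<^sub>R \<Omega> i k y)))) (at y))"
  proof (intro flat_system_on_ball[where d\<Omega> = d\<Omega> and K = K] R(1))
    show "(\<Omega> i k has_derivative d\<Omega> i k y) (at y)" if "i < n" "k < n" "y \<in> ball p R" for i k y
      using d that sub(1) by blast
    show "continuous_on (ball p R) (\<lambda>y. d\<Omega> i k y v)" if "i < n" "k < n" for i k v
      using continuous_on_subset[OF cd[OF that] sub(1)] .
    show "norm (\<Omega> i k y) \<le> K" if "i < n" "k < n" "y \<in> ball p R" for i k y
      using K0[of y i k] that sub(2) by (fastforce simp: K_def le_max_iff_disj)
    show "d\<Omega> i k y v \<bullet> w - d\<Omega> i k y w \<bullet> v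
      = (\<Sum>j<n. (\<Omega> i j y \<bullet> v) * (\<Omega> j k y \<bullet> w) - (\<Omega> i j y \<bullet> w) * (\<Omega> j k y \<bullet> v))"
      if "i < n" "k < n" "y \<in> ball p R" for i k y v w
      using flat' that sub(1) by blast
  qed (simp add: K_def)
  then obtain C where C: "\<And>k. k < n \<Longrightarrow> C k p = c k"
    "\<And>k y. k < n \<Longrightarrow> y \<in> ball p R \<Longrightarrow> (C k has_derivative (\<lambda>v. - (v \<bullet> (\<Sum>i<n. C i y *\<^sub>R \<Omega> i k y)))) (at y)"
    by blast
  have C': "(C k has_derivative (\<lambda>v. - (\<Sum>i<n. C i y * (\<Omega> i k y \<bullet> v)))) (at y)" if "k < n" "y \<in> ball p R" for k y
    using C(2)[OF that] by (simp add: inner_sum_right inner_commute)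
  have "Ck_on m (C k) (ball p R)" if "k < n" for k m
    using that
  proof (induction m arbitrary: k)
    case 0
    show ?case unfolding Ck_on.simps by (rule differentiable_continuous_on) (rule C'[OF 0])
  next
    case (Suc m)
    show ?case
    proof (rule Ck_on_SucI[OF open_ball C'[OF Suc.prems]])
      fix v
      have "Ck_on m (\<lambda>y. \<Sum>i<n. (- 1) * (C i y * (\<Sum>b\<in>Basis. (v \<bullet> b) * (\<Omega> i k y \<bullet> b)))) (ball p R)"
        using Suc Ck_on_subset[OF smooth sub(1)]
        by (intro Ck_on_sum[OF open_ball] Ck_on_mult[OF open_ball] Ck_on_const) auto
      moreover have "(\<Sum>b\<in>Basis. (v \<bullet> b) * (\<Omega> i k y \<bullet> b)) = \<Omega> i k y \<bullet> v" for i y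
        by (subst euclidean_inner) (simp add: mult.commute)
      ultimately show "Ck_on m (\<lambda>y. - (\<Sum>i<n. C i y * (\<Omega> i k y \<bullet> v))) (ball p R)" by (simp add: sum_negf)
    qed
  qed
  then show ?thesis using R(1) sub(1) C(1) C' by blast
qed

section \<open>Smooth functions and tangent vectors in a chart\<close>

locale smooth_manifold =
  fixes A :: "('m::{t2_space,second_countable_topology}, 'e::euclidean_space) atlas"
  assumes atlas: "smooth_atlas A"
begin

lemma chart_exists: "\<exists>D \<phi>. (D, \<phi>) \<in> A \<and> x \<in> D"
proof -
  have "(\<Union>(D, \<phi>)\<in>A. D) = UNIV" using atlas by (simp add: smooth_atlas_def)
  then show ?thesis by (metis (mono_tags, lifting) UNIV_I UN_E case_prod_conv old.prod.exhaust)
qed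

lemma chart_homeomorphism:
  assumes "(D, \<phi>) \<in> A"
  shows "open D" "open (\<phi> ` D)" "homeomorphism D (\<phi> ` D) \<phi> (inv_into D \<phi>)"
proof -
  have "\<forall>(D, \<phi>)\<in>A. open D \<and> open (\<phi> ` D) \<and> homeomorphism D (\<phi> ` D) \<phi> (inv_into D \<phi>)"
    using atlas by (simp add: smooth_atlas_def)
  then show "open D" "open (\<phi> ` D)" "homeomorphism D (\<phi> ` D) \<phi> (inv_into D \<phi>)" using assms by auto
qed

lemma chart_inv [simp]: "(D, \<phi>) \<in> A \<Longrightarrow> y \<in> D \<Longrightarrow> inv_into D \<phi> (\<phi> y) = y"
  by (metis chart_homeomorphism(3) homeomorphism_apply1)

lemma chart_continuous: "(D, \<phi>) \<in> A \<Longrightarrow> continuous_on D \<phi>"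
  using chart_homeomorphism(3) homeomorphism_def by blast

lemma chart_image_open:
  assumes "(D, \<phi>) \<in> A" "open V"
  shows "open (\<phi> ` (D \<inter> V))"
proof -
  have "openin (top_of_set (\<phi> ` D)) (\<phi> ` (D \<inter> V))"
    by (rule homeomorphism_imp_open_map[OF chart_homeomorphism(3)[OF assms(1)]])
      (simp add: assms(2) openin_open_Int)
  then show ?thesis using chart_homeomorphism(2)[OF assms(1)] openin_open_trans by blast
qed

lemma transition_smooth:
  assumes "(D, \<phi>) \<in> A" "(E, \<psi>) \<in> A"
  shows "Ck_on k (\<lambda>p. \<psi> (inv_into D \<phi> p)) (\<phi> ` (D \<inter> E))"
proof -
  have "\<forall>(D, \<phi>)\<in>A. \<forall>(E, \<psi>)\<in>A. smooth_on (\<psi> \<circ> inv_into D \<phi>) (\<phi> ` (D \<inter> E))"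
    using atlas by (simp add: smooth_atlas_def)
  then have "smooth_on (\<psi> \<circ> inv_into D \<phi>) (\<phi> ` (D \<inter> E))" using assms by auto
  then show ?thesis by (simp add: smooth_on_def comp_def)
qed

lemma smooth_funI:
  assumes "\<And>D \<phi> k. (D, \<phi>) \<in> A \<Longrightarrow> Ck_on k (\<lambda>p. f (inv_into D \<phi> p)) (\<phi> ` (D \<inter> U))"
  shows "smooth_fun A U f"
  using assms by (auto simp: smooth_fun_def smooth_on_def comp_def)

lemma smooth_funD:
  assumes "smooth_fun A U f" "(D, \<phi>) \<in> A"
  shows "Ck_on k (\<lambda>p. f (inv_into D \<phi> p)) (\<phi> ` (D \<inter> U))"
  using assms by (auto simp: smooth_fun_def smooth_on_def comp_def)

lemma smooth_fun_subset: "smooth_fun A U f \<Longrightarrow> V \<subseteq> U \<Longrightarrow> smooth_fun A V f"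
  by (rule smooth_funI) (metis Ck_on_subset smooth_funD Int_mono image_mono order_refl)

lemma smooth_fun_cong:
  assumes "open U" "\<And>y. y \<in> U \<Longrightarrow> f y = g y"
  shows "smooth_fun A U f \<longleftrightarrow> smooth_fun A U g"
proof -
  have "Ck_on k (\<lambda>p. f (inv_into D \<phi> p)) (\<phi> ` (D \<inter> U))
      \<longleftrightarrow> Ck_on k (\<lambda>p. g (inv_into D \<phi> p)) (\<phi> ` (D \<inter> U))" if "(D, \<phi>) \<in> A" for D \<phi> k
    by (rule Ck_on_cong[OF chart_image_open[OF that assms(1)]]) (use assms(2) that in auto)
  then show ?thesis by (metis smooth_funD smooth_funI)
qed

lemma smooth_fun_const: "smooth_fun A U (\<lambda>y. c)"
  by (rule smooth_funI) (rule Ck_on_const)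

lemma smooth_fun_add:
  assumes "open U" "smooth_fun A U f" "smooth_fun A U g"
  shows "smooth_fun A U (\<lambda>y. f y + g y)"
  by (rule smooth_funI, rule Ck_on_add[OF chart_image_open[OF _ assms(1)]
        smooth_funD[OF assms(2)] smooth_funD[OF assms(3)]])

lemma smooth_fun_mult:
  assumes "open U" "smooth_fun A U f" "smooth_fun A U g"
  shows "smooth_fun A U (\<lambda>y. f y * g y)"
  by (rule smooth_funI, rule Ck_on_mult[OF chart_image_open[OF _ assms(1)]
        smooth_funD[OF assms(2)] smooth_funD[OF assms(3)]])

lemma smooth_fun_diff:
  assumes "open U" "smooth_fun A U f" "smooth_fun A U g"
  shows "smooth_fun A U (\<lambda>y. f y - g y)"
  using smooth_fun_add[OF assms(1,2) smooth_fun_mult[OF assms(1) smooth_fun_const[of U "-1"] assms(3)]]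
  by simp

lemma smooth_fun_divide:
  assumes "open U" "smooth_fun A U f" "smooth_fun A U g" "\<And>y. y \<in> U \<Longrightarrow> g y \<noteq> 0"
  shows "smooth_fun A U (\<lambda>y. f y / g y)"
proof -
  have "smooth_fun A U (\<lambda>y. inverse (g y))"
    by (rule smooth_funI, rule Ck_on_inverse[OF chart_image_open[OF _ assms(1)] smooth_funD[OF assms(3)]])
      (use assms(4) in auto)
  then show ?thesis unfolding divide_inverse by (rule smooth_fun_mult[OF assms(1,2)])
qed

lemma smooth_fun_sum:
  assumes "open U" "finite I" "\<And>i. i \<in> I \<Longrightarrow> smooth_fun A U (f i)"
  shows "smooth_fun A U (\<lambda>y. \<Sum>i\<in>I. f i y)"
  using assms(2,3) by (induction I) (auto simp: smooth_fun_const intro!: smooth_fun_add[OF assms(1)])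

text \<open>Smoothness in the coordinates of a single chart suffices: passing to another chart
  composes with a transition map.\<close>

lemma smooth_fun_chartI:
  assumes c: "(D, \<phi>) \<in> A" and V: "open V" "V \<subseteq> D"
    and f: "\<And>k. Ck_on k (\<lambda>p. f (inv_into D \<phi> p)) (\<phi> ` V)"
  shows "smooth_fun A V f"
proof (rule smooth_funI)
  fix E \<psi> k assume e: "(E, \<psi>) \<in> A"
  let ?S = "\<psi> ` (E \<inter> V)"
  have S: "open ?S" by (rule chart_image_open[OF e V(1)])
  have "Ck_on k (\<lambda>p. \<phi> (inv_into E \<psi> p)) ?S"
    by (rule Ck_on_subset[OF transition_smooth[OF e c]]) (use V in auto)
  moreover have "(\<lambda>p. \<phi> (inv_into E \<psi> p)) ` ?S \<subseteq> \<phi> ` V" using e by auto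
  ultimately have "Ck_on k (\<lambda>p. f (inv_into D \<phi> (\<phi> (inv_into E \<psi> p)))) ?S"
    by (rule Ck_on_compose[OF S _ f])
  moreover have "f (inv_into D \<phi> (\<phi> (inv_into E \<psi> p))) = f (inv_into E \<psi> p)" if "p \<in> ?S" for p
    using that c e V by auto
  ultimately show "Ck_on k (\<lambda>p. f (inv_into E \<psi> p)) ?S"
    using Ck_on_cong[OF S, of "\<lambda>p. f (inv_into D \<phi> (\<phi> (inv_into E \<psi> p)))" "\<lambda>p. f (inv_into E \<psi> p)"]
    by blast
qed

lemma smooth_fun_coordinate:
  assumes c: "(D, \<phi>) \<in> A"
  shows "smooth_fun A D (\<lambda>y. \<phi> y \<bullet> b)"
proof (rule smooth_fun_chartI[OF c chart_homeomorphism(1)[OF c] order_refl])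
  fix k
  have "Ck_on k (\<lambda>p. p \<bullet> b) (\<phi> ` D)"
    by (intro Ck_on_linear chart_homeomorphism[OF c] bounded_linear_inner_left)
  moreover have "p \<bullet> b = \<phi> (inv_into D \<phi> p) \<bullet> b" if "p \<in> \<phi> ` D" for p
    using that c by auto
  ultimately show "Ck_on k (\<lambda>p. \<phi> (inv_into D \<phi> p) \<bullet> b) (\<phi> ` D)"
    using Ck_on_cong[OF chart_homeomorphism(2)[OF c], of "\<lambda>p. p \<bullet> b" "\<lambda>p. \<phi> (inv_into D \<phi> p) \<bullet> b"]
    by blast
qed

lemma smooth_fun_continuous_on:
  assumes "smooth_fun A U f" "open U"
  shows "continuous_on U f"
proof (rule continuous_at_imp_continuous_on, intro ballI)
  fix x assume x: "x \<in> U"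
  obtain D \<phi> where c: "(D, \<phi>) \<in> A" "x \<in> D" using chart_exists by blast
  have o: "open (D \<inter> U)" using assms(2) chart_homeomorphism(1)[OF c(1)] by auto
  have "continuous_on (\<phi> ` (D \<inter> U)) (\<lambda>p. f (inv_into D \<phi> p))"
    using smooth_funD[OF assms(1) c(1), of 0] by simp
  moreover have "continuous_on (D \<inter> U) \<phi>"
    using chart_continuous[OF c(1)] continuous_on_subset by blast
  ultimately have "continuous_on (D \<inter> U) (\<lambda>y. f (inv_into D \<phi> (\<phi> y)))"
    by (auto intro: continuous_on_compose2)
  moreover have "continuous_on (D \<inter> U) (\<lambda>y. f (inv_into D \<phi> (\<phi> y))) \<longleftrightarrow> continuous_on (D \<inter> U) f"
    by (rule continuous_on_cong) (use c in auto)
  ultimately have "continuous_on (D \<inter> U) f" by simp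
  then show "isCont f x" using o x c continuous_on_eq_continuous_at by blast
qed

lemma smooth_nearI: "open U \<Longrightarrow> x \<in> U \<Longrightarrow> smooth_fun A U f \<Longrightarrow> smooth_near A x f"
  by (auto simp: smooth_near_def)

lemma smooth_near_pair:
  assumes "smooth_near A x f" "smooth_near A x g"
  obtains U where "open U" "x \<in> U" "smooth_fun A U f" "smooth_fun A U g"
proof -
  obtain V W where "open V" "x \<in> V" "smooth_fun A V f" "open W" "x \<in> W" "smooth_fun A W g"
    using assms by (auto simp: smooth_near_def)
  then show ?thesis by (intro that[of "V \<inter> W"]) (auto intro: smooth_fun_subset)
qed

lemma smooth_near_cong:
  assumes "open U" "x \<in> U" "\<And>y. y \<in> U \<Longrightarrow> f y = g y"
  shows "smooth_near A x f \<longleftrightarrow> smooth_near A x g"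
proof -
  have "smooth_near A x g" if "smooth_near A x f" "\<And>y. y \<in> U \<Longrightarrow> f y = g y" for f g
  proof -
    obtain V where "open V" "x \<in> V" "smooth_fun A V f" using \<open>smooth_near A x f\<close> by (auto simp: smooth_near_def)
    then have "smooth_fun A (U \<inter> V) f" by (auto intro: smooth_fun_subset)
    then have "smooth_fun A (U \<inter> V) g"
      using smooth_fun_cong[of "U \<inter> V" f g] that assms(1) \<open>open V\<close> by (simp add: open_Int)
    then show ?thesis using assms \<open>open V\<close> \<open>x \<in> V\<close> by (auto intro: smooth_nearI[of "U \<inter> V"])
  qed
  then show ?thesis using assms by metis
qed

lemma smooth_near_differentiable:
  assumes "smooth_near A x f" "(D, \<phi>) \<in> A" "x \<in> D"
  shows "((\<lambda>p. f (inv_into D \<phi> p)) has_derivative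
    frechet_derivative (\<lambda>p. f (inv_into D \<phi> p)) (at (\<phi> x))) (at (\<phi> x))"
proof -
  obtain U where "open U" "x \<in> U" "smooth_fun A U f" using assms by (auto simp: smooth_near_def)
  then show ?thesis
    using Ck_on_SucD[OF smooth_funD[OF _ assms(2), of U f "Suc 0"]] assms by auto
qed

lemma coord_vec_eq:
  "smooth_near A x f \<Longrightarrow> coord_vec A (D, \<phi>) e x f
     = frechet_derivative (\<lambda>p. f (inv_into D \<phi> p)) (at (\<phi> x)) e"
  by (simp add: coord_vec_def comp_def)

lemma coord_vec_linear:
  assumes "(D, \<phi>) \<in> A" "x \<in> D"
  shows "linear (\<lambda>e. coord_vec A (D, \<phi>) e x f)"
proof (cases "smooth_near A x f")
  case True
  then show ?thesis
    using has_derivative_linear[OF smooth_near_differentiable[OF True assms]] by (simp add: coord_vec_eq)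
next
  case False
  then show ?thesis by (simp add: coord_vec_def linear_iff)
qed

lemma coord_vec_coordinate:
  assumes c: "(D, \<phi>) \<in> A" "x \<in> D"
  shows "coord_vec A (D, \<phi>) e x (\<lambda>y. \<phi> y \<bullet> b) = e \<bullet> b"
proof -
  have s: "smooth_near A x (\<lambda>y. \<phi> y \<bullet> b)"
    using c smooth_fun_coordinate chart_homeomorphism(1) by (metis smooth_nearI)
  have "frechet_derivative (\<lambda>p. \<phi> (inv_into D \<phi> p) \<bullet> b) (at (\<phi> x))
      = frechet_derivative (\<lambda>p. p \<bullet> b) (at (\<phi> x))"
    by (rule frechet_derivative_cong_open[OF chart_homeomorphism(2)[OF c(1)]]) (use c in auto)
  also have "\<dots> = (\<lambda>e. e \<bullet> b)"
    by (rule frechet_derivative_at[symmetric])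
      (rule bounded_linear_imp_has_derivative[OF bounded_linear_inner_left])
  finally show ?thesis using coord_vec_eq[OF s] by metis
qed

text \<open>The chain rule for a transition map.\<close>

lemma coord_vec_change_chart:
  assumes c: "(D, \<phi>) \<in> A" "x \<in> D" and c': "(E, \<psi>) \<in> A" "x \<in> E"
  shows "\<exists>e'. coord_vec A (E, \<psi>) e x = coord_vec A (D, \<phi>) e' x"
proof -
  define \<tau> where "\<tau> = (\<lambda>p. \<phi> (inv_into E \<psi> p))"
  define e' where "e' = frechet_derivative \<tau> (at (\<psi> x)) e"
  have \<tau>x: "\<tau> (\<psi> x) = \<phi> x" using c' by (simp add: \<tau>_def)
  have \<tau>: "(\<tau> has_derivative frechet_derivative \<tau> (at (\<psi> x))) (at (\<psi> x))"
    unfolding \<tau>_def by (rule Ck_on_SucD[OF transition_smooth[OF c'(1) c(1), of "Suc 0"]]) (use c c' in auto)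
  have "coord_vec A (E, \<psi>) e x f = coord_vec A (D, \<phi>) e' x f" for f
  proof (cases "smooth_near A x f")
    case True
    let ?f = "\<lambda>p. f (inv_into D \<phi> p)"
    have "((\<lambda>p. ?f (\<tau> p)) has_derivative
        (\<lambda>v. frechet_derivative ?f (at (\<phi> x)) (frechet_derivative \<tau> (at (\<psi> x)) v))) (at (\<psi> x))"
      using has_derivative_compose[where f = \<tau> and g = ?f, OF \<tau>] smooth_near_differentiable[OF True c]
      by (simp add: \<tau>x)
    moreover have "?f (\<tau> p) = f (inv_into E \<psi> p)" if "p \<in> \<psi> ` (E \<inter> D)" for p
      using that c c' by (auto simp: \<tau>_def)
    ultimately have "((\<lambda>p. f (inv_into E \<psi> p)) has_derivative
        (\<lambda>v. frechet_derivative ?f (at (\<phi> x)) (frechet_derivative \<tau> (at (\<psi> x)) v))) (at (\<psi> x))"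
      using has_derivative_cong_open[OF chart_image_open[OF c'(1) chart_homeomorphism(1)[OF c(1)]],
        of "\<psi> x" "\<lambda>p. ?f (\<tau> p)" "\<lambda>p. f (inv_into E \<psi> p)"] c c' by blast
    then have "frechet_derivative (\<lambda>p. f (inv_into E \<psi> p)) (at (\<psi> x)) e = frechet_derivative ?f (at (\<phi> x)) e'"
      unfolding e'_def by (metis frechet_derivative_at)
    then show ?thesis by (simp add: coord_vec_eq[OF True])
  qed (simp add: coord_vec_def)
  then show ?thesis by blast
qed

lemma tangent_space_chart:
  assumes "(D, \<phi>) \<in> A" "x \<in> D"
  shows "tangent_space A x = range (\<lambda>e. coord_vec A (D, \<phi>) e x)"
  unfolding tangent_space_def using assms coord_vec_change_chart[OF assms] by fastforce

lemma coord_vec_in_tangent [simp]: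
  "(D, \<phi>) \<in> A \<Longrightarrow> x \<in> D \<Longrightarrow> coord_vec A (D, \<phi>) e x \<in> tangent_space A x"
  by (simp add: tangent_space_chart)

lemma tangent_rep:
  assumes c: "(D, \<phi>) \<in> A" "x \<in> D" and u: "u \<in> tangent_space A x"
  shows "u = coord_vec A (D, \<phi>) (\<Sum>b\<in>Basis. u (\<lambda>y. \<phi> y \<bullet> b) *\<^sub>R b) x"
    and "u f = (\<Sum>b\<in>Basis. u (\<lambda>y. \<phi> y \<bullet> b) * coord_vec A (D, \<phi>) b x f)"
proof -
  obtain e where e: "u = coord_vec A (D, \<phi>) e x" using u tangent_space_chart[OF c] by auto
  show 1: "u = coord_vec A (D, \<phi>) (\<Sum>b\<in>Basis. u (\<lambda>y. \<phi> y \<bullet> b) *\<^sub>R b) x"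
    unfolding e coord_vec_coordinate[OF c] euclidean_representation ..
  interpret L: linear "\<lambda>e. coord_vec A (D, \<phi>) e x f" by (rule coord_vec_linear[OF c])
  show "u f = (\<Sum>b\<in>Basis. u (\<lambda>y. \<phi> y \<bullet> b) * coord_vec A (D, \<phi>) b x f)"
    by (subst 1) (simp add: L.sum L.scale)
qed

lemma
  shows tangent_tadd: "u \<in> tangent_space A x \<Longrightarrow> v \<in> tangent_space A x \<Longrightarrow> tadd u v \<in> tangent_space A x"
    and tangent_tscale: "u \<in> tangent_space A x \<Longrightarrow> tscale r u \<in> tangent_space A x"
    and tangent_tzero: "tzero \<in> tangent_space A x"
proof -
  obtain D \<phi> where c: "(D, \<phi>) \<in> A" "x \<in> D" using chart_exists by blast
  note L = coord_vec_linear[OF c]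
  have "tadd (coord_vec A (D, \<phi>) e x) (coord_vec A (D, \<phi>) e' x) = coord_vec A (D, \<phi>) (e + e') x" for e e'
    by (rule ext) (simp add: tadd_def linear_add[OF L])
  then show "u \<in> tangent_space A x \<Longrightarrow> v \<in> tangent_space A x \<Longrightarrow> tadd u v \<in> tangent_space A x"
    unfolding tangent_space_chart[OF c] by auto
  have "tscale r (coord_vec A (D, \<phi>) e x) = coord_vec A (D, \<phi>) (r *\<^sub>R e) x" for e
    by (rule ext) (simp add: tscale_def linear_scale[OF L])
  then show "u \<in> tangent_space A x \<Longrightarrow> tscale r u \<in> tangent_space A x"
    unfolding tangent_space_chart[OF c] by auto
  have "tzero = coord_vec A (D, \<phi>) 0 x" by (rule ext) (simp add: tzero_def linear_0[OF L])
  then show "tzero \<in> tangent_space A x" using coord_vec_in_tangent[OF c] by metis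
qed

lemma tangent_sum:
  assumes "finite I" "\<And>i. i \<in> I \<Longrightarrow> v i \<in> tangent_space A x"
  shows "(\<lambda>f. \<Sum>i\<in>I. c i * v i f) \<in> tangent_space A x"
  using assms
proof (induction I)
  case empty
  then show ?case using tangent_tzero by (simp add: tzero_def)
next
  case (insert i I)
  then have "tadd (tscale (c i) (v i)) (\<lambda>f. \<Sum>i\<in>I. c i * v i f) \<in> tangent_space A x"
    by (intro tangent_tadd tangent_tscale) auto
  then show ?case using insert by (simp add: tadd_def tscale_def)
qed

lemma
  assumes u: "u \<in> tangent_space A x" and f: "smooth_near A x f" and g: "smooth_near A x g"
  shows tangent_add: "u (\<lambda>y. f y + g y) = u f + u g"
    and tangent_mult: "u (\<lambda>y. f y * g y) = u f * g x + f x * u g"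
proof -
  obtain D \<phi> where c: "(D, \<phi>) \<in> A" "x \<in> D" using chart_exists by blast
  obtain e where e: "u = coord_vec A (D, \<phi>) e x" using u tangent_space_chart[OF c] by auto
  obtain U where U: "open U" "x \<in> U" "smooth_fun A U f" "smooth_fun A U g"
    using smooth_near_pair[OF f g] .
  have s: "smooth_near A x (\<lambda>y. f y + g y)" "smooth_near A x (\<lambda>y. f y * g y)"
    using smooth_fun_add[OF U(1,3,4)] smooth_fun_mult[OF U(1,3,4)] smooth_nearI[OF U(1,2)] by auto
  note d = smooth_near_differentiable[OF f c] smooth_near_differentiable[OF g c]
  note d' = frechet_derivative_at[OF has_derivative_add[OF d], symmetric]
    frechet_derivative_at[OF has_derivative_mult[OF d], symmetric]
  show "u (\<lambda>y. f y + g y) = u f + u g"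
    unfolding e coord_vec_eq[OF s(1)] coord_vec_eq[OF f] coord_vec_eq[OF g] d' ..
  show "u (\<lambda>y. f y * g y) = u f * g x + f x * u g"
    unfolding e coord_vec_eq[OF s(2)] coord_vec_eq[OF f] coord_vec_eq[OF g] d'
    using c by (simp add: add.commute)
qed

lemma tangent_const [simp]:
  assumes u: "u \<in> tangent_space A x"
  shows "u (\<lambda>y. r) = 0"
proof -
  obtain D \<phi> where c: "(D, \<phi>) \<in> A" "x \<in> D" using chart_exists by blast
  obtain e where e: "u = coord_vec A (D, \<phi>) e x" using u tangent_space_chart[OF c] by auto
  have "smooth_near A x (\<lambda>y. r)" using smooth_fun_const smooth_nearI[OF open_UNIV] by blast
  then show ?thesis by (simp add: e coord_vec_eq frechet_derivative_const)
qed

lemma tangent_diff: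
  assumes u: "u \<in> tangent_space A x" and f: "smooth_near A x f" and g: "smooth_near A x g"
  shows "u (\<lambda>y. f y - g y) = u f - u g"
proof -
  obtain U where U: "open U" "x \<in> U" "smooth_fun A U f" "smooth_fun A U g"
    using smooth_near_pair[OF f g] .
  have "smooth_near A x (\<lambda>y. f y - g y)"
    using smooth_fun_diff[OF U(1,3,4)] smooth_nearI[OF U(1,2)] by auto
  from tangent_add[OF u this g] show ?thesis by simp
qed

lemma tangent_sum_fun:
  assumes u: "u \<in> tangent_space A x" and U: "open U" "x \<in> U"
    and "finite I" "\<And>i. i \<in> I \<Longrightarrow> smooth_fun A U (f i)"
  shows "u (\<lambda>y. \<Sum>i\<in>I. f i y) = (\<Sum>i\<in>I. u (f i))"
  using assms(4,5)
proof (induction I)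
  case empty
  then show ?case using u by simp
next
  case (insert i I)
  have "smooth_near A x (f i)" "smooth_near A x (\<lambda>y. \<Sum>i\<in>I. f i y)"
    using insert U smooth_fun_sum[OF U(1), of I f] by (auto intro: smooth_nearI)
  from tangent_add[OF u this] show ?case using insert by simp
qed

lemma tangent_cong:
  assumes u: "u \<in> tangent_space A x" and U: "open U" "x \<in> U" "\<And>y. y \<in> U \<Longrightarrow> f y = g y"
  shows "u f = u g"
proof -
  obtain D \<phi> where c: "(D, \<phi>) \<in> A" "x \<in> D" using chart_exists by blast
  obtain e where e: "u = coord_vec A (D, \<phi>) e x" using u tangent_space_chart[OF c] by auto
  have "frechet_derivative (\<lambda>p. f (inv_into D \<phi> p)) (at (\<phi> x))
      = frechet_derivative (\<lambda>p. g (inv_into D \<phi> p)) (at (\<phi> x))"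
    by (rule frechet_derivative_cong_open[OF chart_image_open[OF c(1) U(1)]]) (use c U in auto)
  then show ?thesis
    unfolding e coord_vec_def using smooth_near_cong[OF U] by (simp add: comp_def)
qed

end

section \<open>Vector fields and their Lie brackets\<close>

context smooth_manifold
begin

lemma vector_field_tangent: "vector_field A U X \<Longrightarrow> x \<in> U \<Longrightarrow> X x \<in> tangent_space A x"
  by (simp add: vector_field_def)

lemma vector_field_smooth:
  "vector_field A U X \<Longrightarrow> open V \<Longrightarrow> V \<subseteq> U \<Longrightarrow> smooth_fun A V f \<Longrightarrow> smooth_fun A V (\<lambda>x. X x f)"
  by (simp add: vector_field_def)

lemma vector_field_smooth_near:
  assumes "vector_field A U X" "open U" "x \<in> U" "smooth_near A x f"
  shows "smooth_near A x (\<lambda>y. X y f)"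
proof -
  obtain V where V: "open V" "x \<in> V" "smooth_fun A V f" using assms(4) by (auto simp: smooth_near_def)
  have "smooth_fun A (U \<inter> V) f" using V by (auto intro: smooth_fun_subset)
  then have "smooth_fun A (U \<inter> V) (\<lambda>y. X y f)"
    using vector_field_smooth[OF assms(1), of "U \<inter> V" f] V assms(2) by (simp add: open_Int)
  then show ?thesis using V assms by (auto intro: smooth_nearI[of "U \<inter> V"])
qed

lemma vector_field_subset: "vector_field A U X \<Longrightarrow> V \<subseteq> U \<Longrightarrow> vector_field A V X"
  unfolding vector_field_def by (meson order_trans subsetD)

lemma vector_field_tscale:
  assumes X: "vector_field A U X" and U: "open U" and \<eta>: "smooth_fun A U \<eta>"
  shows "vector_field A U (\<lambda>y. tscale (\<eta> y) (X y))"
  unfolding vector_field_def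
proof (intro conjI ballI allI impI)
  fix x assume "x \<in> U"
  then show "tscale (\<eta> x) (X x) \<in> tangent_space A x"
    using X by (intro tangent_tscale vector_field_tangent)
next
  fix V f assume "open V \<and> V \<subseteq> U \<and> smooth_fun A V f"
  then show "smooth_fun A V (\<lambda>x. tscale (\<eta> x) (X x) f)"
    unfolding tscale_def using vector_field_smooth[OF X] smooth_fun_subset[OF \<eta>]
    by (intro smooth_fun_mult) auto
qed

lemma vector_field_sum:
  assumes "finite I" and U: "open U" and X: "\<And>i. i \<in> I \<Longrightarrow> vector_field A U (X i)"
    and \<eta>: "\<And>i. i \<in> I \<Longrightarrow> smooth_fun A U (\<eta> i)"
  shows "vector_field A U (\<lambda>y f. \<Sum>i\<in>I. \<eta> i y * X i y f)"
  unfolding vector_field_def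
proof (intro conjI ballI allI impI)
  fix x assume "x \<in> U"
  then show "(\<lambda>f. \<Sum>i\<in>I. \<eta> i x * X i x f) \<in> tangent_space A x"
    using X by (intro tangent_sum assms(1) vector_field_tangent)
next
  fix V f assume "open V \<and> V \<subseteq> U \<and> smooth_fun A V f"
  then show "smooth_fun A V (\<lambda>x. \<Sum>i\<in>I. \<eta> i x * X i x f)"
    using vector_field_smooth[OF X] smooth_fun_subset[OF \<eta>] assms(1)
    by (intro smooth_fun_sum smooth_fun_mult) auto
qed

lemma vector_field_coord:
  assumes c: "(D, \<phi>) \<in> A"
  shows "vector_field A D (coord_vec A (D, \<phi>) e)"
  unfolding vector_field_def
proof (intro conjI ballI allI impI)
  fix x assume "x \<in> D"
  then show "coord_vec A (D, \<phi>) e x \<in> tangent_space A x" using c by simp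
next
  fix V f assume V: "open V \<and> V \<subseteq> D \<and> smooth_fun A V f"
  have oV: "open (\<phi> ` V)" using chart_image_open[OF c, of V] V by (simp add: Int_absorb1)
  show "smooth_fun A V (\<lambda>x. coord_vec A (D, \<phi>) e x f)"
  proof (rule smooth_fun_chartI[OF c])
    show "open V" "V \<subseteq> D" using V by auto
    fix k
    have "Ck_on (Suc k) (\<lambda>p. f (inv_into D \<phi> p)) (\<phi> ` V)"
      using smooth_funD[OF _ c, of V f "Suc k"] V by (simp add: Int_absorb1 del: Ck_on.simps)
    then have "Ck_on k (\<lambda>p. frechet_derivative (\<lambda>p. f (inv_into D \<phi> p)) (at p) e) (\<phi> ` V)" by simp
    moreover have "frechet_derivative (\<lambda>p. f (inv_into D \<phi> p)) (at p) e
        = coord_vec A (D, \<phi>) e (inv_into D \<phi> p) f" if p: "p \<in> \<phi> ` V" for p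
    proof -
      obtain y where y: "y \<in> V" "p = \<phi> y" using p by auto
      then have "smooth_near A y f" "y \<in> D" using V smooth_nearI by blast+
      then show ?thesis using c y by (simp add: coord_vec_eq)
    qed
    ultimately show "Ck_on k (\<lambda>p. coord_vec A (D, \<phi>) e (inv_into D \<phi> p) f) (\<phi> ` V)"
      using Ck_on_cong[OF oV, of "\<lambda>p. frechet_derivative (\<lambda>p. f (inv_into D \<phi> p)) (at p) e"
          "\<lambda>p. coord_vec A (D, \<phi>) e (inv_into D \<phi> p) f"] by blast
  qed
qed

lemma vector_field_components:
  assumes "(D, \<phi>) \<in> A" "vector_field A U X" "open U" "U \<subseteq> D"
  shows "smooth_fun A U (\<lambda>y. X y (\<lambda>z. \<phi> z \<bullet> b))"
  using vector_field_smooth[OF assms(2,3) order_refl] smooth_fun_coordinate[OF assms(1)]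
    smooth_fun_subset assms(4) by blast

lemma coord_vec_commute:
  assumes c: "(D, \<phi>) \<in> A" "x \<in> D" and f: "smooth_near A x f"
  shows "coord_vec A (D, \<phi>) b x (\<lambda>y. coord_vec A (D, \<phi>) d y f)
       = coord_vec A (D, \<phi>) d x (\<lambda>y. coord_vec A (D, \<phi>) b y f)"
proof -
  obtain U where U: "open U" "x \<in> U" "smooth_fun A U f" using f by (auto simp: smooth_near_def)
  define F where "F = (\<lambda>p. f (inv_into D \<phi> p))"
  have F: "Ck_on 2 F (\<phi> ` (D \<inter> U))" unfolding F_def by (rule smooth_funD[OF U(3) c(1)])
  have o: "open (\<phi> ` (D \<inter> U))" "\<phi> x \<in> \<phi> ` (D \<inter> U)" using chart_image_open[OF c(1) U(1)] c U by auto
  have *: "coord_vec A (D, \<phi>) b x (\<lambda>y. coord_vec A (D, \<phi>) d y f)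
      = frechet_derivative (\<lambda>p. frechet_derivative F (at p) d) (at (\<phi> x)) b" for b d
  proof -
    have n: "smooth_near A x (\<lambda>y. coord_vec A (D, \<phi>) d y f)"
      by (rule vector_field_smooth_near[OF vector_field_coord[OF c(1)] chart_homeomorphism(1)[OF c(1)] c(2) f])
    have "coord_vec A (D, \<phi>) d (inv_into D \<phi> p) f = frechet_derivative F (at p) d"
      if p: "p \<in> \<phi> ` (D \<inter> U)" for p
    proof -
      obtain y where y: "y \<in> D" "y \<in> U" "p = \<phi> y" using p by auto
      then have "smooth_near A y f" using U smooth_nearI by blast
      then show ?thesis using c y by (simp add: coord_vec_eq F_def)
    qed
    then show ?thesis
      unfolding coord_vec_eq[OF n] by (subst frechet_derivative_cong_open[OF o]) auto
  qed
  show ?thesis unfolding * by (rule second_derivative_symmetric[OF o F])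
qed

lemma lie_bracket_smooth_near:
  "smooth_near A x f \<Longrightarrow> lie_bracket A X Y x f = X x (\<lambda>y. Y y f) - Y x (\<lambda>y. X y f)"
  by (simp add: lie_bracket_def)

lemma lie_bracket_coord:
  assumes "(D, \<phi>) \<in> A" "x \<in> D"
  shows "lie_bracket A (coord_vec A (D, \<phi>) b) (coord_vec A (D, \<phi>) d) x = tzero"
  unfolding lie_bracket_def tzero_def using coord_vec_commute[OF assms] by auto

text \<open>In coordinates the second order parts of \<open>X Y f\<close> and \<open>Y X f\<close> agree, and what is left is the
  derivative of \<open>f\<close> in the direction with components \<open>X \<eta> - Y \<xi>\<close>.\<close>

lemma lie_bracket_tangent:
  assumes X: "vector_field A U X" and Y: "vector_field A U Y" and U: "open U" "x \<in> U"
  shows "lie_bracket A X Y x \<in> tangent_space A x"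
proof -
  obtain D \<phi> where c: "(D, \<phi>) \<in> A" "x \<in> D" using chart_exists by blast
  let ?k = "coord_vec A (D, \<phi>)"
  let ?comp = "\<lambda>X b y. X y (\<lambda>z. \<phi> z \<bullet> b)"
  have oD: "open D" by (rule chart_homeomorphism(1)[OF c(1)])
  have T: "X x \<in> tangent_space A x" "Y x \<in> tangent_space A x"
    using X Y U vector_field_tangent by blast+
  have second_order: "X x (\<lambda>y. Y y f) = (\<Sum>d\<in>Basis. X x (?comp Y d) * ?k d x f)
      + (\<Sum>d\<in>Basis. \<Sum>b\<in>Basis. ?comp Y d x * ?comp X b x * ?k b x (\<lambda>y. ?k d y f))"
    if f: "smooth_near A x f" and X: "vector_field A U X" and Y: "vector_field A U Y" for X Y f
  proof -
    have XT: "X x \<in> tangent_space A x" using X U vector_field_tangent by blast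
    obtain W where W: "open W" "x \<in> W" "smooth_fun A W f" using f by (auto simp: smooth_near_def)
    let ?N = "D \<inter> (U \<inter> W)"
    have N: "open ?N" "x \<in> ?N" "?N \<subseteq> D" "?N \<subseteq> U" "?N \<subseteq> W" using oD U W c by auto
    have s1: "smooth_fun A ?N (?comp Y d)" for d
      by (rule vector_field_components[OF c(1) vector_field_subset[OF Y N(4)] N(1,3)])
    have s2: "smooth_fun A ?N (\<lambda>y. ?k d y f)" for d
      by (rule vector_field_smooth[OF vector_field_coord[OF c(1)] N(1,3) smooth_fun_subset[OF W(3) N(5)]])
    have "X x (\<lambda>y. Y y f) = X x (\<lambda>y. \<Sum>d\<in>Basis. ?comp Y d y * ?k d y f)"
    proof (rule tangent_cong[OF XT N(1,2)])
      fix y assume y: "y \<in> ?N"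
      then have "Y y \<in> tangent_space A y" using vector_field_tangent[OF Y] by auto
      then show "Y y f = (\<Sum>d\<in>Basis. ?comp Y d y * ?k d y f)"
        using tangent_rep(2)[OF c(1)] y by auto
    qed
    also have "\<dots> = (\<Sum>d\<in>Basis. X x (\<lambda>y. ?comp Y d y * ?k d y f))"
      by (rule tangent_sum_fun[OF XT N(1,2)]) (auto intro: smooth_fun_mult[OF N(1) s1 s2])
    also have "\<dots> = (\<Sum>d\<in>Basis. X x (?comp Y d) * ?k d x f + ?comp Y d x * X x (\<lambda>y. ?k d y f))"
      by (intro sum.cong refl tangent_mult[OF XT]) (use N s1 s2 in \<open>auto intro: smooth_nearI\<close>)
    also have "\<dots> = (\<Sum>d\<in>Basis. X x (?comp Y d) * ?k d x f)
      + (\<Sum>d\<in>Basis. \<Sum>b\<in>Basis. ?comp Y d x * ?comp X b x * ?k b x (\<lambda>y. ?k d y f))"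
      by (simp add: sum.distrib tangent_rep(2)[OF c XT, of "\<lambda>y. ?k d y f" for d] sum_distrib_left mult.assoc)
    finally show ?thesis .
  qed
  have "lie_bracket A X Y x = (\<lambda>f. \<Sum>d\<in>Basis. (X x (?comp Y d) - Y x (?comp X d)) * ?k d x f)"
  proof
    fix f
    show "lie_bracket A X Y x f = (\<Sum>d\<in>Basis. (X x (?comp Y d) - Y x (?comp X d)) * ?k d x f)"
    proof (cases "smooth_near A x f")
      case True
      have "(\<Sum>d\<in>Basis. \<Sum>b\<in>Basis. ?comp Y d x * ?comp X b x * ?k b x (\<lambda>y. ?k d y f))
          = (\<Sum>b\<in>Basis. \<Sum>d\<in>Basis. ?comp X b x * ?comp Y d x * ?k d x (\<lambda>y. ?k b y f))"
        by (subst sum.swap) (simp add: coord_vec_commute[OF c True, of _ d for d] mult.commute[of "X x _"])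
      then show ?thesis
        unfolding lie_bracket_smooth_near[OF True] second_order[OF True X Y] second_order[OF True Y X]
        by (simp add: left_diff_distrib sum_subtractf)
    next
      case False
      then show ?thesis by (simp add: lie_bracket_def coord_vec_def)
    qed
  qed
  also have "\<dots> \<in> tangent_space A x" by (rule tangent_sum) (use c in auto)
  finally show ?thesis .
qed

lemma vector_field_lie_bracket:
  assumes X: "vector_field A U X" and Y: "vector_field A U Y" and U: "open U"
  shows "vector_field A U (lie_bracket A X Y)"
  unfolding vector_field_def
proof (intro conjI ballI allI impI)
  fix x assume "x \<in> U"
  then show "lie_bracket A X Y x \<in> tangent_space A x" by (rule lie_bracket_tangent[OF X Y U])
next
  fix V f assume V: "open V \<and> V \<subseteq> U \<and> smooth_fun A V f"
  then have s: "smooth_fun A V (\<lambda>x. X x f)" "smooth_fun A V (\<lambda>x. Y x f)"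
    using vector_field_smooth[OF X] vector_field_smooth[OF Y] by auto
  have "smooth_fun A V (\<lambda>x. X x (\<lambda>y. Y y f) - Y x (\<lambda>y. X y f))"
    using V s vector_field_smooth[OF X] vector_field_smooth[OF Y] by (intro smooth_fun_diff) auto
  moreover have "lie_bracket A X Y x f = X x (\<lambda>y. Y y f) - Y x (\<lambda>y. X y f)" if "x \<in> V" for x
    using that V smooth_nearI lie_bracket_smooth_near by blast
  ultimately show "smooth_fun A V (\<lambda>x. lie_bracket A X Y x f)"
    using smooth_fun_cong[of V "\<lambda>x. lie_bracket A X Y x f"] V by simp
qed

section \<open>Symmetric forms and sections of the bundle of forms\<close>

lemma form_outside: "h \<in> sym_forms A x \<Longrightarrow> a \<notin> tangent_space A x \<or> b \<notin> tangent_space A x \<Longrightarrow> h a b = 0"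
  unfolding sym_forms_def by blast

lemma form_sym: "h \<in> sym_forms A x \<Longrightarrow> h a b = h b a"
  unfolding sym_forms_def by (cases "a \<in> tangent_space A x \<and> b \<in> tangent_space A x") auto

lemma form_tadd:
  assumes "h \<in> sym_forms A x" "a \<in> tangent_space A x" "a' \<in> tangent_space A x"
  shows "h (tadd a a') b = h a b + h a' b"
proof (cases "b \<in> tangent_space A x")
  case True
  then show ?thesis using assms unfolding sym_forms_def by blast
qed (simp add: form_outside[OF assms(1)])

lemma form_tscale:
  assumes "h \<in> sym_forms A x" "a \<in> tangent_space A x"
  shows "h (tscale r a) b = r * h a b"
proof (cases "b \<in> tangent_space A x")
  case True
  then show ?thesis using assms unfolding sym_forms_def by blast
qed (simp add: form_outside[OF assms(1)])

lemma form_tzero: "h \<in> sym_forms A x \<Longrightarrow> h tzero b = 0"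
  using form_tscale[of h x tzero 0 b] tangent_tzero by (simp add: tscale_def tzero_def)

lemma form_sum_left:
  assumes h: "h \<in> sym_forms A x" and "finite I" "\<And>i. i \<in> I \<Longrightarrow> v i \<in> tangent_space A x"
  shows "h (\<lambda>f. \<Sum>i\<in>I. c i * v i f) b = (\<Sum>i\<in>I. c i * h (v i) b)"
  using assms(2,3)
proof (induction I)
  case empty
  then show ?case using form_tzero[OF h] by (simp add: tzero_def)
next
  case (insert i I)
  have "h (\<lambda>f. \<Sum>i\<in>insert i I. c i * v i f) b = h (tadd (tscale (c i) (v i)) (\<lambda>f. \<Sum>i\<in>I. c i * v i f)) b"
    using insert by (simp add: tadd_def tscale_def)
  also have "\<dots> = c i * h (v i) b + h (\<lambda>f. \<Sum>i\<in>I. c i * v i f) b"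
    using insert by (subst form_tadd[OF h]) (auto intro: tangent_tscale tangent_sum simp: form_tscale[OF h])
  finally show ?case using insert by simp
qed

lemma form_sum_right:
  assumes h: "h \<in> sym_forms A x" and "finite I" "\<And>i. i \<in> I \<Longrightarrow> v i \<in> tangent_space A x"
  shows "h b (\<lambda>f. \<Sum>i\<in>I. c i * v i f) = (\<Sum>i\<in>I. c i * h b (v i))"
  using form_sum_left[OF assms] form_sym[OF h] by simp

lemma form_chart_expand:
  assumes h: "h \<in> sym_forms A x" and c: "(D, \<phi>) \<in> A" "x \<in> D"
    and ab: "a \<in> tangent_space A x" "b \<in> tangent_space A x"
  shows "h a b = (\<Sum>i\<in>Basis. \<Sum>j\<in>Basis. a (\<lambda>y. \<phi> y \<bullet> i) * b (\<lambda>y. \<phi> y \<bullet> j)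
      * h (coord_vec A (D, \<phi>) i x) (coord_vec A (D, \<phi>) j x))"
proof -
  have rep: "u = (\<lambda>f. \<Sum>i\<in>Basis. u (\<lambda>y. \<phi> y \<bullet> i) * coord_vec A (D, \<phi>) i x f)"
    if "u \<in> tangent_space A x" for u
    by (rule ext) (rule tangent_rep(2)[OF c that])
  have "h a b = h (\<lambda>f. \<Sum>i\<in>Basis. a (\<lambda>y. \<phi> y \<bullet> i) * coord_vec A (D, \<phi>) i x f) b"
    by (rule arg_cong[OF rep[OF ab(1)], of "\<lambda>v. h v b"])
  also have "\<dots> = (\<Sum>i\<in>Basis. a (\<lambda>y. \<phi> y \<bullet> i) * h (coord_vec A (D, \<phi>) i x) b)"
    by (rule form_sum_left[OF h]) (use c in auto)
  moreover have "h u b = (\<Sum>j\<in>Basis. b (\<lambda>y. \<phi> y \<bullet> j) * h u (coord_vec A (D, \<phi>) j x))" for u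
  proof -
    have "h u b = h u (\<lambda>f. \<Sum>j\<in>Basis. b (\<lambda>y. \<phi> y \<bullet> j) * coord_vec A (D, \<phi>) j x f)"
      by (rule arg_cong[OF rep[OF ab(2)], of "h u"])
    also have "\<dots> = (\<Sum>j\<in>Basis. b (\<lambda>y. \<phi> y \<bullet> j) * h u (coord_vec A (D, \<phi>) j x))"
      by (rule form_sum_right[OF h]) (use c in auto)
    finally show ?thesis .
  qed
  ultimately show ?thesis by (simp add: sum_distrib_left mult.assoc)
qed

lemma form_eqI:
  assumes h: "h \<in> sym_forms A x" and k: "k \<in> sym_forms A x" and c: "(D, \<phi>) \<in> A" "x \<in> D"
    and eq: "\<And>i j. i \<in> Basis \<Longrightarrow> j \<in> Basis \<Longrightarrow> h (coord_vec A (D, \<phi>) i x) (coord_vec A (D, \<phi>) j x)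
      = k (coord_vec A (D, \<phi>) i x) (coord_vec A (D, \<phi>) j x)"
  shows "h = k"
proof (intro ext)
  fix a b
  show "h a b = k a b"
  proof (cases "a \<in> tangent_space A x \<and> b \<in> tangent_space A x")
    case True
    then show ?thesis
      using form_chart_expand[OF h c] form_chart_expand[OF k c] eq by (auto intro!: sum.cong)
  next
    case False
    then show ?thesis using form_outside[OF h] form_outside[OF k] by metis
  qed
qed

lemma sym_forms_sum:
  assumes "\<And>i. i \<in> I \<Longrightarrow> h i \<in> sym_forms A x"
  shows "(\<lambda>a b. \<Sum>i\<in>I. c i * h i a b) \<in> sym_forms A x"
proof -
  let ?s = "\<lambda>a b. \<Sum>i\<in>I. c i * h i a b"
  have "?s a b = 0" if "a \<notin> tangent_space A x \<or> b \<notin> tangent_space A x" for a b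
    using form_outside[OF assms that] by simp
  moreover have "?s a b = ?s b a" for a b
    by (intro sum.cong refl arg_cong2[of _ _ _ _ "(*)"] form_sym[OF assms])
  moreover have "?s (tadd a a') b = ?s a b + ?s a' b"
    if "a \<in> tangent_space A x" "a' \<in> tangent_space A x" for a a' b
    using form_tadd[OF assms that] by (simp add: distrib_left sum.distrib)
  moreover have "?s (tscale r a) b = r * ?s a b" if "a \<in> tangent_space A x" for a b r
    using form_tscale[OF assms that] by (simp add: sum_distrib_left mult.left_commute)
  ultimately show ?thesis unfolding sym_forms_def by blast
qed

lemma sym_forms_scale: "h \<in> sym_forms A x \<Longrightarrow> (\<lambda>a b. r * h a b) \<in> sym_forms A x"
  using sym_forms_sum[of "{()}" "\<lambda>_. h" x "\<lambda>_. r"] by simp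

lemma sym_forms_add:
  assumes "h \<in> sym_forms A x" "k \<in> sym_forms A x"
  shows "(\<lambda>a b. h a b + k a b) \<in> sym_forms A x"
  using sym_forms_sum[of "{False, True}" "\<lambda>t. if t then h else k" x "\<lambda>_. 1"] assms by (simp add: add.commute)

lemma sym_forms_zero: "(\<lambda>a b. 0) \<in> sym_forms A x"
  using sym_forms_sum[of "{}"] by simp

lemma sym_forms_diff:
  assumes "h \<in> sym_forms A x" "k \<in> sym_forms A x"
  shows "(\<lambda>a b. h a b - k a b) \<in> sym_forms A x"
  using sym_forms_add[OF assms(1) sym_forms_scale[OF assms(2), of "-1"]] by simp

definition matrix_form :: "('m \<Rightarrow> 'e) \<Rightarrow> 'm \<Rightarrow> ('e \<Rightarrow> 'e \<Rightarrow> real) \<Rightarrow> 'm form" where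
  "matrix_form \<phi> x M = (\<lambda>a b. if a \<in> tangent_space A x \<and> b \<in> tangent_space A x
     then \<Sum>i\<in>Basis. \<Sum>j\<in>Basis. a (\<lambda>y. \<phi> y \<bullet> i) * b (\<lambda>y. \<phi> y \<bullet> j) * M i j else 0)"

lemma matrix_form_sym_forms:
  assumes "\<And>i j. i \<in> Basis \<Longrightarrow> j \<in> Basis \<Longrightarrow> M i j = M j i"
  shows "matrix_form \<phi> x M \<in> sym_forms A x"
proof -
  have "matrix_form \<phi> x M a b = matrix_form \<phi> x M b a" for a b
  proof -
    have "(\<Sum>i\<in>Basis. \<Sum>j\<in>Basis. a (\<lambda>y. \<phi> y \<bullet> i) * b (\<lambda>y. \<phi> y \<bullet> j) * M i j)
        = (\<Sum>i\<in>Basis. \<Sum>j\<in>Basis. b (\<lambda>y. \<phi> y \<bullet> i) * a (\<lambda>y. \<phi> y \<bullet> j) * M i j)"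
      by (subst sum.swap) (auto intro!: sum.cong simp: assms mult.commute[of "a _"])
    then show ?thesis by (simp add: matrix_form_def)
  qed
  moreover have "matrix_form \<phi> x M (tadd a a') b = matrix_form \<phi> x M a b + matrix_form \<phi> x M a' b"
    if "a \<in> tangent_space A x" "a' \<in> tangent_space A x" "b \<in> tangent_space A x" for a a' b
    using that tangent_tadd[of a x a']
    by (simp add: matrix_form_def tadd_def sum.distrib[symmetric] distrib_right)
  moreover have "matrix_form \<phi> x M (tscale r a) b = r * matrix_form \<phi> x M a b"
    if "a \<in> tangent_space A x" "b \<in> tangent_space A x" for a b r
    using that tangent_tscale[of a x r]
    by (simp add: matrix_form_def tscale_def sum_distrib_left mult.assoc)
  moreover have "matrix_form \<phi> x M a b = 0"
    if "a \<notin> tangent_space A x \<or> b \<notin> tangent_space A x" for a b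
    using that by (auto simp: matrix_form_def)
  ultimately show ?thesis unfolding sym_forms_def by blast
qed

lemma matrix_form_coord:
  assumes c: "(D, \<phi>) \<in> A" "x \<in> D" and "i \<in> Basis" "j \<in> Basis"
  shows "matrix_form \<phi> x M (coord_vec A (D, \<phi>) i x) (coord_vec A (D, \<phi>) j x) = M i j"
proof -
  have "matrix_form \<phi> x M (coord_vec A (D, \<phi>) i x) (coord_vec A (D, \<phi>) j x)
      = (\<Sum>i'\<in>Basis. \<Sum>j'\<in>Basis. (if i' = i then if j' = j then M i' j' else 0 else 0))"
    using c unfolding matrix_form_def coord_vec_coordinate[OF c]
    by (auto intro!: sum.cong simp: inner_Basis assms)
  also have "\<dots> = (\<Sum>i'\<in>Basis. if i' = i then M i' j else 0)"
    by (rule sum.cong) (simp_all add: assms(4))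
  finally show ?thesis using assms(3) by simp
qed

lemma W_section_form: "W_section A U h \<Longrightarrow> x \<in> U \<Longrightarrow> h x \<in> sym_forms A x"
  by (simp add: W_section_def)

lemma W_section_smooth:
  "W_section A U h \<Longrightarrow> open V \<Longrightarrow> V \<subseteq> U \<Longrightarrow> vector_field A V X \<Longrightarrow> vector_field A V Y \<Longrightarrow>
     smooth_fun A V (\<lambda>x. h x (X x) (Y x))"
  by (simp add: W_section_def)

lemma W_section_subset: "W_section A U h \<Longrightarrow> V \<subseteq> U \<Longrightarrow> W_section A V h"
  unfolding W_section_def by (meson order_trans subsetD)

lemma W_section_sum:
  assumes "finite I" and U: "open U" and h: "\<And>i. i \<in> I \<Longrightarrow> W_section A U (h i)"
    and c: "\<And>i. i \<in> I \<Longrightarrow> smooth_fun A U (c i)"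
  shows "W_section A U (\<lambda>y a b. \<Sum>i\<in>I. c i y * h i y a b)"
  unfolding W_section_def
proof (intro conjI ballI allI impI)
  fix x assume "x \<in> U"
  then show "(\<lambda>a b. \<Sum>i\<in>I. c i x * h i x a b) \<in> sym_forms A x"
    using h by (intro sym_forms_sum W_section_form)
next
  fix V X Y assume V: "open V \<and> V \<subseteq> U \<and> vector_field A V X \<and> vector_field A V Y"
  then show "smooth_fun A V (\<lambda>x. \<Sum>i\<in>I. c i x * h i x (X x) (Y x))"
    using assms(1) smooth_fun_subset[OF c] W_section_smooth[OF h]
    by (intro smooth_fun_sum smooth_fun_mult) auto
qed

lemma W_section_zero: "W_section A U (\<lambda>y a b. 0)"
  unfolding W_section_def by (auto simp: sym_forms_zero smooth_fun_const)

lemma W_section_diff: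
  assumes U: "open U" and h: "W_section A U h" and k: "W_section A U k"
  shows "W_section A U (\<lambda>y a b. h y a b - k y a b)"
proof -
  have "W_section A U (\<lambda>y a b. \<Sum>t\<in>{False, True}. (if t then -1 else 1) * (if t then k else h) y a b)"
    by (rule W_section_sum) (use assms in \<open>auto simp: smooth_fun_const\<close>)
  then show ?thesis by simp
qed

lemma W_section_chartI:
  assumes c: "(D, \<phi>) \<in> A" and U: "open U" "U \<subseteq> D"
    and h: "\<And>y. y \<in> U \<Longrightarrow> h y \<in> sym_forms A y"
    and s: "\<And>i j. i \<in> Basis \<Longrightarrow> j \<in> Basis \<Longrightarrow>
      smooth_fun A U (\<lambda>y. h y (coord_vec A (D, \<phi>) i y) (coord_vec A (D, \<phi>) j y))"
  shows "W_section A U h"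
  unfolding W_section_def
proof (intro conjI ballI allI impI)
  fix V X Y assume V: "open V \<and> V \<subseteq> U \<and> vector_field A V X \<and> vector_field A V Y"
  let ?f = "\<lambda>x. \<Sum>i\<in>Basis. \<Sum>j\<in>Basis. X x (\<lambda>y. \<phi> y \<bullet> i) * Y x (\<lambda>y. \<phi> y \<bullet> j)
      * h x (coord_vec A (D, \<phi>) i x) (coord_vec A (D, \<phi>) j x)"
  have "smooth_fun A V (\<lambda>y. h y (coord_vec A (D, \<phi>) i y) (coord_vec A (D, \<phi>) j y))"
    if "i \<in> Basis" "j \<in> Basis" for i j using smooth_fun_subset[OF s] V that by blast
  moreover have "smooth_fun A V (\<lambda>x. X x (\<lambda>y. \<phi> y \<bullet> i))" "smooth_fun A V (\<lambda>x. Y x (\<lambda>y. \<phi> y \<bullet> i))" for i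
    using V U by (auto intro!: vector_field_components[OF c])
  ultimately have "smooth_fun A V ?f"
    using V by (intro smooth_fun_sum smooth_fun_mult) auto
  moreover have "smooth_fun A V (\<lambda>x. h x (X x) (Y x)) \<longleftrightarrow> smooth_fun A V ?f"
    by (rule smooth_fun_cong)
      (use V U c vector_field_tangent in \<open>auto intro!: form_chart_expand h\<close>)
  ultimately show "smooth_fun A V (\<lambda>x. h x (X x) (Y x))" by simp
qed (rule h)

lemma W_section_extension:
  assumes c: "(D, \<phi>) \<in> A" "x \<in> D" and w: "w \<in> sym_forms A x"
  shows "\<exists>h. W_section A D h \<and> h x = w"
proof -
  let ?M = "\<lambda>i j. w (coord_vec A (D, \<phi>) i x) (coord_vec A (D, \<phi>) j x)"
  let ?h = "\<lambda>y. matrix_form \<phi> y ?M"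
  have f: "?h y \<in> sym_forms A y" for y
    by (rule matrix_form_sym_forms) (rule form_sym[OF w])
  have "W_section A D ?h"
  proof (rule W_section_chartI[OF c(1) chart_homeomorphism(1)[OF c(1)] order_refl f])
    fix i j :: 'e assume "i \<in> Basis" "j \<in> Basis"
    then show "smooth_fun A D (\<lambda>y. ?h y (coord_vec A (D, \<phi>) i y) (coord_vec A (D, \<phi>) j y))"
      using smooth_fun_cong[OF chart_homeomorphism(1)[OF c(1)],
          of "\<lambda>y. ?h y (coord_vec A (D, \<phi>) i y) (coord_vec A (D, \<phi>) j y)" "\<lambda>y. ?M i j"]
      by (simp add: matrix_form_coord[OF c(1)] smooth_fun_const)
  qed
  moreover have "?h x = w"
    by (rule form_eqI[OF f w c]) (rule matrix_form_coord[OF c])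
  ultimately show ?thesis by blast
qed

end

section \<open>The induced connection on the bundle of forms\<close>

locale manifold_connection = smooth_manifold A
  for A :: "('m::{t2_space,second_countable_topology}, 'e::euclidean_space) atlas" +
  fixes nabla :: "'m conn"
  assumes conn: "connection A nabla"
begin

lemma
  assumes U: "open U" and Y: "vector_field A U Y" and x: "x \<in> U" and v: "v \<in> tangent_space A x"
  shows nabla_tangent: "nabla x v Y \<in> tangent_space A x"
    and nabla_dir_tadd: "w \<in> tangent_space A x \<Longrightarrow> nabla x (tadd v w) Y = tadd (nabla x v Y) (nabla x w Y)"
    and nabla_dir_tscale: "nabla x (tscale r v) Y = tscale r (nabla x v Y)"
    and nabla_tadd: "vector_field A U Z \<Longrightarrow>
      nabla x v (\<lambda>y. tadd (Y y) (Z y)) = tadd (nabla x v Y) (nabla x v Z)"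
    and nabla_tscale: "smooth_fun A U f \<Longrightarrow> nabla x v (\<lambda>y. tscale (f y) (Y y))
      = tadd (tscale (v f) (Y x)) (tscale (f x) (nabla x v Y))"
    and nabla_cong: "(\<And>y. y \<in> U \<Longrightarrow> Z y = Y y) \<Longrightarrow> nabla x v Z = nabla x v Y"
proof -
  note C = conn[unfolded connection_def, THEN spec[of _ U], THEN spec[of _ Y], THEN mp, OF conjI[OF U Y]]
  note C1 = C[THEN conjunct1] C[THEN conjunct2, THEN conjunct1]
    C[THEN conjunct2, THEN conjunct2, THEN conjunct1]
  note C2 = C[THEN conjunct2, THEN conjunct2, THEN conjunct2]
  note C3 = C2[THEN conjunct1] C2[THEN conjunct2, THEN conjunct1]
    C2[THEN conjunct2, THEN conjunct2, THEN conjunct1]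
  show "nabla x v Y \<in> tangent_space A x" using C1(1) x v by blast
  show "w \<in> tangent_space A x \<Longrightarrow> nabla x (tadd v w) Y = tadd (nabla x v Y) (nabla x w Y)"
    using C1(2) x v by blast
  show "nabla x (tscale r v) Y = tscale r (nabla x v Y)" using C1(3) x v by blast
  show "vector_field A U Z \<Longrightarrow> nabla x v (\<lambda>y. tadd (Y y) (Z y)) = tadd (nabla x v Y) (nabla x v Z)"
    using C3(1) x v by blast
  show "smooth_fun A U f \<Longrightarrow> nabla x v (\<lambda>y. tscale (f y) (Y y))
      = tadd (tscale (v f) (Y x)) (tscale (f x) (nabla x v Y))"
    using C3(2) x v by blast
  show "(\<And>y. y \<in> U \<Longrightarrow> Z y = Y y) \<Longrightarrow> nabla x v Z = nabla x v Y"
    using C3(3) x v by blast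
qed

lemma vector_field_nabla:
  "open U \<Longrightarrow> vector_field A U X \<Longrightarrow> vector_field A U Y \<Longrightarrow> vector_field A U (\<lambda>x. nabla x (X x) Y)"
  using conn[unfolded connection_def, THEN spec[of _ U], THEN spec[of _ Y], THEN mp, OF conjI,
    THEN conjunct2, THEN conjunct2, THEN conjunct2, THEN conjunct2, THEN conjunct2, THEN conjunct2]
  by blast

lemma nabla_sum:
  assumes U: "open U" "x \<in> U" and v: "v \<in> tangent_space A x" and "finite I"
    and "\<And>i. i \<in> I \<Longrightarrow> vector_field A U (X i)" "\<And>i. i \<in> I \<Longrightarrow> smooth_fun A U (\<eta> i)"
  shows "nabla x v (\<lambda>y f. \<Sum>i\<in>I. \<eta> i y * X i y f)
    = tadd (\<lambda>f. \<Sum>i\<in>I. v (\<eta> i) * X i x f) (\<lambda>f. \<Sum>i\<in>I. \<eta> i x * nabla x v (X i) f)"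
  using assms(4-6)
proof (induction I)
  case empty
  have z: "vector_field A U (\<lambda>y f. 0)" using vector_field_sum[of "{}" U] U by simp
  have "nabla x v (\<lambda>y. tscale 0 (\<lambda>f. 0)) = (\<lambda>f. 0)"
    using nabla_tscale[OF U(1) z U(2) v, of "\<lambda>y. 0"] v smooth_fun_const by (simp add: tscale_def tadd_def)
  then show ?case by (simp add: tscale_def tadd_def)
next
  case (insert i I)
  let ?R = "\<lambda>y f. \<Sum>i\<in>I. \<eta> i y * X i y f"
  have R: "vector_field A U ?R" using insert U by (intro vector_field_sum) auto
  have S: "vector_field A U (\<lambda>y. tscale (\<eta> i y) (X i y))" using insert U by (intro vector_field_tscale) auto
  have "nabla x v (\<lambda>y f. \<Sum>i\<in>insert i I. \<eta> i y * X i y f) = nabla x v (\<lambda>y. tadd (tscale (\<eta> i y) (X i y)) (?R y))"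
    using insert by (simp add: tadd_def tscale_def)
  also have "\<dots> = tadd (tadd (tscale (v (\<eta> i)) (X i x)) (tscale (\<eta> i x) (nabla x v (X i)))) (nabla x v ?R)"
    using nabla_tadd[OF U(1) S U(2) v R] nabla_tscale[OF U(1) _ U(2) v] insert by simp
  finally show ?case using insert by (auto simp: tadd_def tscale_def)
qed

lemma nabla_dir_sum:
  assumes U: "open U" "x \<in> U" and Y: "vector_field A U Y" and "finite I"
    and "\<And>i. i \<in> I \<Longrightarrow> v i \<in> tangent_space A x"
  shows "nabla x (\<lambda>f. \<Sum>i\<in>I. c i * v i f) Y = (\<lambda>f. \<Sum>i\<in>I. c i * nabla x (v i) Y f)"
  using assms(4,5)
proof (induction I)
  case empty
  show ?case
    using nabla_dir_tscale[OF U(1) Y U(2) tangent_tzero, of 0] by (simp add: tscale_def tzero_def)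
next
  case (insert i I)
  have "nabla x (tadd (tscale (c i) (v i)) (\<lambda>f. \<Sum>i\<in>I. c i * v i f)) Y
     = tadd (tscale (c i) (nabla x (v i) Y)) (nabla x (\<lambda>f. \<Sum>i\<in>I. c i * v i f) Y)"
    using insert
    by (simp add: nabla_dir_tadd[OF U(1) Y U(2)] nabla_dir_tscale[OF U(1) Y U(2)] tangent_tscale tangent_sum)
  then show ?case using insert by (simp add: tadd_def tscale_def)
qed

text \<open>The value that the Leibniz rule prescribes for \<open>(\<nabla>\<^sub>u h)(Y, Z)\<close>. It is linear over the
  smooth functions in \<open>Y\<close> and \<open>Z\<close>, so that it is a form evaluated at \<open>Y x\<close> and \<open>Z x\<close>; that form is
  \<open>W_nabla\<close>.\<close>

definition leibniz :: "'m \<Rightarrow> 'm tvec \<Rightarrow> ('m \<Rightarrow> 'm form) \<Rightarrow> ('m \<Rightarrow> 'm tvec) \<Rightarrow> ('m \<Rightarrow> 'm tvec) \<Rightarrow> real" where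
  "leibniz x u h Y Z = u (\<lambda>y. h y (Y y) (Z y)) - h x (nabla x u Y) (Z x) - h x (Y x) (nabla x u Z)"

lemma leibniz_cong:
  assumes U: "open U" "x \<in> U" and Y: "vector_field A U Y" "\<And>y. y \<in> U \<Longrightarrow> Y' y = Y y"
    and u: "u \<in> tangent_space A x"
  shows "leibniz x u h Y' Z = leibniz x u h Y Z"
  using tangent_cong[OF u U, of "\<lambda>y. h y (Y' y) (Z y)" "\<lambda>y. h y (Y y) (Z y)"]
    nabla_cong[OF U(1) Y(1) U(2) u Y(2)] Y(2)[OF U(2)] Y(2)
  by (simp add: leibniz_def)

lemma leibniz_sym:
  assumes U: "open U" "x \<in> U" and h: "W_section A U h" and u: "u \<in> tangent_space A x"
  shows "leibniz x u h Y Z = leibniz x u h Z Y"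
  using tangent_cong[OF u U, of "\<lambda>y. h y (Y y) (Z y)" "\<lambda>y. h y (Z y) (Y y)"]
    form_sym[OF W_section_form[OF h]] U
  by (simp add: leibniz_def)

lemma leibniz_sum:
  assumes U: "open U" "x \<in> U" and h: "W_section A U h" and u: "u \<in> tangent_space A x"
    and I: "finite I" and Y: "\<And>i. i \<in> I \<Longrightarrow> vector_field A U (Y i)"
    and \<eta>: "\<And>i. i \<in> I \<Longrightarrow> smooth_fun A U (\<eta> i)" and Z: "vector_field A U Z"
  shows "leibniz x u h (\<lambda>y f. \<Sum>i\<in>I. \<eta> i y * Y i y f) Z = (\<Sum>i\<in>I. \<eta> i x * leibniz x u h (Y i) Z)"
proof -
  note hx = W_section_form[OF h U(2)]
  have s: "smooth_fun A U (\<lambda>y. h y (Y i y) (Z y))" if "i \<in> I" for i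
    by (rule W_section_smooth[OF h U(1) order_refl Y[OF that] Z])
  have T: "Y i x \<in> tangent_space A x" "nabla x u (Y i) \<in> tangent_space A x" if "i \<in> I" for i
    using vector_field_tangent[OF Y] nabla_tangent[OF U(1) Y U(2) u] that U by auto
  have lin: "h y (\<lambda>f. \<Sum>i\<in>I. \<eta> i y * Y i y f) b = (\<Sum>i\<in>I. \<eta> i y * h y (Y i y) b)" if "y \<in> U" for y b
    using Y that by (intro form_sum_left[OF W_section_form[OF h that] I]) (auto intro: vector_field_tangent)
  have "u (\<lambda>y. h y (\<lambda>f. \<Sum>i\<in>I. \<eta> i y * Y i y f) (Z y)) = u (\<lambda>y. \<Sum>i\<in>I. \<eta> i y * h y (Y i y) (Z y))"
    by (rule tangent_cong[OF u U]) (rule lin)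
  also have "\<dots> = (\<Sum>i\<in>I. u (\<lambda>y. \<eta> i y * h y (Y i y) (Z y)))"
    by (rule tangent_sum_fun[OF u U I]) (rule smooth_fun_mult[OF U(1) \<eta> s])
  also have "\<dots> = (\<Sum>i\<in>I. u (\<eta> i) * h x (Y i x) (Z x) + \<eta> i x * u (\<lambda>y. h y (Y i y) (Z y)))"
    by (intro sum.cong refl tangent_mult[OF u]) (use s \<eta> smooth_nearI[OF U] in auto)
  finally have 1: "u (\<lambda>y. h y (\<lambda>f. \<Sum>i\<in>I. \<eta> i y * Y i y f) (Z y))
    = (\<Sum>i\<in>I. u (\<eta> i) * h x (Y i x) (Z x) + \<eta> i x * u (\<lambda>y. h y (Y i y) (Z y)))" .
  have nab: "nabla x u (\<lambda>y f. \<Sum>i\<in>I. \<eta> i y * Y i y f)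
      = tadd (\<lambda>f. \<Sum>i\<in>I. u (\<eta> i) * Y i x f) (\<lambda>f. \<Sum>i\<in>I. \<eta> i x * nabla x u (Y i) f)"
    using U u I Y \<eta> by (rule nabla_sum)
  have 2: "h x (nabla x u (\<lambda>y f. \<Sum>i\<in>I. \<eta> i y * Y i y f)) (Z x)
    = (\<Sum>i\<in>I. u (\<eta> i) * h x (Y i x) (Z x)) + (\<Sum>i\<in>I. \<eta> i x * h x (nabla x u (Y i)) (Z x))"
    unfolding nab by (subst form_tadd[OF hx]) (auto simp: form_sum_left[OF hx I] T intro!: tangent_sum I)
  show ?thesis
    unfolding leibniz_def 1 2 lin[OF U(2)] by (simp add: sum.distrib sum_subtractf right_diff_distrib)
qed

lemma leibniz_chart_expand:
  assumes U: "open U" "x \<in> U" and h: "W_section A U h" and u: "u \<in> tangent_space A x"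
    and V: "open V" "x \<in> V" and Y: "vector_field A V Y" and Z: "vector_field A V Z"
    and c: "(D, \<phi>) \<in> A" "x \<in> D"
  shows "leibniz x u h Y Z = (\<Sum>i\<in>Basis. \<Sum>j\<in>Basis. Y x (\<lambda>y. \<phi> y \<bullet> i) * Z x (\<lambda>y. \<phi> y \<bullet> j)
    * leibniz x u h (coord_vec A (D, \<phi>) i) (coord_vec A (D, \<phi>) j))"
proof -
  let ?k = "coord_vec A (D, \<phi>)"
  let ?N = "D \<inter> (U \<inter> V)"
  have N: "open ?N" "x \<in> ?N" using chart_homeomorphism(1)[OF c(1)] U V c by auto
  have hN: "W_section A ?N h" by (rule W_section_subset[OF h]) auto
  have k: "vector_field A ?N (?k e)" for e by (rule vector_field_subset[OF vector_field_coord[OF c(1)]]) auto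
  have half: "leibniz x u h Y Z = (\<Sum>i\<in>Basis. Y x (\<lambda>y. \<phi> y \<bullet> i) * leibniz x u h (?k i) Z)"
    if Y: "vector_field A V Y" and Z: "vector_field A ?N Z" for Y Z
  proof -
    have YN: "vector_field A ?N Y" by (rule vector_field_subset[OF Y]) auto
    have s: "smooth_fun A ?N (\<lambda>y. Y y (\<lambda>z. \<phi> z \<bullet> i))" for i
      by (rule vector_field_components[OF c(1) YN N(1)]) auto
    have "leibniz x u h Y Z = leibniz x u h (\<lambda>y f. \<Sum>i\<in>Basis. Y y (\<lambda>z. \<phi> z \<bullet> i) * ?k i y f) Z"
    proof (rule leibniz_cong[OF N _ _ u])
      show "vector_field A ?N (\<lambda>y f. \<Sum>i\<in>Basis. Y y (\<lambda>z. \<phi> z \<bullet> i) * ?k i y f)"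
        by (rule vector_field_sum) (use N s k in auto)
      fix y assume "y \<in> ?N"
      then show "Y y = (\<lambda>f. \<Sum>i\<in>Basis. Y y (\<lambda>z. \<phi> z \<bullet> i) * ?k i y f)"
        using tangent_rep(2)[OF c(1) _ vector_field_tangent[OF YN]] by (intro ext) auto
    qed
    also have "\<dots> = (\<Sum>i\<in>Basis. Y x (\<lambda>y. \<phi> y \<bullet> i) * leibniz x u h (?k i) Z)"
      by (rule leibniz_sum[OF N hN u finite_Basis k s Z])
    finally show ?thesis .
  qed
  have ZN: "vector_field A ?N Z" by (rule vector_field_subset[OF Z]) auto
  have "leibniz x u h (?k i) Z = (\<Sum>j\<in>Basis. Z x (\<lambda>y. \<phi> y \<bullet> j) * leibniz x u h (?k i) (?k j))" for i
    unfolding leibniz_sym[OF N hN u, of "?k i"] by (rule half[OF Z k])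
  then show ?thesis
    unfolding half[OF Y ZN] by (simp add: sum_distrib_left mult.assoc)
qed

text \<open>The form with matrix \<open>leibniz x u h (\<partial>\<^sub>i) (\<partial>\<^sub>j)\<close> in some chart meets the description of
  \<open>W_nabla\<close>, and no other form does, as coordinate fields are among the admissible test fields.\<close>

lemma
  assumes U: "open U" "x \<in> U" and h: "W_section A U h" and u: "u \<in> tangent_space A x"
  shows W_nabla_form: "W_nabla A nabla x u h \<in> sym_forms A x"
    and W_nabla_value: "open V \<Longrightarrow> x \<in> V \<Longrightarrow> vector_field A V Y \<Longrightarrow> vector_field A V Z \<Longrightarrow>
      W_nabla A nabla x u h (Y x) (Z x) = leibniz x u h Y Z"
proof -
  obtain D \<phi> where c: "(D, \<phi>) \<in> A" "x \<in> D" using chart_exists by blast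
  let ?k = "coord_vec A (D, \<phi>)"
  let ?P = "\<lambda>k. k \<in> sym_forms A x \<and> (\<forall>V Y Z. open V \<and> x \<in> V \<and> vector_field A V Y \<and> vector_field A V Z \<longrightarrow>
        k (Y x) (Z x) = leibniz x u h Y Z)"
  define K where "K = matrix_form \<phi> x (\<lambda>i j. leibniz x u h (?k i) (?k j))"
  have K: "?P K"
  proof (intro conjI allI impI)
    show "K \<in> sym_forms A x" unfolding K_def
      by (rule matrix_form_sym_forms) (rule leibniz_sym[OF U h u])
    fix V Y Z assume "open V \<and> x \<in> V \<and> vector_field A V Y \<and> vector_field A V Z"
    then show "K (Y x) (Z x) = leibniz x u h Y Z"
      unfolding K_def matrix_form_def
      using leibniz_chart_expand[OF U h u _ _ _ _ c, of V Y Z] vector_field_tangent by auto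
  qed
  moreover have "k = K" if k: "?P k" for k
  proof (rule form_eqI[OF _ _ c])
    show "k \<in> sym_forms A x" "K \<in> sym_forms A x" using k K by auto
    fix i j :: 'e
    have "open D \<and> x \<in> D \<and> vector_field A D (?k i) \<and> vector_field A D (?k j)"
      using c chart_homeomorphism(1) vector_field_coord by blast
    then show "k (?k i x) (?k j x) = K (?k i x) (?k j x)" using k K by metis
  qed
  ultimately have "?P (THE k. ?P k)" by (rule theI)
  then have "?P (W_nabla A nabla x u h)" unfolding W_nabla_def leibniz_def .
  then show "W_nabla A nabla x u h \<in> sym_forms A x"
    and "open V \<Longrightarrow> x \<in> V \<Longrightarrow> vector_field A V Y \<Longrightarrow> vector_field A V Z \<Longrightarrow>
      W_nabla A nabla x u h (Y x) (Z x) = leibniz x u h Y Z"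
    by blast+
qed

lemma W_nabla_eqI:
  assumes U: "open U" "x \<in> U" and h: "W_section A U h" and u: "u \<in> tangent_space A x"
    and k: "k \<in> sym_forms A x"
    and eq: "\<And>V Y Z. open V \<Longrightarrow> x \<in> V \<Longrightarrow> V \<subseteq> U \<Longrightarrow> vector_field A V Y \<Longrightarrow> vector_field A V Z \<Longrightarrow>
      k (Y x) (Z x) = leibniz x u h Y Z"
  shows "W_nabla A nabla x u h = k"
proof -
  obtain D \<phi> where c: "(D, \<phi>) \<in> A" "x \<in> D" using chart_exists by blast
  have V: "open (D \<inter> U)" "x \<in> D \<inter> U" "D \<inter> U \<subseteq> U" using chart_homeomorphism(1)[OF c(1)] U c by auto
  have "vector_field A (D \<inter> U) (coord_vec A (D, \<phi>) e)" for e
    by (rule vector_field_subset[OF vector_field_coord[OF c(1)]]) auto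
  then show ?thesis
    by (intro form_eqI[OF W_nabla_form[OF U h u] k c])
      (simp add: W_nabla_value[OF U h u V(1,2)] eq[OF V])
qed

lemma W_nabla_cong:
  assumes U: "open U" "x \<in> U" and h: "W_section A U h" and u: "u \<in> tangent_space A x"
    and eq: "\<And>y. y \<in> U \<Longrightarrow> h' y = h y"
  shows "W_nabla A nabla x u h' = W_nabla A nabla x u h"
proof -
  have "leibniz x u h' Y Z = leibniz x u h Y Z" for Y Z
    unfolding leibniz_def using tangent_cong[OF u U, of "\<lambda>y. h' y (Y y) (Z y)" "\<lambda>y. h y (Y y) (Z y)"] eq U
    by simp
  then show ?thesis unfolding W_nabla_def leibniz_def by simp
qed

lemma W_nabla_sum:
  assumes U: "open U" "x \<in> U" and u: "u \<in> tangent_space A x" and I: "finite I"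
    and h: "\<And>i. i \<in> I \<Longrightarrow> W_section A U (h i)" and c: "\<And>i. i \<in> I \<Longrightarrow> smooth_fun A U (c i)"
  shows "W_nabla A nabla x u (\<lambda>y a b. \<Sum>i\<in>I. c i y * h i y a b)
    = (\<lambda>a b. (\<Sum>i\<in>I. u (c i) * h i x a b) + (\<Sum>i\<in>I. c i x * W_nabla A nabla x u (h i) a b))"
proof (rule W_nabla_eqI[OF U W_section_sum[OF I U(1) h c] u])
  show "(\<lambda>a b. (\<Sum>i\<in>I. u (c i) * h i x a b) + (\<Sum>i\<in>I. c i x * W_nabla A nabla x u (h i) a b)) \<in> sym_forms A x"
    using W_section_form[OF h U(2)] W_nabla_form[OF U h u] by (intro sym_forms_add sym_forms_sum)
  fix V Y Z assume V: "open V" "x \<in> V" "V \<subseteq> U" and Y: "vector_field A V Y" and Z: "vector_field A V Z"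
  have s: "smooth_fun A V (\<lambda>y. h i y (Y y) (Z y))" "smooth_fun A V (c i)" if "i \<in> I" for i
    using W_section_smooth[OF h[OF that] V(1,3) Y Z] smooth_fun_subset[OF c[OF that] V(3)] by auto
  have "u (\<lambda>y. \<Sum>i\<in>I. c i y * h i y (Y y) (Z y)) = (\<Sum>i\<in>I. u (\<lambda>y. c i y * h i y (Y y) (Z y)))"
    by (rule tangent_sum_fun[OF u V(1,2) I]) (rule smooth_fun_mult[OF V(1) s(2,1)])
  also have "\<dots> = (\<Sum>i\<in>I. u (c i) * h i x (Y x) (Z x) + c i x * u (\<lambda>y. h i y (Y y) (Z y)))"
    by (intro sum.cong refl tangent_mult[OF u]) (use s smooth_nearI[OF V(1,2)] in auto)
  finally show "(\<Sum>i\<in>I. u (c i) * h i x (Y x) (Z x)) + (\<Sum>i\<in>I. c i x * W_nabla A nabla x u (h i) (Y x) (Z x))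
      = leibniz x u (\<lambda>y a b. \<Sum>i\<in>I. c i y * h i y a b) Y Z"
    using W_nabla_value[OF U h u V(1,2) Y Z]
    by (simp add: leibniz_def sum.distrib sum_subtractf right_diff_distrib)
qed

lemma W_nabla_diff:
  assumes U: "open U" "x \<in> U" and u: "u \<in> tangent_space A x"
    and h: "W_section A U h" and k: "W_section A U k"
  shows "W_nabla A nabla x u (\<lambda>y a b. h y a b - k y a b)
    = (\<lambda>a b. W_nabla A nabla x u h a b - W_nabla A nabla x u k a b)"
proof -
  have "W_nabla A nabla x u (\<lambda>y a b. \<Sum>t\<in>{False, True}. (if t then -1 else 1) * (if t then k else h) y a b)
    = (\<lambda>a b. (\<Sum>t\<in>{False, True}. u (\<lambda>y. if t then -1 else 1) * (if t then k else h) x a b)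
      + (\<Sum>t\<in>{False, True}. (if t then -1 else 1) * W_nabla A nabla x u (if t then k else h) a b))"
    by (rule W_nabla_sum[OF U u]) (use h k in \<open>auto simp: smooth_fun_const\<close>)
  then show ?thesis using u by simp
qed

lemma W_nabla_zero:
  assumes "u \<in> tangent_space A x"
  shows "W_nabla A nabla x u (\<lambda>y a b. 0) = (\<lambda>a b. 0)"
  using W_nabla_sum[OF open_UNIV UNIV_I assms finite.emptyI] by simp

lemma W_nabla_dir_sum:
  assumes U: "open U" "x \<in> U" and h: "W_section A U h" and I: "finite I"
    and v: "\<And>i. i \<in> I \<Longrightarrow> v i \<in> tangent_space A x"
  shows "W_nabla A nabla x (\<lambda>f. \<Sum>i\<in>I. c i * v i f) h = (\<lambda>a b. \<Sum>i\<in>I. c i * W_nabla A nabla x (v i) h a b)"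
proof (rule W_nabla_eqI[OF U h])
  show "(\<lambda>f. \<Sum>i\<in>I. c i * v i f) \<in> tangent_space A x" by (rule tangent_sum[OF I v])
  show "(\<lambda>a b. \<Sum>i\<in>I. c i * W_nabla A nabla x (v i) h a b) \<in> sym_forms A x"
    by (rule sym_forms_sum) (rule W_nabla_form[OF U h v])
  fix V Y Z assume V: "open V" "x \<in> V" "V \<subseteq> U" and Y: "vector_field A V Y" and Z: "vector_field A V Z"
  note hx = W_section_form[OF h U(2)]
  show "(\<Sum>i\<in>I. c i * W_nabla A nabla x (v i) h (Y x) (Z x)) = leibniz x (\<lambda>f. \<Sum>i\<in>I. c i * v i f) h Y Z"
    using W_nabla_value[OF U h v V(1,2) Y Z]
    by (simp add: leibniz_def nabla_dir_sum[OF V(1,2) Y I v] nabla_dir_sum[OF V(1,2) Z I v]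
        form_sum_left[OF hx I nabla_tangent[OF V(1) Y V(2) v]]
        form_sum_right[OF hx I nabla_tangent[OF V(1) Z V(2) v]]
        sum_subtractf right_diff_distrib)
qed

lemma W_section_W_nabla:
  assumes U: "open U" and X: "vector_field A U X" and h: "W_section A U h"
  shows "W_section A U (\<lambda>y. W_nabla A nabla y (X y) h)"
  unfolding W_section_def
proof (intro conjI ballI allI impI)
  fix y assume "y \<in> U"
  then show "W_nabla A nabla y (X y) h \<in> sym_forms A y"
    using W_nabla_form[OF U _ h] vector_field_tangent[OF X] by blast
next
  fix V Y Z assume V: "open V \<and> V \<subseteq> U \<and> vector_field A V Y \<and> vector_field A V Z"
  have XV: "vector_field A V X" using vector_field_subset[OF X] V by blast
  have "smooth_fun A V (\<lambda>y. leibniz y (X y) h Y Z)"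
    unfolding leibniz_def
    using V vector_field_smooth[OF XV] W_section_smooth[OF h] vector_field_nabla[OF _ XV]
    by (intro smooth_fun_diff) auto
  moreover have "smooth_fun A V (\<lambda>y. W_nabla A nabla y (X y) h (Y y) (Z y))
      \<longleftrightarrow> smooth_fun A V (\<lambda>y. leibniz y (X y) h Y Z)"
    by (rule smooth_fun_cong)
      (use V W_nabla_value[OF U _ h] vector_field_tangent[OF X] in \<open>auto simp: subset_iff\<close>)
  ultimately show "smooth_fun A V (\<lambda>y. W_nabla A nabla y (X y) h (Y y) (Z y))" by simp
qed

end

section \<open>Curvature\<close>

context manifold_connection
begin

text \<open>The curvature of \<open>\<nabla>\<close> itself. It serves to express the curvature on forms without any
  derivative of the form, and to show that only the values of the vector fields at \<open>x\<close> matter.\<close>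

definition curv :: "'m \<Rightarrow> ('m \<Rightarrow> 'm tvec) \<Rightarrow> ('m \<Rightarrow> 'm tvec) \<Rightarrow> ('m \<Rightarrow> 'm tvec) \<Rightarrow> 'm tvec" where
  "curv x X Y Z = (\<lambda>f. nabla x (X x) (\<lambda>y. nabla y (Y y) Z) f - nabla x (Y x) (\<lambda>y. nabla y (X y) Z) f
     - nabla x (lie_bracket A X Y x) Z f)"

lemma curv_eq_tadd:
  "curv x X Y Z = tadd (nabla x (X x) (\<lambda>y. nabla y (Y y) Z))
     (tadd (tscale (-1) (nabla x (Y x) (\<lambda>y. nabla y (X y) Z)))
       (tscale (-1) (nabla x (lie_bracket A X Y x) Z)))"
  by (rule ext) (simp add: curv_def tadd_def tscale_def)

lemma form_curv:
  assumes U: "open U" "x \<in> U" and XYZ: "vector_field A U X" "vector_field A U Y" "vector_field A U Z"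
    and h: "h \<in> sym_forms A x"
  shows "h (curv x X Y Z) b = h (nabla x (X x) (\<lambda>y. nabla y (Y y) Z)) b
    - h (nabla x (Y x) (\<lambda>y. nabla y (X y) Z)) b - h (nabla x (lie_bracket A X Y x) Z) b"
proof -
  have "nabla x (X x) (\<lambda>y. nabla y (Y y) Z) \<in> tangent_space A x"
    "nabla x (Y x) (\<lambda>y. nabla y (X y) Z) \<in> tangent_space A x"
    "nabla x (lie_bracket A X Y x) Z \<in> tangent_space A x"
    using U XYZ vector_field_tangent vector_field_nabla lie_bracket_tangent
    by (auto intro!: nabla_tangent[OF U(1) _ U(2)])
  then show ?thesis
    unfolding curv_eq_tadd by (simp add: form_tadd[OF h] form_tscale[OF h] tangent_tadd tangent_tscale)
qed

lemma curv_antisym: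
  assumes U: "open U" "x \<in> U" and XYZ: "vector_field A U X" "vector_field A U Y" "vector_field A U Z"
  shows "curv x Y X Z = tscale (-1) (curv x X Y Z)"
proof -
  have "lie_bracket A Y X x = tscale (-1) (lie_bracket A X Y x)"
    by (rule ext) (simp add: lie_bracket_def tscale_def)
  then have "nabla x (lie_bracket A Y X x) Z = tscale (-1) (nabla x (lie_bracket A X Y x) Z)"
    using nabla_dir_tscale[OF U(1) XYZ(3) U(2) lie_bracket_tangent[OF XYZ(1,2) U]] by simp
  then show ?thesis by (intro ext) (simp add: curv_def tscale_def)
qed

text \<open>Linearity over the smooth functions: the derivatives of the coefficients \<open>\<xi> i\<close> that come from
  \<open>\<nabla>\<^sub>Y \<nabla>\<^sub>X Z\<close> cancel against those in the Lie bracket.\<close>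

lemma curv_sum:
  assumes U: "open U" "x \<in> U" and I: "finite I" and X: "\<And>i. i \<in> I \<Longrightarrow> vector_field A U (X i)"
    and \<xi>: "\<And>i. i \<in> I \<Longrightarrow> smooth_fun A U (\<xi> i)"
    and Y: "vector_field A U Y" and Z: "vector_field A U Z"
  shows "curv x (\<lambda>y f. \<Sum>i\<in>I. \<xi> i y * X i y f) Y Z = (\<lambda>f. \<Sum>i\<in>I. \<xi> i x * curv x (X i) Y Z f)"
proof -
  let ?X = "\<lambda>y f. \<Sum>i\<in>I. \<xi> i y * X i y f"
  have T: "Y x \<in> tangent_space A x" "\<And>i. i \<in> I \<Longrightarrow> X i x \<in> tangent_space A x"
    "\<And>i. i \<in> I \<Longrightarrow> lie_bracket A (X i) Y x \<in> tangent_space A x"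
    using vector_field_tangent[OF X] vector_field_tangent[OF Y] lie_bracket_tangent[OF X Y] U by auto
  have YZ: "vector_field A U (\<lambda>y. nabla y (Y y) Z)" by (rule vector_field_nabla[OF U(1) Y Z])
  have XZ: "vector_field A U (\<lambda>y. nabla y (X i y) Z)" if "i \<in> I" for i
    by (rule vector_field_nabla[OF U(1) X[OF that] Z])
  have 1: "nabla x (?X x) (\<lambda>y. nabla y (Y y) Z) = (\<lambda>f. \<Sum>i\<in>I. \<xi> i x * nabla x (X i x) (\<lambda>y. nabla y (Y y) Z) f)"
    using U YZ I T(2) by (rule nabla_dir_sum)
  have "nabla x (Y x) (\<lambda>y. nabla y (?X y) Z) = nabla x (Y x) (\<lambda>y f. \<Sum>i\<in>I. \<xi> i y * nabla y (X i y) Z f)"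
  proof (rule nabla_cong[OF U(1) _ U(2) T(1)])
    show "vector_field A U (\<lambda>y f. \<Sum>i\<in>I. \<xi> i y * nabla y (X i y) Z f)"
      using I U(1) XZ \<xi> by (rule vector_field_sum)
    fix y assume y: "y \<in> U"
    show "nabla y (?X y) Z = (\<lambda>f. \<Sum>i\<in>I. \<xi> i y * nabla y (X i y) Z f)"
      using U(1) y Z I vector_field_tangent[OF X y] by (rule nabla_dir_sum)
  qed
  also have "\<dots> = tadd (\<lambda>f. \<Sum>i\<in>I. Y x (\<xi> i) * nabla x (X i x) Z f)
      (\<lambda>f. \<Sum>i\<in>I. \<xi> i x * nabla x (Y x) (\<lambda>y. nabla y (X i y) Z) f)"
    using U T(1) I XZ \<xi> by (rule nabla_sum)
  finally have 2: "nabla x (Y x) (\<lambda>y. nabla y (?X y) Z) = tadd (\<lambda>f. \<Sum>i\<in>I. Y x (\<xi> i) * nabla x (X i x) Z f)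
      (\<lambda>f. \<Sum>i\<in>I. \<xi> i x * nabla x (Y x) (\<lambda>y. nabla y (X i y) Z) f)" .
  have "lie_bracket A ?X Y x f = (\<Sum>i\<in>I. \<xi> i x * lie_bracket A (X i) Y x f) + (\<Sum>i\<in>I. (- Y x (\<xi> i)) * X i x f)" for f
  proof (cases "smooth_near A x f")
    case True
    then obtain V where V: "open V" "x \<in> V" "smooth_fun A V f" by (auto simp: smooth_near_def)
    let ?N = "U \<inter> V"
    have N: "open ?N" "x \<in> ?N" using U V by auto
    have s: "smooth_fun A ?N (\<xi> i)" "smooth_fun A ?N (\<lambda>y. X i y f)" if "i \<in> I" for i
      using smooth_fun_subset[OF \<xi>[OF that]] vector_field_smooth[OF X[OF that] N(1) _ smooth_fun_subset[OF V(3)]]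
      by auto
    have "Y x (\<lambda>y. ?X y f) = (\<Sum>i\<in>I. Y x (\<lambda>y. \<xi> i y * X i y f))"
      by (rule tangent_sum_fun[OF T(1) N I]) (rule smooth_fun_mult[OF N(1) s])
    also have "\<dots> = (\<Sum>i\<in>I. Y x (\<xi> i) * X i x f + \<xi> i x * Y x (\<lambda>y. X i y f))"
      by (intro sum.cong refl tangent_mult[OF T(1)]) (use s smooth_nearI[OF N] in auto)
    finally show ?thesis
      unfolding lie_bracket_smooth_near[OF True]
      by (simp add: sum.distrib sum_subtractf right_diff_distrib sum_negf)
  next
    case False
    have "X i x f = 0" if "i \<in> I" for i
      using T(2)[OF that] False by (auto simp: tangent_space_def coord_vec_def)
    then show ?thesis using False by (simp add: lie_bracket_def)
  qed
  then have "lie_bracket A ?X Y x = tadd (\<lambda>f. \<Sum>i\<in>I. \<xi> i x * lie_bracket A (X i) Y x f) (\<lambda>f. \<Sum>i\<in>I. (- Y x (\<xi> i)) * X i x f)"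
    by (intro ext) (simp add: tadd_def)
  moreover have "nabla x (\<lambda>f. \<Sum>i\<in>I. \<xi> i x * lie_bracket A (X i) Y x f) Z
      = (\<lambda>f. \<Sum>i\<in>I. \<xi> i x * nabla x (lie_bracket A (X i) Y x) Z f)"
    using U Z I T(3) by (rule nabla_dir_sum)
  moreover have "nabla x (\<lambda>f. \<Sum>i\<in>I. (- Y x (\<xi> i)) * X i x f) Z = (\<lambda>f. \<Sum>i\<in>I. (- Y x (\<xi> i)) * nabla x (X i x) Z f)"
    using U Z I T(2) by (rule nabla_dir_sum)
  ultimately have 3: "nabla x (lie_bracket A ?X Y x) Z
      = tadd (\<lambda>f. \<Sum>i\<in>I. \<xi> i x * nabla x (lie_bracket A (X i) Y x) Z f) (\<lambda>f. \<Sum>i\<in>I. (- Y x (\<xi> i)) * nabla x (X i x) Z f)"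
    using nabla_dir_tadd[OF U(1) Z U(2) tangent_sum[where c = "\<lambda>i. \<xi> i x" and v = "\<lambda>i. lie_bracket A (X i) Y x", OF I T(3)]
        tangent_sum[where c = "\<lambda>i. - Y x (\<xi> i)" and v = "\<lambda>i. X i x", OF I T(2)]] by simp
  show ?thesis
    unfolding curv_def 1 2 3
    by (rule ext) (simp add: tadd_def sum.distrib sum_subtractf right_diff_distrib sum_negf)
qed

lemma curv_cong:
  assumes U: "open U" "x \<in> U" and X: "vector_field A U X" "\<And>y. y \<in> U \<Longrightarrow> X' y = X y"
    and Y: "vector_field A U Y" and Z: "vector_field A U Z"
  shows "curv x X' Y Z = curv x X Y Z"
proof -
  have T: "Y x \<in> tangent_space A x" by (rule vector_field_tangent[OF Y U(2)])
  have "nabla x (Y x) (\<lambda>y. nabla y (X' y) Z) = nabla x (Y x) (\<lambda>y. nabla y (X y) Z)"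
    by (rule nabla_cong[OF U(1) vector_field_nabla[OF U(1) X(1) Z] U(2) T]) (simp add: X(2))
  moreover have "Y x (\<lambda>y. X' y f) = Y x (\<lambda>y. X y f)" for f
    by (rule tangent_cong[OF T U]) (simp add: X(2))
  then have "lie_bracket A X' Y x = lie_bracket A X Y x"
    by (intro ext) (simp add: lie_bracket_def X(2)[OF U(2)])
  ultimately show ?thesis by (simp add: curv_def X(2)[OF U(2)])
qed

lemma curv_chart_expand:
  assumes U: "open U" "x \<in> U" and X: "vector_field A U X" and Y: "vector_field A U Y"
    and Z: "vector_field A U Z" and c: "(D, \<phi>) \<in> A" "x \<in> D"
  shows "curv x X Y Z = (\<lambda>f. \<Sum>i\<in>Basis. X x (\<lambda>y. \<phi> y \<bullet> i) * curv x (coord_vec A (D, \<phi>) i) Y Z f)"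
proof -
  let ?k = "coord_vec A (D, \<phi>)"
  let ?N = "D \<inter> U"
  have N: "open ?N" "x \<in> ?N" using chart_homeomorphism(1)[OF c(1)] U c by auto
  have k: "vector_field A ?N (?k e)" for e by (rule vector_field_subset[OF vector_field_coord[OF c(1)]]) auto
  have XN: "vector_field A ?N X" and YN: "vector_field A ?N Y" and ZN: "vector_field A ?N Z"
    using X Y Z vector_field_subset by blast+
  have s: "smooth_fun A ?N (\<lambda>y. X y (\<lambda>z. \<phi> z \<bullet> i))" for i
    by (rule vector_field_components[OF c(1) XN N(1)]) auto
  have "curv x X Y Z = curv x (\<lambda>y f. \<Sum>i\<in>Basis. X y (\<lambda>z. \<phi> z \<bullet> i) * ?k i y f) Y Z"
  proof (rule curv_cong[OF N _ _ YN ZN])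
    show "vector_field A ?N (\<lambda>y f. \<Sum>i\<in>Basis. X y (\<lambda>z. \<phi> z \<bullet> i) * ?k i y f)"
      by (rule vector_field_sum) (use N s k in auto)
    fix y assume "y \<in> ?N"
    then show "X y = (\<lambda>f. \<Sum>i\<in>Basis. X y (\<lambda>z. \<phi> z \<bullet> i) * ?k i y f)"
      using tangent_rep(2)[OF c(1) _ vector_field_tangent[OF XN]] by (intro ext) auto
  qed
  also have "\<dots> = (\<lambda>f. \<Sum>i\<in>Basis. X x (\<lambda>y. \<phi> y \<bullet> i) * curv x (?k i) Y Z f)"
    by (rule curv_sum[OF N finite_Basis k s YN ZN])
  finally show ?thesis .
qed

text \<open>Linearity over the smooth functions, in \<open>X\<close> directly and in \<open>Y\<close> by antisymmetry, reduces the
  curvature to coordinate fields with the components of \<open>X x\<close> and \<open>Y x\<close> as coefficients.\<close>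

lemma curv_pointwise:
  assumes U: "open U" "x \<in> U" "vector_field A U X" "vector_field A U Y"
    and U': "open U'" "x \<in> U'" "vector_field A U' X'" "vector_field A U' Y'"
    and eq: "X' x = X x" "Y' x = Y x"
    and Z: "open V" "x \<in> V" "vector_field A V Z"
  shows "curv x X' Y' Z = curv x X Y Z"
proof -
  let ?N = "U \<inter> U' \<inter> V"
  have N: "open ?N" "x \<in> ?N" using U U' Z by auto
  have F: "vector_field A ?N X" "vector_field A ?N Y" "vector_field A ?N X'" "vector_field A ?N Y'"
    "vector_field A ?N Z"
    using vector_field_subset[OF U(3), of ?N] vector_field_subset[OF U(4), of ?N]
      vector_field_subset[OF U'(3), of ?N] vector_field_subset[OF U'(4), of ?N]
      vector_field_subset[OF Z(3), of ?N] by auto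
  obtain D \<phi> where c: "(D, \<phi>) \<in> A" "x \<in> D" using chart_exists by blast
  have "curv x X' Y Z = curv x X Y Z" if "vector_field A ?N X" "vector_field A ?N X'" "X' x = X x"
    "vector_field A ?N Y" for X X' Y
    using curv_chart_expand[OF N that(1,4) F(5) c] curv_chart_expand[OF N that(2,4) F(5) c] that(3) by simp
  note left = this
  have "curv x X' Y' Z = tscale (-1) (curv x Y' X' Z)" by (rule curv_antisym[OF N F(4,3,5)])
  also have "\<dots> = tscale (-1) (curv x Y X' Z)" using left[OF F(2,4) eq(2) F(3)] by simp
  also have "\<dots> = curv x X' Y Z" by (rule curv_antisym[OF N F(2,3,5), symmetric])
  also have "\<dots> = curv x X Y Z" by (rule left[OF F(1,3) eq(1) F(2)])
  finally show ?thesis .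
qed

definition W_curv :: "'m \<Rightarrow> ('m \<Rightarrow> 'm tvec) \<Rightarrow> ('m \<Rightarrow> 'm tvec) \<Rightarrow> ('m \<Rightarrow> 'm form) \<Rightarrow> 'm form" where
  "W_curv x X Y h = (\<lambda>a b. W_nabla A nabla x (X x) (\<lambda>y. W_nabla A nabla y (Y y) h) a b
     - W_nabla A nabla x (Y x) (\<lambda>y. W_nabla A nabla y (X y) h) a b
     - W_nabla A nabla x (lie_bracket A X Y x) h a b)"

lemma W_curv_form:
  assumes U: "open U" "x \<in> U" and X: "vector_field A U X" and Y: "vector_field A U Y" and h: "W_section A U h"
  shows "W_curv x X Y h \<in> sym_forms A x"
  unfolding W_curv_def
  using vector_field_tangent[OF X U(2)] vector_field_tangent[OF Y U(2)] lie_bracket_tangent[OF X Y U]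
    W_section_W_nabla[OF U(1) X h] W_section_W_nabla[OF U(1) Y h] h
  by (intro sym_forms_diff W_nabla_form[OF U])

text \<open>Expanding both covariant derivatives by the Leibniz rule, all terms in which a derivative of
  \<open>h\<close> survives are symmetric in \<open>X\<close> and \<open>Y\<close> or cancel against the bracket term.\<close>

lemma W_curv_value:
  assumes U: "open U" "x \<in> U" and X: "vector_field A U X" and Y: "vector_field A U Y"
    and h: "W_section A U h" and P: "vector_field A U P" and Q: "vector_field A U Q"
  shows "W_curv x X Y h (P x) (Q x) = - h x (curv x X Y P) (Q x) - h x (P x) (curv x X Y Q)"
proof -
  note hx = W_section_form[OF h U(2)]
  have second: "W_nabla A nabla x (X x) (\<lambda>y. W_nabla A nabla y (Y y) h) (P x) (Q x)
      = X x (\<lambda>y. Y y (\<lambda>z. h z (P z) (Q z)))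
        - X x (\<lambda>y. h y (nabla y (Y y) P) (Q y)) - X x (\<lambda>y. h y (P y) (nabla y (Y y) Q))
        - (Y x (\<lambda>y. h y (nabla y (X y) P) (Q y)) - h x (nabla x (Y x) (\<lambda>y. nabla y (X y) P)) (Q x)
           - h x (nabla x (X x) P) (nabla x (Y x) Q))
        - (Y x (\<lambda>y. h y (P y) (nabla y (X y) Q)) - h x (nabla x (Y x) P) (nabla x (X x) Q)
           - h x (P x) (nabla x (Y x) (\<lambda>y. nabla y (X y) Q)))"
    if X: "vector_field A U X" and Y: "vector_field A U Y" for X Y
  proof -
    have T: "X x \<in> tangent_space A x" "Y x \<in> tangent_space A x"
      using X Y U vector_field_tangent by blast+
    have XP: "vector_field A U (\<lambda>y. nabla y (X y) P)" and XQ: "vector_field A U (\<lambda>y. nabla y (X y) Q)"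
      and YP: "vector_field A U (\<lambda>y. nabla y (Y y) P)" and YQ: "vector_field A U (\<lambda>y. nabla y (Y y) Q)"
      using X Y P Q U vector_field_nabla by blast+
    have n: "smooth_near A x (\<lambda>y. Y y (\<lambda>z. h z (P z) (Q z)))"
      "smooth_near A x (\<lambda>y. h y (nabla y (Y y) P) (Q y))"
      "smooth_near A x (\<lambda>y. h y (P y) (nabla y (Y y) Q))"
      using W_section_smooth[OF h U(1) order_refl] vector_field_smooth[OF Y U(1) order_refl] P Q YP YQ
      by (auto intro!: smooth_nearI[OF U])
    have n': "smooth_near A x (\<lambda>y. Y y (\<lambda>z. h z (P z) (Q z)) - h y (nabla y (Y y) P) (Q y))"
      using W_section_smooth[OF h U(1) order_refl] vector_field_smooth[OF Y U(1) order_refl] P Q YP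
      by (auto intro!: smooth_nearI[OF U] smooth_fun_diff U)
    have "X x (\<lambda>y. W_nabla A nabla y (Y y) h (P y) (Q y)) = X x (\<lambda>y. leibniz y (Y y) h P Q)"
      by (rule tangent_cong[OF T(1) U])
        (use W_nabla_value[OF U(1) _ h _ U(1) _ P Q] vector_field_tangent[OF Y] in auto)
    also have "\<dots> = X x (\<lambda>y. Y y (\<lambda>z. h z (P z) (Q z)))
        - X x (\<lambda>y. h y (nabla y (Y y) P) (Q y)) - X x (\<lambda>y. h y (P y) (nabla y (Y y) Q))"
      unfolding leibniz_def tangent_diff[OF T(1) n' n(3)] tangent_diff[OF T(1) n(1,2)] ..
    finally show ?thesis
      unfolding W_nabla_value[OF U W_section_W_nabla[OF U(1) Y h] T(1) U P Q]
      using W_nabla_value[OF U h T(2) U XP Q] W_nabla_value[OF U h T(2) U P XQ]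
      by (simp add: leibniz_def)
  qed
  have T: "X x \<in> tangent_space A x" "Y x \<in> tangent_space A x" "lie_bracket A X Y x \<in> tangent_space A x"
    using X Y U vector_field_tangent lie_bracket_tangent by blast+
  have "smooth_near A x (\<lambda>z. h z (P z) (Q z))"
    by (rule smooth_nearI[OF U W_section_smooth[OF h U(1) order_refl P Q]])
  then have "W_nabla A nabla x (lie_bracket A X Y x) h (P x) (Q x)
      = X x (\<lambda>y. Y y (\<lambda>z. h z (P z) (Q z))) - Y x (\<lambda>y. X y (\<lambda>z. h z (P z) (Q z)))
        - h x (nabla x (lie_bracket A X Y x) P) (Q x) - h x (P x) (nabla x (lie_bracket A X Y x) Q)"
    unfolding W_nabla_value[OF U h T(3) U P Q] leibniz_def by (simp add: lie_bracket_smooth_near)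
  then show ?thesis
    unfolding W_curv_def second[OF X Y] second[OF Y X] form_curv[OF U X Y P hx]
      form_sym[OF hx, of "P x" "curv x X Y Q"] form_curv[OF U X Y Q hx]
    by (simp add: form_sym[OF hx, of _ "P x"])
qed

text \<open>By the previous formula \<open>W_curv x X Y h\<close> depends on the values of \<open>X\<close>, \<open>Y\<close> and \<open>h\<close> at \<open>x\<close> only, so
  the description of \<open>W_curvature\<close> is met by exactly one form.\<close>

lemma W_curvature_eq:
  assumes U: "open U" "x \<in> U" and X: "vector_field A U X" and Y: "vector_field A U Y" and h: "W_section A U h"
  shows "W_curvature A nabla x (X x) (Y x) (h x) = W_curv x X Y h"
proof -
  have eq: "W_curv x X' Y' h' = W_curv x X Y h"
    if U': "open U'" "x \<in> U'" and X': "vector_field A U' X'" and Y': "vector_field A U' Y'"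
      and h': "W_section A U' h'" and e: "X' x = X x" "Y' x = Y x" "h' x = h x" for U' X' Y' h'
  proof -
    obtain D \<phi> where c: "(D, \<phi>) \<in> A" "x \<in> D" using chart_exists by blast
    let ?k = "coord_vec A (D, \<phi>)"
    let ?N = "D \<inter> (U \<inter> U')"
    have N: "open ?N" "x \<in> ?N" using chart_homeomorphism(1)[OF c(1)] U U' c by auto
    have k: "vector_field A ?N (?k e)" for e by (rule vector_field_subset[OF vector_field_coord[OF c(1)]]) auto
    have F: "vector_field A ?N X" "vector_field A ?N Y" "vector_field A ?N X'" "vector_field A ?N Y'"
      "W_section A ?N h" "W_section A ?N h'"
      using vector_field_subset[OF X, of ?N] vector_field_subset[OF Y, of ?N]
        vector_field_subset[OF X', of ?N] vector_field_subset[OF Y', of ?N]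
        W_section_subset[OF h, of ?N] W_section_subset[OF h', of ?N] by auto
    show ?thesis
    proof (rule form_eqI[OF W_curv_form[OF U' X' Y' h'] W_curv_form[OF U X Y h] c])
      fix i j :: 'e
      show "W_curv x X' Y' h' (?k i x) (?k j x) = W_curv x X Y h (?k i x) (?k j x)"
        using W_curv_value[OF N F(1,2,5) k k] W_curv_value[OF N F(3,4,6) k k]
          curv_pointwise[OF N F(1,2) N F(3,4) e(1,2) N k] e(3) by metis
    qed
  qed
  show ?thesis
    unfolding W_curvature_def
  proof (rule the_equality)
    show "\<forall>U' X' Y' h'. open U' \<and> x \<in> U' \<and> vector_field A U' X' \<and> vector_field A U' Y' \<and> W_section A U' h' \<and>
        X' x = X x \<and> Y' x = Y x \<and> h' x = h x \<longrightarrow>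
        W_curv x X Y h = (\<lambda>a b. W_nabla A nabla x (X' x) (\<lambda>y. W_nabla A nabla y (Y' y) h') a b
          - W_nabla A nabla x (Y' x) (\<lambda>y. W_nabla A nabla y (X' y) h') a b
          - W_nabla A nabla x (lie_bracket A X' Y' x) h' a b)"
      using eq unfolding W_curv_def[of _ _ _ "_ :: 'm \<Rightarrow> 'm form", symmetric] by metis
  next
    fix k assume "\<forall>U' X' Y' h'. open U' \<and> x \<in> U' \<and> vector_field A U' X' \<and> vector_field A U' Y' \<and> W_section A U' h' \<and>
        X' x = X x \<and> Y' x = Y x \<and> h' x = h x \<longrightarrow>
        k = (\<lambda>a b. W_nabla A nabla x (X' x) (\<lambda>y. W_nabla A nabla y (Y' y) h') a b
          - W_nabla A nabla x (Y' x) (\<lambda>y. W_nabla A nabla y (X' y) h') a b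
          - W_nabla A nabla x (lie_bracket A X' Y' x) h' a b)"
    then show "k = W_curv x X Y h" unfolding W_curv_def using U X Y h by blast
  qed
qed

text \<open>Membership in the kernel in terms of vector fields: every pair of tangent vectors extends to a
  pair of coordinate fields.\<close>

lemma ker_curvature_iff:
  assumes U: "open U" "x \<in> U" and h: "W_section A U h"
  shows "(x, h x) \<in> ker_curvature A nabla \<longleftrightarrow>
    (\<forall>V X Y. open V \<and> x \<in> V \<and> vector_field A V X \<and> vector_field A V Y \<longrightarrow> W_curv x X Y h = (\<lambda>a b. 0))"
proof -
  obtain D \<phi> where c: "(D, \<phi>) \<in> A" "x \<in> D" using chart_exists by blast
  let ?k = "coord_vec A (D, \<phi>)"
  have D: "open D" by (rule chart_homeomorphism(1)[OF c(1)])
  have curvature: "W_curvature A nabla x (X x) (Y x) (h x) = W_curv x X Y h"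
    if "open V" "x \<in> V" "vector_field A V X" "vector_field A V Y" for V X Y
    using that U W_section_subset[OF h, of "U \<inter> V"] vector_field_subset[of V X "U \<inter> V"]
      vector_field_subset[of V Y "U \<inter> V"]
    by (intro W_curvature_eq[of "U \<inter> V"]) auto
  have "W_curvature A nabla x u v (h x) = (\<lambda>a b. 0)"
    if *: "\<forall>V X Y. open V \<and> x \<in> V \<and> vector_field A V X \<and> vector_field A V Y \<longrightarrow> W_curv x X Y h = (\<lambda>a b. 0)"
      and uv: "u \<in> tangent_space A x" "v \<in> tangent_space A x" for u v
  proof -
    obtain e e' where e: "u = ?k e x" "v = ?k e' x" using uv tangent_space_chart[OF c] by auto
    show ?thesis
      unfolding e curvature[OF D c(2) vector_field_coord[OF c(1)] vector_field_coord[OF c(1)]]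
      using * D c(2) vector_field_coord[OF c(1)] by blast
  qed
  moreover have "W_curv x X Y h = (\<lambda>a b. 0)"
    if "(x, h x) \<in> ker_curvature A nabla" "open V" "x \<in> V" "vector_field A V X" "vector_field A V Y" for V X Y
    using that curvature[OF that(2-5)] vector_field_tangent[OF that(4,3)] vector_field_tangent[OF that(5,3)]
    by (auto simp: ker_curvature_def)
  ultimately show ?thesis
    using W_section_form[OF h U(2)] by (auto simp: ker_curvature_def W_bundle_def)
qed

end

section \<open>Orthogonal systems of sections\<close>

text \<open>Bessel's inequality for each of the standard basis vectors, summed up.\<close>

lemma orthogonal_family_card_bound:
  fixes v :: "nat \<Rightarrow> 'i \<Rightarrow> real"
  assumes I: "finite I"
    and nz: "\<And>l. l < n \<Longrightarrow> (\<Sum>p\<in>I. v l p * v l p) \<noteq> 0"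
    and orth: "\<And>l m. l < n \<Longrightarrow> m < n \<Longrightarrow> l \<noteq> m \<Longrightarrow> (\<Sum>p\<in>I. v l p * v m p) = 0"
  shows "n \<le> card I"
proof -
  define q where "q = (\<lambda>l. \<Sum>p\<in>I. v l p * v l p)"
  have bessel: "(\<Sum>l<n. v l r * v l r / q l) \<le> 1" if r: "r \<in> I" for r
  proof -
    define c where "c = (\<lambda>l. v l r / q l)"
    let ?d = "\<lambda>p. if p = r then 1 else 0 :: real"
    have "0 \<le> (\<Sum>p\<in>I. (?d p - (\<Sum>l<n. c l * v l p)) * (?d p - (\<Sum>l<n. c l * v l p)))"
      by (intro sum_nonneg) simp
    also have "\<dots> = (\<Sum>p\<in>I. ?d p * ?d p) - 2 * (\<Sum>p\<in>I. ?d p * (\<Sum>l<n. c l * v l p))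
        + (\<Sum>p\<in>I. (\<Sum>l<n. c l * v l p) * (\<Sum>m<n. c m * v m p))"
      by (simp add: algebra_simps sum.distrib sum_subtractf sum_distrib_left)
    also have "(\<Sum>p\<in>I. ?d p * ?d p) = 1" using I r by (simp add: sum.delta if_distrib cong: if_cong)
    also have "(\<Sum>p\<in>I. ?d p * (\<Sum>l<n. c l * v l p)) = (\<Sum>l<n. c l * v l r)"
      using I r by (simp add: if_distribR if_distrib[of "\<lambda>x. x * _"] sum.delta cong: if_cong)
    also have "(\<Sum>p\<in>I. (\<Sum>l<n. c l * v l p) * (\<Sum>m<n. c m * v m p))
        = (\<Sum>p\<in>I. \<Sum>l<n. \<Sum>m<n. c l * c m * (v l p * v m p))"
      by (intro sum.cong refl) (simp add: sum_product mult.assoc mult.left_commute)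
    also have "\<dots> = (\<Sum>l<n. \<Sum>p\<in>I. \<Sum>m<n. c l * c m * (v l p * v m p))" by (rule sum.swap)
    also have "\<dots> = (\<Sum>l<n. \<Sum>m<n. \<Sum>p\<in>I. c l * c m * (v l p * v m p))"
      by (intro sum.cong refl) (rule sum.swap)
    also have "\<dots> = (\<Sum>l<n. \<Sum>m<n. c l * c m * (\<Sum>p\<in>I. v l p * v m p))"
      by (simp add: sum_distrib_left)
    also have "\<dots> = (\<Sum>l<n. \<Sum>m<n. if m = l then c l * c l * q l else 0)"
      by (intro sum.cong refl) (use orth in \<open>auto simp: q_def\<close>)
    also have "\<dots> = (\<Sum>l<n. c l * v l r)"
      by (intro sum.cong refl) (use nz in \<open>auto simp: c_def q_def[symmetric]\<close>)
    finally have "(\<Sum>l<n. c l * v l r) \<le> 1" by simp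
    then show ?thesis by (simp add: c_def)
  qed
  have "real n = (\<Sum>l<n. q l / q l)" using nz by (simp add: q_def)
  also have "\<dots> = (\<Sum>l<n. \<Sum>r\<in>I. v l r * v l r / q l)" by (intro sum.cong refl) (simp add: q_def sum_divide_distrib[symmetric])
  also have "\<dots> = (\<Sum>r\<in>I. \<Sum>l<n. v l r * v l r / q l)" by (rule sum.swap)
  also have "\<dots> \<le> (\<Sum>r\<in>I. 1)" by (rule sum_mono) (rule bessel)
  finally show ?thesis by simp
qed

context smooth_manifold
begin

text \<open>The Euclidean inner product of the coordinate matrices of two forms. Any smooth inner product
  on the forms would do; it makes coefficients with respect to a frame smooth.\<close>

definition form_ip :: "('m, 'e) chart \<Rightarrow> 'm \<Rightarrow> 'm form \<Rightarrow> 'm form \<Rightarrow> real" where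
  "form_ip c y h k = (\<Sum>(i, j)\<in>Basis \<times> Basis.
     h (coord_vec A c i y) (coord_vec A c j y) * k (coord_vec A c i y) (coord_vec A c j y))"

lemma form_ip_commute: "form_ip c y h k = form_ip c y k h"
  by (simp add: form_ip_def mult.commute)

lemma form_ip_diff: "form_ip c y (\<lambda>a b. h a b - h' a b) k = form_ip c y h k - form_ip c y h' k"
  by (simp add: form_ip_def case_prod_unfold left_diff_distrib sum_subtractf)

lemma form_ip_sum: "form_ip c y (\<lambda>a b. \<Sum>i\<in>I. r i * h i a b) k = (\<Sum>i\<in>I. r i * form_ip c y (h i) k)"
proof -
  have "form_ip c y (\<lambda>a b. \<Sum>i\<in>I. r i * h i a b) k
    = (\<Sum>p\<in>Basis \<times> Basis. \<Sum>i\<in>I. r i * (h i (coord_vec A c (fst p) y) (coord_vec A c (snd p) y)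
        * k (coord_vec A c (fst p) y) (coord_vec A c (snd p) y)))"
    by (simp add: form_ip_def case_prod_unfold sum_distrib_right mult.assoc)
  also have "\<dots> = (\<Sum>i\<in>I. r i * form_ip c y (h i) k)"
    by (subst sum.swap) (simp add: form_ip_def case_prod_unfold sum_distrib_left)
  finally show ?thesis .
qed

lemma form_ip_self_zero:
  assumes "(D, \<phi>) \<in> A" "y \<in> D" "h \<in> sym_forms A y" "form_ip (D, \<phi>) y h h = 0"
  shows "h = (\<lambda>a b. 0)"
proof (rule form_eqI[OF assms(3) sym_forms_zero assms(1,2)])
  fix i j :: 'e assume "i \<in> Basis" "j \<in> Basis"
  then show "h (coord_vec A (D, \<phi>) i y) (coord_vec A (D, \<phi>) j y) = 0"
    using assms(4) sum_nonneg_0[of "(Basis :: 'e set) \<times> (Basis :: 'e set)" "\<lambda>p. h (coord_vec A (D, \<phi>) (fst p) y)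
      (coord_vec A (D, \<phi>) (snd p) y) * h (coord_vec A (D, \<phi>) (fst p) y) (coord_vec A (D, \<phi>) (snd p) y)" "(i, j)"]
    by (simp add: form_ip_def case_prod_unfold)
qed

lemma smooth_fun_form_ip:
  assumes c: "(D, \<phi>) \<in> A" and U: "open U" "U \<subseteq> D" and "W_section A U h" "W_section A U k"
  shows "smooth_fun A U (\<lambda>y. form_ip (D, \<phi>) y (h y) (k y))"
proof -
  have "vector_field A U (coord_vec A (D, \<phi>) e)" for e
    by (rule vector_field_subset[OF vector_field_coord[OF c] U(2)])
  then show ?thesis
    unfolding form_ip_def case_prod_unfold
    using W_section_smooth[OF assms(4) U(1) order_refl] W_section_smooth[OF assms(5) U(1) order_refl]
    by (intro smooth_fun_sum smooth_fun_mult U(1)) (simp_all add: finite_cartesian_product)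
qed

lemma open_nonzero:
  assumes "open U" "smooth_fun A U f"
  shows "open {y \<in> U. f y \<noteq> 0}"
proof -
  have "open (U \<inter> f -` (- {0}))"
    by (rule continuous_open_preimage[OF smooth_fun_continuous_on[OF assms(2,1)] assms(1)]) auto
  moreover have "U \<inter> f -` (- {0}) = {y \<in> U. f y \<noteq> 0}" by auto
  ultimately show ?thesis by simp
qed

text \<open>Properties P1 and P2 of a subset of the bundle of forms, and closedness under limits in the
  following sense: a section with values in \<open>V\<close> over a dense set has values in \<open>V\<close> everywhere.
  The fibres of \<open>V\<close> may jump, so \<open>V\<close> need not be a closed set.\<close>

definition linear_fibres :: "('m \<times> 'm form) set \<Rightarrow> bool" where
  "linear_fibres V \<longleftrightarrow> (\<forall>x. fibre V x \<subseteq> sym_forms A x \<and>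
     (\<forall>(n::nat) c h. (\<forall>i<n. h i \<in> fibre V x) \<longrightarrow> (\<lambda>a b. \<Sum>i<n. c i * h i a b) \<in> fibre V x))"

definition V_section :: "('m \<times> 'm form) set \<Rightarrow> 'm set \<Rightarrow> ('m \<Rightarrow> 'm form) \<Rightarrow> bool" where
  "V_section V U X \<longleftrightarrow> open U \<and> W_section A U X \<and> (\<forall>y\<in>U. (y, X y) \<in> V)"

definition has_sections :: "('m \<times> 'm form) set \<Rightarrow> bool" where
  "has_sections V \<longleftrightarrow> (\<forall>x w. (x, w) \<in> V \<longrightarrow> (\<exists>U X. x \<in> U \<and> V_section V U X \<and> X x = w))"

definition section_closed :: "('m \<times> 'm form) set \<Rightarrow> bool" where
  "section_closed V \<longleftrightarrow> (\<forall>U X. open U \<and> W_section A U X \<and>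
     (\<forall>P. open P \<and> P \<noteq> {} \<and> P \<subseteq> U \<longrightarrow> (\<exists>P'. P' \<noteq> {} \<and> P' \<subseteq> P \<and> V_section V P' X)) \<longrightarrow> V_section V U X)"

lemma has_sectionsD: "has_sections V \<Longrightarrow> (x, w) \<in> V \<Longrightarrow> \<exists>U X. x \<in> U \<and> V_section V U X \<and> X x = w"
  unfolding has_sections_def by blast

lemma section_closedD:
  assumes "section_closed V" "open U" "W_section A U X"
    "\<And>P. open P \<Longrightarrow> P \<noteq> {} \<Longrightarrow> P \<subseteq> U \<Longrightarrow> \<exists>P'. P' \<noteq> {} \<and> P' \<subseteq> P \<and> V_section V P' X"
  shows "V_section V U X"
  using assms unfolding section_closed_def by blast

lemma V_sectionD:
  assumes "V_section V U X"
  shows "open U" "W_section A U X" "\<And>y. y \<in> U \<Longrightarrow> (y, X y) \<in> V"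
  using assms by (auto simp: V_section_def)

lemma V_section_subset: "V_section V U X \<Longrightarrow> open U' \<Longrightarrow> U' \<subseteq> U \<Longrightarrow> V_section V U' X"
  unfolding V_section_def using W_section_subset by blast

lemma V_section_mono: "V_section V U X \<Longrightarrow> V \<subseteq> V' \<Longrightarrow> V_section V' U X"
  unfolding V_section_def by blast

lemma linear_fibres_form: "linear_fibres V \<Longrightarrow> (x, w) \<in> V \<Longrightarrow> w \<in> sym_forms A x"
  by (auto simp: linear_fibres_def fibre_def)

lemma linear_fibres_sum:
  "linear_fibres V \<Longrightarrow> (\<And>i. i < n \<Longrightarrow> (x, h i) \<in> V) \<Longrightarrow> (x, \<lambda>a b. \<Sum>i<(n::nat). c i * h i a b) \<in> V"
  by (simp add: linear_fibres_def fibre_def)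

lemma linear_fibres_zero: "linear_fibres V \<Longrightarrow> (x, \<lambda>a b. 0) \<in> V"
  using linear_fibres_sum[of V 0] by simp

lemma linear_fibres_diff:
  assumes "linear_fibres V" "(x, h) \<in> V" "(x, k) \<in> V"
  shows "(x, \<lambda>a b. h a b - k a b) \<in> V"
proof -
  have "(x, \<lambda>a b. \<Sum>i<(2::nat). (if i = 0 then 1 else -1) * (if i = 0 then h else k) a b) \<in> V"
    using assms by (intro linear_fibres_sum) auto
  then show ?thesis by (simp add: numeral_2_eq_2)
qed

lemma linear_fibres_add:
  assumes "linear_fibres V" "(x, h) \<in> V" "(x, k) \<in> V"
  shows "(x, \<lambda>a b. h a b + k a b) \<in> V"
proof -
  have "(x, \<lambda>a b. \<Sum>i<(2::nat). 1 * (if i = 0 then h else k) a b) \<in> V"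
    using assms by (intro linear_fibres_sum) auto
  then show ?thesis by (simp add: numeral_2_eq_2)
qed

lemma V_section_sum:
  assumes V: "linear_fibres V" and U: "open U" and e: "\<And>i. i < n \<Longrightarrow> V_section V U (e i)"
    and c: "\<And>i. i < n \<Longrightarrow> smooth_fun A U (c i)"
  shows "V_section V U (\<lambda>y a b. \<Sum>i<(n::nat). c i y * e i y a b)"
  using e c U unfolding V_section_def
  by (auto intro!: W_section_sum linear_fibres_sum[OF V])

lemma V_section_diff:
  assumes V: "linear_fibres V" and X: "V_section V U X" and Y: "V_section V U Y"
  shows "V_section V U (\<lambda>y a b. X y a b - Y y a b)"
  using X Y unfolding V_section_def by (auto intro!: W_section_diff linear_fibres_diff[OF V])

definition orthogonal_system ::
    "('m, 'e) chart \<Rightarrow> ('m \<times> 'm form) set \<Rightarrow> 'm set \<Rightarrow> nat \<Rightarrow> (nat \<Rightarrow> 'm \<Rightarrow> 'm form) \<Rightarrow> bool" where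
  "orthogonal_system c V U n e \<longleftrightarrow> open U \<and> (\<forall>i<n. V_section V U (e i) \<and> (\<forall>y\<in>U. form_ip c y (e i y) (e i y) \<noteq> 0)) \<and>
     (\<forall>i<n. \<forall>j<n. i \<noteq> j \<longrightarrow> (\<forall>y\<in>U. form_ip c y (e i y) (e j y) = 0))"

text \<open>For an orthogonal system \<open>e\<close> this vanishes exactly if \<open>w\<close> lies in the span of the \<open>e i y\<close>.\<close>

definition remainder :: "('m, 'e) chart \<Rightarrow> nat \<Rightarrow> (nat \<Rightarrow> 'm \<Rightarrow> 'm form) \<Rightarrow> 'm \<Rightarrow> 'm form \<Rightarrow> 'm form" where
  "remainder c n e y w = (\<lambda>a b. w a b - (\<Sum>i<n. form_ip c y w (e i y) / form_ip c y (e i y) (e i y) * e i y a b))"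

lemma orthogonal_systemD:
  assumes "orthogonal_system c V U n e"
  shows "open U" "\<And>i. i < n \<Longrightarrow> V_section V U (e i)"
    "\<And>i y. i < n \<Longrightarrow> y \<in> U \<Longrightarrow> form_ip c y (e i y) (e i y) \<noteq> 0"
    "\<And>i j y. i < n \<Longrightarrow> j < n \<Longrightarrow> i \<noteq> j \<Longrightarrow> y \<in> U \<Longrightarrow> form_ip c y (e i y) (e j y) = 0"
  using assms by (auto simp: orthogonal_system_def)

lemma orthogonal_system_subset:
  "orthogonal_system c V U n e \<Longrightarrow> open U' \<Longrightarrow> U' \<subseteq> U \<Longrightarrow> orthogonal_system c V U' n e"
  unfolding orthogonal_system_def using V_section_subset by blast

lemma orthogonal_system_bound:
  assumes "orthogonal_system c V U n e" "U \<noteq> {}"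
  shows "n \<le> DIM('e) * DIM('e)"
proof -
  obtain y where y: "y \<in> U" using assms by auto
  have "n \<le> card ((Basis :: 'e set) \<times> (Basis :: 'e set))"
    by (rule orthogonal_family_card_bound[where v = "\<lambda>l p. e l y (coord_vec A c (fst p) y) (coord_vec A c (snd p) y)"])
      (use orthogonal_systemD(3,4)[OF assms(1)] y in \<open>auto simp: form_ip_def case_prod_unfold\<close>)
  then show ?thesis by (simp add: card_cartesian_product)
qed

lemma form_ip_combination:
  assumes e: "orthogonal_system c V U n e" and y: "y \<in> U" and j: "j < n"
  shows "form_ip c y (\<lambda>a b. \<Sum>i<n. r i * e i y a b) (e j y) = r j * form_ip c y (e j y) (e j y)"
proof -
  have "form_ip c y (\<lambda>a b. \<Sum>i<n. r i * e i y a b) (e j y) = (\<Sum>i<n. r i * form_ip c y (e i y) (e j y))"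
    by (rule form_ip_sum)
  also have "\<dots> = (\<Sum>i<n. if i = j then r j * form_ip c y (e j y) (e j y) else 0)"
    by (intro sum.cong refl) (use orthogonal_systemD(4)[OF e _ j _ y] in auto)
  finally show ?thesis using j by simp
qed

lemma remainder_orthogonal:
  assumes e: "orthogonal_system c V U n e" and y: "y \<in> U" and j: "j < n"
  shows "form_ip c y (remainder c n e y w) (e j y) = 0"
  unfolding remainder_def form_ip_diff form_ip_combination[OF e y j]
  using orthogonal_systemD(3)[OF e j y] by simp

lemma remainder_zero_iff:
  "remainder c n e y w = (\<lambda>a b. 0) \<longleftrightarrow>
     w = (\<lambda>a b. \<Sum>i<n. form_ip c y w (e i y) / form_ip c y (e i y) (e i y) * e i y a b)"
  by (auto simp: remainder_def fun_eq_iff)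

lemma V_section_remainder:
  assumes c: "(D, \<phi>) \<in> A" and V: "linear_fibres V" and e: "orthogonal_system (D, \<phi>) V U n e" and U: "U \<subseteq> D"
    and X: "V_section V U X"
  shows "V_section V U (\<lambda>y. remainder (D, \<phi>) n e y (X y))"
  unfolding remainder_def
  using orthogonal_systemD[OF e] V_sectionD(2)[OF X] V_sectionD(2)[OF orthogonal_systemD(2)[OF e]] U
  by (intro V_section_diff[OF V X] V_section_sum[OF V] smooth_fun_divide smooth_fun_form_ip[OF c]) auto

lemma orthogonal_system_append:
  assumes e: "orthogonal_system c V U n e" and R: "V_section V U R"
    and orth: "\<And>i y. i < n \<Longrightarrow> y \<in> U \<Longrightarrow> form_ip c y (R y) (e i y) = 0"
    and nz: "\<And>y. y \<in> U \<Longrightarrow> form_ip c y (R y) (R y) \<noteq> 0"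
  shows "orthogonal_system c V U (Suc n) (e(n := R))"
  unfolding orthogonal_system_def
proof (intro conjI allI impI ballI orthogonal_systemD(1)[OF e])
  fix i assume i: "i < Suc n"
  show "V_section V U ((e(n := R)) i)" using orthogonal_systemD(2)[OF e] R i by auto
  fix y assume "y \<in> U"
  then show "form_ip c y ((e(n := R)) i y) ((e(n := R)) i y) \<noteq> 0"
    using orthogonal_systemD(3)[OF e] nz i by auto
next
  fix i j y assume ij: "i < Suc n" "j < Suc n" "i \<noteq> j" and y: "y \<in> U"
  have "form_ip c y (e l y) (R y) = 0" if "l < n" for l
    using orth[OF that y] by (subst form_ip_commute)
  then show "form_ip c y ((e(n := R)) i y) ((e(n := R)) j y) = 0"
    using orthogonal_systemD(4)[OF e _ _ _ y] orth[OF _ y] ij by (cases "i = n"; cases "j = n") auto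
qed

text \<open>The Gram-Schmidt step. A nonzero remainder at one point stays nonzero nearby.\<close>

lemma orthogonal_system_extend:
  assumes c: "(D, \<phi>) \<in> A" and V: "linear_fibres V" "has_sections V" and e: "orthogonal_system (D, \<phi>) V U n e"
    and U: "U \<subseteq> D" and y: "y \<in> U" and w: "(y, w) \<in> V" "remainder (D, \<phi>) n e y w \<noteq> (\<lambda>a b. 0)"
  shows "\<exists>U' e'. y \<in> U' \<and> U' \<subseteq> U \<and> orthogonal_system (D, \<phi>) V U' (Suc n) e'"
proof -
  obtain N X where N: "y \<in> N" "V_section V N X" "X y = w"
    using has_sectionsD[OF V(2) w(1)] by blast
  let ?N = "U \<inter> N"
  have oN: "open ?N" using N V_sectionD(1) orthogonal_systemD(1)[OF e] by blast
  have eN: "orthogonal_system (D, \<phi>) V ?N n e" by (rule orthogonal_system_subset[OF e oN]) auto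
  define R where "R = (\<lambda>y. remainder (D, \<phi>) n e y (X y))"
  have R: "V_section V ?N R"
    unfolding R_def
    by (rule V_section_remainder[OF c V(1) eN _ V_section_subset[OF N(2) oN]]) (use U in auto)
  define U' where "U' = {z \<in> ?N. form_ip (D, \<phi>) z (R z) (R z) \<noteq> 0}"
  have oU': "open U'"
    unfolding U'_def by (rule open_nonzero[OF oN smooth_fun_form_ip[OF c oN _ V_sectionD(2)[OF R] V_sectionD(2)[OF R]]])
      (use U in auto)
  have "R y \<noteq> (\<lambda>a b. 0)" using w N by (simp add: R_def)
  then have y': "y \<in> U'"
    unfolding U'_def using form_ip_self_zero[OF c, of y "R y"] W_section_form[OF V_sectionD(2)[OF R]] y N U by auto
  have U'N: "U' \<subseteq> ?N" by (auto simp: U'_def)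
  have "orthogonal_system (D, \<phi>) V U' (Suc n) (e(n := R))"
  proof (rule orthogonal_system_append[OF orthogonal_system_subset[OF eN oU' U'N] V_section_subset[OF R oU' U'N]])
    show "form_ip (D, \<phi>) z (R z) (e i z) = 0" if "i < n" "z \<in> U'" for i z
      unfolding R_def using remainder_orthogonal[OF eN _ that(1)] that(2) U'N by blast
  qed (simp add: U'_def)
  then show ?thesis using y' U'N by blast
qed

definition spanning :: "('m, 'e) chart \<Rightarrow> ('m \<times> 'm form) set \<Rightarrow> 'm set \<Rightarrow> nat \<Rightarrow> (nat \<Rightarrow> 'm \<Rightarrow> 'm form) \<Rightarrow> bool" where
  "spanning c V U n e \<longleftrightarrow> (\<forall>y\<in>U. \<forall>w. (y, w) \<in> V \<longrightarrow> remainder c n e y w = (\<lambda>a b. 0))"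

text \<open>A system of maximal length over the nonempty open subsets of \<open>P\<close> cannot be extended, hence
  spans.\<close>

lemma generic_frame:
  assumes c: "(D, \<phi>) \<in> A" and V: "linear_fibres V" "has_sections V" and P: "open P" "P \<noteq> {}" "P \<subseteq> D"
  shows "\<exists>U n e. U \<noteq> {} \<and> U \<subseteq> P \<and> orthogonal_system (D, \<phi>) V U n e \<and> spanning (D, \<phi>) V U n e"
proof -
  define S where "S = {n. \<exists>U e. U \<noteq> {} \<and> U \<subseteq> P \<and> orthogonal_system (D, \<phi>) V U n e}"
  have "0 \<in> S" using P by (auto simp: S_def orthogonal_system_def)
  moreover have fin: "finite S"
    by (rule finite_subset[of _ "{..DIM('e) * DIM('e)}"]) (auto simp: S_def dest: orthogonal_system_bound)
  ultimately have "Max S \<in> S" using Max_in by blast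
  then obtain U e where U: "U \<noteq> {}" "U \<subseteq> P" "orthogonal_system (D, \<phi>) V U (Max S) e" by (auto simp: S_def)
  have "remainder (D, \<phi>) (Max S) e y w = (\<lambda>a b. 0)" if yw: "y \<in> U" "(y, w) \<in> V" for y w
  proof (rule ccontr)
    assume ne: "remainder (D, \<phi>) (Max S) e y w \<noteq> (\<lambda>a b. 0)"
    then obtain U' e' where e': "y \<in> U'" "U' \<subseteq> U" "orthogonal_system (D, \<phi>) V U' (Suc (Max S)) e'"
      using orthogonal_system_extend[OF c V U(3) order_trans[OF U(2) P(3)] yw ne] by blast
    have "U' \<noteq> {}" "U' \<subseteq> P" using e' U(2) by auto
    then have "Suc (Max S) \<in> S" using e'(3) unfolding S_def by blast
    then show False using Max_ge[OF fin] by fastforce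
  qed
  then have "spanning (D, \<phi>) V U (Max S) e" by (simp add: spanning_def)
  then show ?thesis using U by blast
qed

end

section \<open>The derived flag stabilizes\<close>

context manifold_connection
begin

text \<open>In a frame, a section that vanishes at \<open>z\<close> is a combination with coefficients that vanish at
  \<open>z\<close>, so only derivatives of coefficients contribute to its covariant derivative there. This is
  what makes the second fundamental form well defined where the rank is constant.\<close>

lemma W_nabla_vanishing_section:
  assumes c: "(D, \<phi>) \<in> A" and V: "linear_fibres V" and e: "orthogonal_system (D, \<phi>) V U n e" and U: "U \<subseteq> D"
    and span: "spanning (D, \<phi>) V U n e" and X: "V_section V U X" and z: "z \<in> U" "X z = (\<lambda>a b. 0)"
    and u: "u \<in> tangent_space A z"
  shows "(z, W_nabla A nabla z u X) \<in> V"
proof -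
  note oU = orthogonal_systemD(1)[OF e]
  define r where "r = (\<lambda>i y. form_ip (D, \<phi>) y (X y) (e i y) / form_ip (D, \<phi>) y (e i y) (e i y))"
  have r: "smooth_fun A U (r i)" if "i < n" for i
    unfolding r_def using orthogonal_systemD(2,3)[OF e that] V_sectionD(2) X
    by (intro smooth_fun_divide oU smooth_fun_form_ip[OF c oU U]) auto
  have eW: "W_section A U (e i)" if "i < n" for i using orthogonal_systemD(2)[OF e that] V_sectionD(2) by blast
  have "X y = (\<lambda>a b. \<Sum>i<n. r i y * e i y a b)" if "y \<in> U" for y
    using span V_sectionD(3)[OF X that] that unfolding spanning_def remainder_zero_iff r_def by blast
  then have "W_nabla A nabla z u X = W_nabla A nabla z u (\<lambda>y a b. \<Sum>i<n. r i y * e i y a b)"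
    by (intro W_nabla_cong[OF oU z(1) _ u] W_section_sum) (use oU r eW in auto)
  also have "\<dots> = (\<lambda>a b. (\<Sum>i<n. u (r i) * e i z a b) + (\<Sum>i<n. r i z * W_nabla A nabla z u (e i) a b))"
    by (rule W_nabla_sum[OF oU z(1) u]) (use r eW in auto)
  also have "\<dots> = (\<lambda>a b. \<Sum>i<n. u (r i) * e i z a b)"
    using z(2) by (simp add: r_def form_ip_def)
  finally show ?thesis
    using linear_fibres_sum[OF V, of n z "\<lambda>i. e i z"] V_sectionD(3)[OF orthogonal_systemD(2)[OF e]] z by simp
qed

lemma ker_second_form_iff:
  assumes V: "linear_fibres V"
  shows "(x, w) \<in> ker_second_form A nabla V \<longleftrightarrow> (\<exists>U X. x \<in> U \<and> V_section V U X \<and> X x = w \<and>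
    (\<forall>u\<in>tangent_space A x. (x, W_nabla A nabla x u X) \<in> V))"
proof -
  have "quot_class A V x (\<lambda>u a b. 0) = quot_class A V x (\<lambda>u. W_nabla A nabla x u X) \<longleftrightarrow>
      (\<forall>u\<in>tangent_space A x. (x, W_nabla A nabla x u X) \<in> V)" (is "?L \<longleftrightarrow> ?R")
    if X: "x \<in> U" "V_section V U X" for U X
  proof
    assume ?L
    show ?R
    proof
      fix u assume u: "u \<in> tangent_space A x"
      have "{k \<in> sym_forms A x. (\<lambda>a b. k a b - 0) \<in> fibre V x}
        = {k \<in> sym_forms A x. (\<lambda>a b. k a b - W_nabla A nabla x u X a b) \<in> fibre V x}"
        using fun_cong[OF \<open>?L\<close>, of u] u by (simp add: quot_class_def)
      moreover have "(\<lambda>a b. 0) \<in> {k \<in> sym_forms A x. (\<lambda>a b. k a b - 0) \<in> fibre V x}"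
        using linear_fibres_zero[OF V] sym_forms_zero by (auto simp: fibre_def)
      ultimately have "(x, \<lambda>a b. 0 - W_nabla A nabla x u X a b) \<in> V" by (auto simp: fibre_def)
      from linear_fibres_diff[OF V linear_fibres_zero[OF V] this]
      show "(x, W_nabla A nabla x u X) \<in> V" by simp
    qed
  next
    assume R: ?R
    show ?L
    proof
      fix u
      have "(x, k) \<in> V \<longleftrightarrow> (x, \<lambda>a b. k a b - W_nabla A nabla x u X a b) \<in> V" if "u \<in> tangent_space A x" for k
      proof
        have R': "(x, W_nabla A nabla x u X) \<in> V" using R that by blast
        show "(x, k) \<in> V \<Longrightarrow> (x, \<lambda>a b. k a b - W_nabla A nabla x u X a b) \<in> V"
          by (rule linear_fibres_diff[OF V _ R'])
        assume "(x, \<lambda>a b. k a b - W_nabla A nabla x u X a b) \<in> V"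
        from linear_fibres_add[OF V this R'] show "(x, k) \<in> V" by simp
      qed
      then show "quot_class A V x (\<lambda>u a b. 0) u = quot_class A V x (\<lambda>u. W_nabla A nabla x u X) u"
        unfolding quot_class_def fibre_def by (cases "u \<in> tangent_space A x") simp_all
    qed
  qed
  then show ?thesis
    unfolding ker_second_form_def second_form_def V_section_def by blast
qed

text \<open>In the presence of a frame every section through an element of the kernel witnesses it.\<close>

lemma W_nabla_of_ker_second_form:
  assumes c: "(D, \<phi>) \<in> A" and V: "linear_fibres V" and e: "orthogonal_system (D, \<phi>) V Q n e" and Q: "Q \<subseteq> D"
    and span: "spanning (D, \<phi>) V Q n e" and X: "V_section V Q X" and z: "z \<in> Q"
    and ker: "(z, X z) \<in> ker_second_form A nabla V" and u: "u \<in> tangent_space A z"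
  shows "(z, W_nabla A nabla z u X) \<in> V"
proof -
  obtain U' X' where X': "z \<in> U'" "V_section V U' X'" "X' z = X z" "(z, W_nabla A nabla z u X') \<in> V"
    using ker u unfolding ker_second_form_iff[OF V] by blast
  let ?M = "Q \<inter> U'"
  have M: "open ?M" "z \<in> ?M" using orthogonal_systemD(1)[OF e] V_sectionD(1)[OF X'(2)] z X'(1) by auto
  have XM: "V_section V ?M X" "V_section V ?M X'"
    using V_section_subset[OF X M(1)] V_section_subset[OF X'(2) M(1)] by auto
  have eM: "orthogonal_system (D, \<phi>) V ?M n e" by (rule orthogonal_system_subset[OF e M(1)]) auto
  have "(z, W_nabla A nabla z u (\<lambda>y a b. X y a b - X' y a b)) \<in> V"
    by (rule W_nabla_vanishing_section[OF c V eM _ _ V_section_diff[OF V XM] M(2) _ u])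
      (use span Q X'(3) in \<open>auto simp: spanning_def\<close>)
  then have "(z, \<lambda>a b. W_nabla A nabla z u X a b - W_nabla A nabla z u X' a b) \<in> V"
    unfolding W_nabla_diff[OF M u V_sectionD(2)[OF XM(1)] V_sectionD(2)[OF XM(2)]] .
  from linear_fibres_add[OF V this X'(4)] show ?thesis by simp
qed

lemma ker_second_form_subset: "ker_second_form A nabla V \<subseteq> V"
  by (auto simp: ker_second_form_def)

lemma S_op_iff: "(x, w) \<in> S_op A V \<longleftrightarrow> (\<exists>U X. x \<in> U \<and> V_section V U X \<and> X x = w)"
  unfolding S_op_def V_section_def by blast

lemma S_op_subset: "S_op A V \<subseteq> V"
  by (auto simp: S_op_def)

lemma V_section_S_op: "V_section (S_op A V) U X \<longleftrightarrow> V_section V U X"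
proof
  assume "V_section V U X"
  moreover from this have "(y, X y) \<in> S_op A V" if "y \<in> U" for y using that S_op_iff by blast
  ultimately show "V_section (S_op A V) U X" by (auto simp: V_section_def)
qed (rule V_section_mono[OF _ S_op_subset])

lemma has_sections_S_op: "has_sections (S_op A V)"
  unfolding has_sections_def V_section_S_op S_op_iff by blast

lemma section_closed_S_op: "section_closed V \<Longrightarrow> section_closed (S_op A V)"
  unfolding section_closed_def V_section_S_op .

lemma common_domain:
  assumes "\<And>i. i < (n::nat) \<Longrightarrow> x \<in> U i \<and> open (U i)"
  shows "open (\<Inter>i<n. U i)" "x \<in> (\<Inter>i<n. U i)"
  using assms by (auto intro!: open_INT)

lemma linear_fibres_S_op:
  assumes V: "linear_fibres V"
  shows "linear_fibres (S_op A V)"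
  unfolding linear_fibres_def
proof (intro conjI allI impI)
  fix x show "fibre (S_op A V) x \<subseteq> sym_forms A x"
    using linear_fibres_form[OF V] S_op_subset[of V] by (auto simp: fibre_def)
  fix n c h assume "\<forall>i<(n::nat). h i \<in> fibre (S_op A V) x"
  then have "\<forall>i. \<exists>U X. i < n \<longrightarrow> x \<in> U \<and> V_section V U X \<and> X x = h i" by (simp add: fibre_def S_op_iff)
  then obtain U X where UX: "\<And>i. i < n \<Longrightarrow> x \<in> U i \<and> V_section V (U i) (X i) \<and> X i x = h i" by metis
  let ?N = "\<Inter>i<n. U i"
  have N: "open ?N" "x \<in> ?N" using common_domain[of n x U] UX V_sectionD(1) by blast+
  have "V_section V ?N (\<lambda>y a b. \<Sum>i<n. c i * X i y a b)"
    by (rule V_section_sum[OF V N(1)]) (use UX N in \<open>auto intro: V_section_subset smooth_fun_const\<close>)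
  then show "(\<lambda>a b. \<Sum>i<n. c i * h i a b) \<in> fibre (S_op A V) x"
    using N(2) UX by (auto simp: fibre_def S_op_iff intro!: exI[of _ ?N] exI[of _ "\<lambda>y a b. \<Sum>i<n. c i * X i y a b"])
qed

lemma linear_fibres_ker_second_form:
  assumes V: "linear_fibres V"
  shows "linear_fibres (ker_second_form A nabla V)"
  unfolding linear_fibres_def
proof (intro conjI allI impI)
  fix x show "fibre (ker_second_form A nabla V) x \<subseteq> sym_forms A x"
    using linear_fibres_form[OF V] ker_second_form_subset[of V] by (auto simp: fibre_def)
  fix n c h assume "\<forall>i<(n::nat). h i \<in> fibre (ker_second_form A nabla V) x"
  then have "\<forall>i. \<exists>U X. i < n \<longrightarrow> x \<in> U \<and> V_section V U X \<and> X x = h i \<and>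
      (\<forall>u\<in>tangent_space A x. (x, W_nabla A nabla x u X) \<in> V)"
    unfolding fibre_def mem_Collect_eq ker_second_form_iff[OF V] by blast
  then obtain U X where UX: "\<And>i. i < n \<Longrightarrow> x \<in> U i \<and> V_section V (U i) (X i) \<and> X i x = h i \<and>
      (\<forall>u\<in>tangent_space A x. (x, W_nabla A nabla x u (X i)) \<in> V)" by metis
  let ?N = "\<Inter>i<n. U i" and ?X = "\<lambda>y a b. \<Sum>i<n. c i * X i y a b"
  have N: "open ?N" "x \<in> ?N" using common_domain[of n x U] UX V_sectionD(1) by blast+
  have XN: "V_section V ?N (X i)" if "i < n" for i
    using UX N that by (auto intro: V_section_subset)
  have "V_section V ?N ?X"
    by (rule V_section_sum[OF V N(1)]) (use XN in \<open>auto intro: smooth_fun_const\<close>)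
  moreover have "(x, W_nabla A nabla x u ?X) \<in> V" if u: "u \<in> tangent_space A x" for u
  proof -
    have "W_nabla A nabla x u ?X = (\<lambda>a b. (\<Sum>i<n. u (\<lambda>y. c i) * X i x a b) + (\<Sum>i<n. c i * W_nabla A nabla x u (X i) a b))"
      by (rule W_nabla_sum[OF N u]) (use XN V_sectionD(2) smooth_fun_const in auto)
    then show ?thesis using u UX linear_fibres_sum[OF V, of n x "\<lambda>i. W_nabla A nabla x u (X i)" c] by simp
  qed
  ultimately show "(\<lambda>a b. \<Sum>i<n. c i * h i a b) \<in> fibre (ker_second_form A nabla V) x"
    using N(2) UX by (auto simp: fibre_def ker_second_form_iff[OF V] intro!: exI[of _ ?N] exI[of _ ?X])
qed

text \<open>Over a dense set there is a frame of \<open>V\<close>, so there the covariant derivatives of \<open>X\<close> itself lie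
  in \<open>V\<close>; they are sections, so they lie in \<open>V\<close> everywhere.\<close>

lemma section_closed_ker_second_form:
  assumes V: "linear_fibres V" "has_sections V" "section_closed V"
  shows "section_closed (ker_second_form A nabla V)"
  unfolding section_closed_def
proof (intro allI impI, elim conjE)
  fix U X
  assume U: "open U" and X: "W_section A U X" and dense: "\<forall>P. open P \<and> P \<noteq> {} \<and> P \<subseteq> U \<longrightarrow>
      (\<exists>P'. P' \<noteq> {} \<and> P' \<subseteq> P \<and> V_section (ker_second_form A nabla V) P' X)"
  have XV: "V_section V U X"
  proof (rule section_closedD[OF V(3) U X])
    fix P assume "open P" "P \<noteq> {}" "P \<subseteq> U"
    then obtain P' where "P' \<noteq> {}" "P' \<subseteq> P" "V_section (ker_second_form A nabla V) P' X"
      using dense[rule_format, of P] by blast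
    then show "\<exists>P'. P' \<noteq> {} \<and> P' \<subseteq> P \<and> V_section V P' X"
      using V_section_mono[OF _ ker_second_form_subset] by blast
  qed
  have "(x, X x) \<in> ker_second_form A nabla V" if x: "x \<in> U" for x
  proof -
    obtain D \<phi> where c: "(D, \<phi>) \<in> A" "x \<in> D" using chart_exists by blast
    let ?k = "coord_vec A (D, \<phi>)"
    let ?N = "D \<inter> U"
    have N: "open ?N" "x \<in> ?N" using chart_homeomorphism(1)[OF c(1)] U x c by auto
    have "V_section V ?N (\<lambda>y. W_nabla A nabla y (?k e y) X)" for e
    proof (rule section_closedD[OF V(3) N(1)])
      show "W_section A ?N (\<lambda>y. W_nabla A nabla y (?k e y) X)"
        by (rule W_section_W_nabla[OF N(1) vector_field_subset[OF vector_field_coord[OF c(1)]] W_section_subset[OF X]]) auto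
      fix P assume P: "open P" "P \<noteq> {}" "P \<subseteq> ?N"
      then obtain P' where P': "P' \<noteq> {}" "P' \<subseteq> P" "V_section (ker_second_form A nabla V) P' X"
        using dense[rule_format, of P] by auto
      then obtain Q n e' where Q: "Q \<noteq> {}" "Q \<subseteq> P'" and e': "orthogonal_system (D, \<phi>) V Q n e'"
        and span: "spanning (D, \<phi>) V Q n e'"
        using generic_frame[OF c(1) V(1,2) V_sectionD(1)[OF P'(3)] P'(1)] P' P by blast
      have oQ: "open Q" and QN: "Q \<subseteq> ?N" using orthogonal_systemD(1)[OF e'] Q P P' by auto
      have "(z, W_nabla A nabla z (?k e z) X) \<in> V" if z: "z \<in> Q" for z
      proof (rule W_nabla_of_ker_second_form[OF c(1) V(1) e' _ span _ z])
        show "Q \<subseteq> D" "V_section V Q X" using QN V_section_subset[OF XV oQ] by auto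
        show "(z, X z) \<in> ker_second_form A nabla V" using V_sectionD(3)[OF P'(3)] z Q(2) by auto
        show "?k e z \<in> tangent_space A z" using z QN c by auto
      qed
      then have "V_section V Q (\<lambda>y. W_nabla A nabla y (?k e y) X)"
        using oQ W_section_subset[OF \<open>W_section A ?N _\<close> QN] by (auto simp: V_section_def)
      then show "\<exists>P'. P' \<noteq> {} \<and> P' \<subseteq> P \<and> V_section V P' (\<lambda>y. W_nabla A nabla y (?k e y) X)"
        using Q P' by blast
    qed
    then have "(x, W_nabla A nabla x u X) \<in> V" if "u \<in> tangent_space A x" for u
      using that N(2) V_sectionD(3) unfolding tangent_space_chart[OF c] by blast
    then show ?thesis using x XV by (auto simp: ker_second_form_iff[OF V(1)])
  qed
  then show "V_section (ker_second_form A nabla V) U X" using U X by (auto simp: V_section_def)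
qed

lemma W_section_W_curv:
  assumes U: "open U" and X: "vector_field A U X" and Y: "vector_field A U Y" and h: "W_section A U h"
  shows "W_section A U (\<lambda>y. W_curv y X Y h)"
  unfolding W_curv_def
  by (intro W_section_diff[OF U] W_section_W_nabla[OF U] vector_field_lie_bracket[OF X Y U] X Y h)

text \<open>The formula \<open>W_curv_value\<close> is linear in the value of the form.\<close>

lemma linear_fibres_ker_curvature: "linear_fibres (ker_curvature A nabla)"
  unfolding linear_fibres_def
proof (intro conjI allI impI)
  fix x show "fibre (ker_curvature A nabla) x \<subseteq> sym_forms A x"
    by (auto simp: fibre_def ker_curvature_def W_bundle_def)
  fix n c h assume h: "\<forall>i<(n::nat). h i \<in> fibre (ker_curvature A nabla) x"
  obtain D \<phi> where ch: "(D, \<phi>) \<in> A" "x \<in> D" using chart_exists by blast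
  have D: "open D" by (rule chart_homeomorphism(1)[OF ch(1)])
  have "\<forall>i. \<exists>H. i < n \<longrightarrow> W_section A D H \<and> H x = h i"
    using h W_section_extension[OF ch] by (auto simp: fibre_def ker_curvature_def W_bundle_def)
  then obtain H where H: "\<And>i. i < n \<Longrightarrow> W_section A D (H i) \<and> H i x = h i" by metis
  let ?H = "\<lambda>y a b. \<Sum>i<n. c i * H i y a b"
  have HD: "W_section A D ?H" by (rule W_section_sum) (use H D in \<open>auto intro: smooth_fun_const\<close>)
  have "W_curv x X Y ?H = (\<lambda>a b. 0)"
    if V: "open V" "x \<in> V" and X: "vector_field A V X" and Y: "vector_field A V Y" for V X Y
  proof -
    let ?N = "D \<inter> V" and ?k = "coord_vec A (D, \<phi>)"
    have N: "open ?N" "x \<in> ?N" using D V ch by auto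
    have F: "vector_field A ?N X" "vector_field A ?N Y" "W_section A ?N ?H" "\<And>i. i < n \<Longrightarrow> W_section A ?N (H i)"
      using vector_field_subset[OF X, of ?N] vector_field_subset[OF Y, of ?N] W_section_subset[of D _ ?N] HD H by auto
    have k: "vector_field A ?N (?k e)" for e by (rule vector_field_subset[OF vector_field_coord[OF ch(1)]]) auto
    have "W_curv x X Y (H i) = (\<lambda>a b. 0)" if "i < n" for i
      using ker_curvature_iff[OF D ch(2), of "H i"] H[OF that] h that V X Y by (auto simp: fibre_def)
    then have z: "- h i (curv x X Y (?k e)) (?k e' x) - h i (?k e x) (curv x X Y (?k e')) = 0" if "i < n" for i e e'
      using W_curv_value[OF N F(1,2) F(4)[OF that] k[of e] k[of e']] H[OF that] that by simp
    show ?thesis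
    proof (rule form_eqI[OF W_curv_form[OF N F(1,2,3)] sym_forms_zero ch])
      fix e e' :: 'e
      have "W_curv x X Y ?H (?k e x) (?k e' x)
        = (\<Sum>i<n. c i * (- h i (curv x X Y (?k e)) (?k e' x) - h i (?k e x) (curv x X Y (?k e'))))"
        unfolding W_curv_value[OF N F(1,2,3) k k] using H
        by (simp add: sum_subtractf right_diff_distrib sum_negf)
      then show "W_curv x X Y ?H (?k e x) (?k e' x) = 0" using z by simp
    qed
  qed
  then have "(x, ?H x) \<in> ker_curvature A nabla" unfolding ker_curvature_iff[OF D ch(2) HD] by blast
  then show "(\<lambda>a b. \<Sum>i<n. c i * h i a b) \<in> fibre (ker_curvature A nabla) x" using H by (simp add: fibre_def)
qed

text \<open>In a chart, the components of the curvature of a section are continuous functions.\<close>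

lemma section_closed_ker_curvature: "section_closed (ker_curvature A nabla)"
  unfolding section_closed_def
proof (intro allI impI, elim conjE)
  fix U h
  assume U: "open U" and h: "W_section A U h" and dense: "\<forall>P. open P \<and> P \<noteq> {} \<and> P \<subseteq> U \<longrightarrow>
      (\<exists>P'. P' \<noteq> {} \<and> P' \<subseteq> P \<and> V_section (ker_curvature A nabla) P' h)"
  have "(x, h x) \<in> ker_curvature A nabla" if x: "x \<in> U" for x
    unfolding ker_curvature_iff[OF U x h]
  proof (intro allI impI, elim conjE)
    fix V X Y assume V: "open V" "x \<in> V" and X: "vector_field A V X" and Y: "vector_field A V Y"
    obtain D \<phi> where c: "(D, \<phi>) \<in> A" "x \<in> D" using chart_exists by blast
    let ?N = "D \<inter> (U \<inter> V)" and ?k = "coord_vec A (D, \<phi>)"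
    have N: "open ?N" "x \<in> ?N" using chart_homeomorphism(1)[OF c(1)] U x V c by auto
    have F: "vector_field A ?N X" "vector_field A ?N Y" "W_section A ?N h"
      using vector_field_subset[OF X, of ?N] vector_field_subset[OF Y, of ?N] W_section_subset[OF h, of ?N] by auto
    have k: "vector_field A ?N (?k e)" for e by (rule vector_field_subset[OF vector_field_coord[OF c(1)]]) auto
    show "W_curv x X Y h = (\<lambda>a b. 0)"
    proof (rule form_eqI[OF W_curv_form[OF N F] sym_forms_zero c], rule ccontr)
      fix i j :: 'e
      let ?f = "\<lambda>y. W_curv y X Y h (?k i y) (?k j y)"
      assume "?f x \<noteq> 0"
      moreover have "open {y \<in> ?N. ?f y \<noteq> 0}"
        by (rule open_nonzero[OF N(1) W_section_smooth[OF W_section_W_curv[OF N(1) F] N(1) order_refl k k]])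
      ultimately obtain P' where P': "P' \<noteq> {}" "P' \<subseteq> {y \<in> ?N. ?f y \<noteq> 0}" "V_section (ker_curvature A nabla) P' h"
        using dense[rule_format, of "{y \<in> ?N. ?f y \<noteq> 0}"] N(2) by blast
      then obtain y where y: "y \<in> ?N" "?f y \<noteq> 0" "(y, h y) \<in> ker_curvature A nabla"
        using V_sectionD(3) by blast
      then have "W_curv y X Y h = (\<lambda>a b. 0)" using ker_curvature_iff[OF U _ h, of y] V X Y by auto
      then show False using y by simp
    qed
  qed
  then show "V_section (ker_curvature A nabla) U h" using U h by (auto simp: V_section_def)
qed

lemma W_flag_properties:
  "linear_fibres (W_flag A nabla i) \<and> has_sections (W_flag A nabla i) \<and> section_closed (W_flag A nabla i)"
proof (induction i)
  case 0
  show ?case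
    by (simp add: linear_fibres_S_op linear_fibres_ker_curvature has_sections_S_op section_closed_S_op
        section_closed_ker_curvature)
next
  case (Suc i)
  then show ?case
    by (simp add: linear_fibres_S_op linear_fibres_ker_second_form has_sections_S_op section_closed_S_op
        section_closed_ker_second_form)
qed

lemmas W_flag_linear = W_flag_properties[THEN conjunct1]
  and W_flag_has_sections = W_flag_properties[THEN conjunct2, THEN conjunct1]
  and W_flag_section_closed = W_flag_properties[THEN conjunct2, THEN conjunct2]

lemma W_flag_Suc_subset: "W_flag A nabla (Suc i) \<subseteq> W_flag A nabla i"
  using S_op_subset ker_second_form_subset by (metis W_flag.simps(2) order_trans)

text \<open>Coincidence of two consecutive members over an open set persists, since the next member is
  formed locally.\<close>

lemma W_flag_step_local:
  assumes P: "open P" and eq: "\<And>y w. y \<in> P \<Longrightarrow> (y, w) \<in> W_flag A nabla i \<Longrightarrow> (y, w) \<in> W_flag A nabla (Suc i)"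
    and y: "y \<in> P" "(y, w) \<in> W_flag A nabla (Suc i)"
  shows "(y, w) \<in> W_flag A nabla (Suc (Suc i))"
proof -
  note lin = W_flag_linear
  have "(z, v) \<in> ker_second_form A nabla (W_flag A nabla (Suc i))"
    if z: "z \<in> P" "(z, v) \<in> ker_second_form A nabla (W_flag A nabla i)" for z v
  proof -
    obtain U X where X: "z \<in> U" "V_section (W_flag A nabla i) U X" "X z = v"
      "\<forall>u\<in>tangent_space A z. (z, W_nabla A nabla z u X) \<in> W_flag A nabla i"
      using z unfolding ker_second_form_iff[OF lin] by blast
    have "V_section (W_flag A nabla (Suc i)) (P \<inter> U) X"
      using X(2) P eq W_section_subset[of U X "P \<inter> U"] by (auto simp: V_section_def)
    then show ?thesis
      unfolding ker_second_form_iff[OF lin] using X z eq by blast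
  qed
  note ker = this
  obtain U X where X: "y \<in> U" "V_section (ker_second_form A nabla (W_flag A nabla i)) U X" "X y = w"
    using y(2) by (auto simp: S_op_iff)
  have "V_section (ker_second_form A nabla (W_flag A nabla (Suc i))) (P \<inter> U) X"
    using X(2) P ker W_section_subset[of U X "P \<inter> U"] by (auto simp: V_section_def)
  then show ?thesis using X y by (auto simp: S_op_iff simp del: W_flag.simps(2) simp: W_flag.simps(2)[of _ _ "Suc i"])
qed

text \<open>As long as consecutive members differ over every nonempty open subset of \<open>P\<close>, an orthogonal
  system in one of them extends, over a smaller open set, by a section of the preceding one. The
  length of orthogonal systems is bounded, so two members must coincide over some open set.\<close>

lemma W_flag_generic_coincidence:
  assumes P: "open P" "P \<noteq> {}"
  shows "\<exists>P'. open P' \<and> P' \<noteq> {} \<and> P' \<subseteq> P \<and> (\<forall>y\<in>P'. \<forall>w. (y, w) \<in> W_flag A nabla (DIM('e) * DIM('e)) \<longrightarrow>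
    (y, w) \<in> W_flag A nabla (Suc (DIM('e) * DIM('e))))"
proof -
  let ?N = "DIM('e) * DIM('e)"
  obtain x where x: "x \<in> P" using P by auto
  obtain D \<phi> where c: "(D, \<phi>) \<in> A" "x \<in> D" using chart_exists by blast
  let ?P = "D \<inter> P"
  have oP: "open ?P" "?P \<noteq> {}" using chart_homeomorphism(1)[OF c(1)] P x c by auto
  have "\<exists>i P'. i \<le> ?N \<and> open P' \<and> P' \<noteq> {} \<and> P' \<subseteq> ?P \<and>
    (\<forall>y\<in>P'. \<forall>w. (y, w) \<in> W_flag A nabla i \<longrightarrow> (y, w) \<in> W_flag A nabla (Suc i))"
  proof (rule ccontr)
    assume no: "\<not> ?thesis"
    have "\<exists>U e. U \<noteq> {} \<and> U \<subseteq> ?P \<and> orthogonal_system (D, \<phi>) (W_flag A nabla (Suc ?N - j)) U j e" if "j \<le> Suc ?N" for j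
      using that
    proof (induction j)
      case 0
      have "orthogonal_system (D, \<phi>) (W_flag A nabla (Suc ?N - 0)) ?P 0 (\<lambda>i y a b. 0)"
        unfolding orthogonal_system_def using oP(1) by blast
      then show ?case using oP(2) by (intro exI[of _ ?P] exI[of _ "\<lambda>i y a b. 0"] conjI order_refl)
    next
      case (Suc j)
      define i where "i = ?N - j"
      have i: "Suc ?N - j = Suc i" "Suc ?N - Suc j = i" "i \<le> ?N" using Suc.prems by (auto simp: i_def)
      obtain U e where U: "U \<noteq> {}" "U \<subseteq> ?P" "orthogonal_system (D, \<phi>) (W_flag A nabla (Suc i)) U j e"
        using Suc i by auto
      obtain y w where y: "y \<in> U" "(y, w) \<in> W_flag A nabla i" "(y, w) \<notin> W_flag A nabla (Suc i)"
        using no U orthogonal_systemD(1)[OF U(3)] i(3) by blast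
      have "remainder (D, \<phi>) j e y w \<noteq> (\<lambda>a b. 0)"
      proof
        assume "remainder (D, \<phi>) j e y w = (\<lambda>a b. 0)"
        then have "w = (\<lambda>a b. \<Sum>i<j. form_ip (D, \<phi>) y w (e i y) / form_ip (D, \<phi>) y (e i y) (e i y) * e i y a b)"
          by (simp only: remainder_zero_iff)
        moreover have "(y, \<lambda>a b. \<Sum>i<j. form_ip (D, \<phi>) y w (e i y) / form_ip (D, \<phi>) y (e i y) (e i y) * e i y a b)
            \<in> W_flag A nabla (Suc i)"
          by (rule linear_fibres_sum[OF W_flag_linear])
            (rule V_sectionD(3)[OF orthogonal_systemD(2)[OF U(3)] y(1)])
        ultimately show False using y(3) by metis
      qed
      note rem = this
      have sys: "orthogonal_system (D, \<phi>) (W_flag A nabla i) U j e"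
        using U(3) V_section_mono[OF _ W_flag_Suc_subset] unfolding orthogonal_system_def by blast
      have "U \<subseteq> D" using U(2) by blast
      then obtain U' e' where e': "y \<in> U'" "U' \<subseteq> U" "orthogonal_system (D, \<phi>) (W_flag A nabla i) U' (Suc j) e'"
        using orthogonal_system_extend[OF c(1) W_flag_linear W_flag_has_sections sys _ y(1,2) rem] by blast
      have "U' \<noteq> {}" "U' \<subseteq> ?P" using e' U(2) by auto
      then show ?case unfolding i(2) using e'(3) by blast
    qed
    from this[of "Suc ?N"] show False using orthogonal_system_bound by fastforce
  qed
  then obtain i P' where i: "i \<le> ?N" and P': "open P'" "P' \<noteq> {}" "P' \<subseteq> ?P"
    "\<And>y w. y \<in> P' \<Longrightarrow> (y, w) \<in> W_flag A nabla i \<Longrightarrow> (y, w) \<in> W_flag A nabla (Suc i)" by blast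
  have "y \<in> P' \<Longrightarrow> (y, w) \<in> W_flag A nabla (i + l) \<Longrightarrow> (y, w) \<in> W_flag A nabla (Suc (i + l))" for l y w
  proof (induction l arbitrary: y w)
    case (Suc l)
    then show ?case using W_flag_step_local[OF P'(1), of "i + l" y w] by (simp del: W_flag.simps)
  qed (use P'(4) in \<open>simp del: W_flag.simps\<close>)
  from this[of _ _ "?N - i"] show ?thesis using i P' by (intro exI[of _ P']) auto
qed

text \<open>Members that coincide over a dense open set coincide everywhere: an element of the larger one
  extends to a section, whose values lie in the smaller one over a dense set and hence everywhere.\<close>

lemma W_flag_stabilizes:
  assumes "l \<ge> DIM('e) * DIM('e)"
  shows "W_flag A nabla l = W_flag A nabla (DIM('e) * DIM('e))"
  using assms
proof (induction l rule: dec_induct)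
  case (step l)
  let ?N = "DIM('e) * DIM('e)"
  have "(x, w) \<in> W_flag A nabla (Suc ?N)" if xw: "(x, w) \<in> W_flag A nabla ?N" for x w
  proof -
    obtain U X where X: "x \<in> U" "V_section (W_flag A nabla ?N) U X" "X x = w"
      using has_sectionsD[OF W_flag_has_sections xw] by blast
    have "V_section (W_flag A nabla (Suc ?N)) U X"
    proof (rule section_closedD[OF _ V_sectionD(1,2)[OF X(2)]])
      show "section_closed (W_flag A nabla (Suc ?N))" by (rule W_flag_section_closed)
      fix P assume P: "open P" "P \<noteq> {}" "P \<subseteq> U"
      obtain P' where P': "open P'" "P' \<noteq> {}" "P' \<subseteq> P" "\<forall>y\<in>P'. \<forall>w. (y, w) \<in> W_flag A nabla ?N \<longrightarrow> (y, w) \<in> W_flag A nabla (Suc ?N)"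
        using W_flag_generic_coincidence[OF P(1,2)] by blast
      have "V_section (W_flag A nabla (Suc ?N)) P' X"
        using X(2) P' P W_section_subset[of U X P'] unfolding V_section_def by blast
      then show "\<exists>P'. P' \<noteq> {} \<and> P' \<subseteq> P \<and> V_section (W_flag A nabla (Suc ?N)) P' X" using P' by blast
    qed
    then show ?thesis using V_sectionD(3)[of _ U X x] X by blast
  qed
  then have "W_flag A nabla (Suc ?N) = W_flag A nabla ?N"
    using W_flag_Suc_subset[of ?N] by (auto simp del: W_flag.simps)
  then show ?case using step by simp
qed simp

lemma W_tilde_stable:
  obtains k where "W_tilde A nabla = W_flag A nabla k" "W_flag A nabla (Suc k) = W_flag A nabla k"
proof -
  define k where "k = (LEAST k. \<forall>l\<ge>k. W_flag A nabla l = W_flag A nabla k)"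
  have "\<forall>l\<ge>k. W_flag A nabla l = W_flag A nabla k"
    unfolding k_def by (rule LeastI[of _ "DIM('e) * DIM('e)"]) (use W_flag_stabilizes in blast)
  then have "W_flag A nabla (Suc k) = W_flag A nabla k" using le_Suc_eq by blast
  then show ?thesis using that[of k] by (simp add: W_tilde_def k_def)
qed

text \<open>A parallel section has zero curvature and zero second fundamental form, so it lies in every
  member of the flag.\<close>

lemma parallel_section_in_W_flag:
  assumes U: "open U" and g: "W_section A U g" and par: "parallel_on A nabla U g"
  shows "V_section (W_flag A nabla i) U g"
proof (induction i)
  case 0
  have "(x, g x) \<in> ker_curvature A nabla" if x: "x \<in> U" for x
    unfolding ker_curvature_iff[OF U x g]
  proof (intro allI impI, elim conjE)
    fix V X Y assume V: "open V" "x \<in> V" and X: "vector_field A V X" and Y: "vector_field A V Y"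
    let ?N = "U \<inter> V"
    have N: "open ?N" "x \<in> ?N" using U x V by auto
    have XN: "vector_field A ?N X" and YN: "vector_field A ?N Y"
      using vector_field_subset[OF X, of ?N] vector_field_subset[OF Y, of ?N] by auto
    have second: "W_nabla A nabla x u (\<lambda>y. W_nabla A nabla y (Z y) g) = (\<lambda>a b. 0)"
      if u: "u \<in> tangent_space A x" and Z: "vector_field A ?N Z" for u Z
    proof -
      have "W_nabla A nabla x u (\<lambda>y. W_nabla A nabla y (Z y) g) = W_nabla A nabla x u (\<lambda>y a b. 0)"
        by (rule W_nabla_cong[OF N W_section_zero u])
          (use par vector_field_tangent[OF Z] in \<open>auto simp: parallel_on_def\<close>)
      then show ?thesis by (simp add: W_nabla_zero[OF u])
    qed
    show "W_curv x X Y g = (\<lambda>a b. 0)"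
      unfolding W_curv_def
      using second[OF _ YN] second[OF _ XN] vector_field_tangent[OF XN N(2)] vector_field_tangent[OF YN N(2)]
        lie_bracket_tangent[OF XN YN N] par x
      by (simp add: parallel_on_def)
  qed
  then show ?case using U g by (simp add: V_section_S_op) (simp add: V_section_def)
next
  case (Suc i)
  note lin = W_flag_linear
  have "(x, g x) \<in> ker_second_form A nabla (W_flag A nabla i)" if "x \<in> U" for x
    unfolding ker_second_form_iff[OF lin]
    using Suc that par linear_fibres_zero[OF lin]
    by (intro exI[of _ U] exI[of _ g]) (simp add: parallel_on_def)
  then show ?case using U g by (simp add: V_section_S_op) (simp add: V_section_def)
qed

end

section \<open>Orthogonal frames of subbundles\<close>

definition combinations :: "nat \<Rightarrow> (nat \<Rightarrow> 'm form) \<Rightarrow> 'm form set" where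
  "combinations m f = {w. \<exists>r. w = (\<lambda>a b. \<Sum>i<m. r i * f i a b)}"

lemma combinationsI: "w = (\<lambda>a b. \<Sum>i<m. r i * f i a b) \<Longrightarrow> w \<in> combinations m f"
  by (auto simp: combinations_def)

lemma combinations_member:
  assumes "j < m"
  shows "f j \<in> combinations m f"
  by (rule combinationsI[where r = "\<lambda>i. if i = j then 1 else 0"])
    (use assms in \<open>simp add: if_distrib[of "\<lambda>x. x * _"] cong: if_cong\<close>)

lemma combinations_trans:
  assumes w: "w \<in> combinations m f" and f: "\<And>i. i < m \<Longrightarrow> f i \<in> combinations n g"
  shows "w \<in> combinations n g"
proof -
  obtain r where r: "w = (\<lambda>a b. \<Sum>i<m. r i * f i a b)" using w by (auto simp: combinations_def)
  have "\<forall>i. \<exists>s. i < m \<longrightarrow> f i = (\<lambda>a b. \<Sum>j<n. s j * g j a b)" using f by (auto simp: combinations_def)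
  then obtain s where s: "\<And>i. i < m \<Longrightarrow> f i = (\<lambda>a b. \<Sum>j<n. s i j * g j a b)" by metis
  show ?thesis
  proof (rule combinationsI[where r = "\<lambda>j. \<Sum>i<m. r i * s i j"], intro ext)
    fix a b
    have "w a b = (\<Sum>i<m. \<Sum>j<n. r i * s i j * g j a b)"
      unfolding r by (intro sum.cong refl) (simp add: s sum_distrib_left mult.assoc)
    also have "\<dots> = (\<Sum>j<n. (\<Sum>i<m. r i * s i j) * g j a b)"
      by (subst sum.swap) (simp add: sum_distrib_right)
    finally show "w a b = (\<Sum>j<n. (\<Sum>i<m. r i * s i j) * g j a b)" .
  qed
qed

context smooth_manifold
begin

lemma remainder_combination:
  assumes e: "orthogonal_system c V U n e" and y: "y \<in> U" and w: "w \<in> combinations n (\<lambda>i. e i y)"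
  shows "remainder c n e y w = (\<lambda>a b. 0)"
proof -
  obtain r where r: "w = (\<lambda>a b. \<Sum>i<n. r i * e i y a b)" using w by (auto simp: combinations_def)
  have "form_ip c y w (e i y) / form_ip c y (e i y) (e i y) = r i" if "i < n" for i
    unfolding r form_ip_combination[OF e y that] using orthogonal_systemD(3)[OF e that y] by simp
  then show ?thesis unfolding remainder_zero_iff using r by simp
qed

text \<open>Gram-Schmidt orthogonalization, carried out simultaneously at all points.\<close>

lemma gram_schmidt:
  assumes c: "(D, \<phi>) \<in> A" and V: "linear_fibres V" and U: "open U" "U \<subseteq> D"
    and s: "\<And>i. i < n \<Longrightarrow> V_section V U (s i)"
    and indep: "\<And>y m. y \<in> U \<Longrightarrow> m < n \<Longrightarrow> s m y \<notin> combinations m (\<lambda>i. s i y)"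
  shows "m \<le> n \<Longrightarrow> \<exists>e. orthogonal_system (D, \<phi>) V U m e \<and>
    (\<forall>y\<in>U. \<forall>i<m. e i y \<in> combinations m (\<lambda>i. s i y) \<and> s i y \<in> combinations m (\<lambda>i. e i y))"
proof (induction m)
  case 0
  then show ?case using U by (auto simp: orthogonal_system_def)
next
  case (Suc m)
  then obtain e where e: "orthogonal_system (D, \<phi>) V U m e"
    and es: "\<And>y i. y \<in> U \<Longrightarrow> i < m \<Longrightarrow> e i y \<in> combinations m (\<lambda>i. s i y)"
    and se: "\<And>y i. y \<in> U \<Longrightarrow> i < m \<Longrightarrow> s i y \<in> combinations m (\<lambda>i. e i y)" by auto
  have m: "m < n" using Suc.prems by simp
  define R where "R = (\<lambda>y. remainder (D, \<phi>) m e y (s m y))"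
  have R: "V_section V U R" unfolding R_def by (rule V_section_remainder[OF c V e U(2) s[OF m]])
  let ?e = "e(m := R)"
  define q where "q = (\<lambda>y i. form_ip (D, \<phi>) y (s m y) (e i y) / form_ip (D, \<phi>) y (e i y) (e i y))"
  have R_eq: "R y = (\<lambda>a b. s m y a b - (\<Sum>i<m. q y i * e i y a b))" for y
    by (simp add: R_def remainder_def q_def)
  have lift_s: "combinations m (\<lambda>i. s i y) \<subseteq> combinations (Suc m) (\<lambda>i. s i y)" for y
    using combinations_trans[where m = m and f = "\<lambda>i. s i y"] combinations_member[of _ "Suc m" "\<lambda>i. s i y"] by auto
  have lift_e: "combinations m (\<lambda>i. e i y) \<subseteq> combinations (Suc m) (\<lambda>i. ?e i y)" for y
  proof
    fix w assume w: "w \<in> combinations m (\<lambda>i. e i y)"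
    have "e i y \<in> combinations (Suc m) (\<lambda>i. ?e i y)" if "i < m" for i
      using combinations_member[of i "Suc m" "\<lambda>i. ?e i y"] that by simp
    then show "w \<in> combinations (Suc m) (\<lambda>i. ?e i y)" using combinations_trans[OF w] by blast
  qed
  have nz: "form_ip (D, \<phi>) y (R y) (R y) \<noteq> 0" if y: "y \<in> U" for y
  proof
    assume "form_ip (D, \<phi>) y (R y) (R y) = 0"
    then have "R y = (\<lambda>a b. 0)"
      using form_ip_self_zero[OF c _ W_section_form[OF V_sectionD(2)[OF R] y]] y U by auto
    then have "s m y = (\<lambda>a b. \<Sum>i<m. q y i * e i y a b)" unfolding R_eq by (auto simp: fun_eq_iff)
    then have "s m y \<in> combinations m (\<lambda>i. e i y)" by (rule combinationsI)
    then have "s m y \<in> combinations m (\<lambda>i. s i y)" by (rule combinations_trans) (rule es[OF y])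
    then show False using indep[OF y m] by contradiction
  qed
  have sys: "orthogonal_system (D, \<phi>) V U (Suc m) ?e"
    by (rule orthogonal_system_append[OF e R _ nz]) (auto simp: R_def intro: remainder_orthogonal[OF e])
  have Rs: "R y \<in> combinations (Suc m) (\<lambda>i. s i y)" if y: "y \<in> U" for y
  proof -
    have "R y \<in> combinations (Suc m) (\<lambda>i. if i < m then e i y else s m y)"
      by (rule combinationsI[where r = "\<lambda>i. if i < m then - q y i else 1"]) (simp add: R_eq sum_negf)
    then show ?thesis
      by (rule combinations_trans)
        (use es[OF y] lift_s[of y] combinations_member[of m "Suc m" "\<lambda>i. s i y"] in auto)
  qed
  have sR: "s m y \<in> combinations (Suc m) (\<lambda>i. ?e i y)" for y
    by (rule combinationsI[where r = "\<lambda>i. if i < m then q y i else 1"]) (simp add: R_eq)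
  have "?e i y \<in> combinations (Suc m) (\<lambda>i. s i y) \<and> s i y \<in> combinations (Suc m) (\<lambda>i. ?e i y)"
    if y: "y \<in> U" and i: "i < Suc m" for y i
  proof (cases "i = m")
    case True
    then show ?thesis using Rs[OF y] sR[of y] by simp
  next
    case False
    then have "i < m" using i by simp
    then show ?thesis using subsetD[OF lift_s es[OF y]] subsetD[OF lift_e se[OF y]] False by simp
  qed
  then show ?case using sys by blast
qed

text \<open>Injectivity of the coefficient map of a subbundle is what makes the given frame independent.\<close>

lemma subbundle_orthogonal_frame:
  assumes c: "(D, \<phi>) \<in> A" "x \<in> D" and V: "linear_fibres V" and sub: "subbundle_over A V U" "x \<in> U"
  shows "\<exists>N n e. x \<in> N \<and> N \<subseteq> D \<and> orthogonal_system (D, \<phi>) V N n e \<and> spanning (D, \<phi>) V N n e"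
proof -
  from sub(1)[unfolded subbundle_over_def, THEN bspec, OF sub(2)]
  obtain M n s where *: "open M \<and> x \<in> M \<and> M \<subseteq> U \<and> (\<forall>i<n. W_section A M (s i)) \<and>
      (\<forall>z\<in>M. bij_betw (\<lambda>c a b. \<Sum>i<n. c i * s i z a b) ({..<n::nat} \<rightarrow>\<^sub>E (UNIV::real set)) (fibre V z))"
    by (elim exE)
  then have M: "open M" "x \<in> M" "\<And>i. i < n \<Longrightarrow> W_section A M (s i)"
    and bij: "\<And>z. z \<in> M \<Longrightarrow> bij_betw (\<lambda>c a b. \<Sum>i<n. c i * s i z a b) ({..<n::nat} \<rightarrow>\<^sub>E (UNIV::real set)) (fibre V z)"
    by simp_all
  let ?N = "D \<inter> M"
  have N: "open ?N" "x \<in> ?N" using chart_homeomorphism(1)[OF c(1)] M c by auto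
  have fib: "w \<in> combinations n (\<lambda>i. s i z) \<longleftrightarrow> (z, w) \<in> V" if z: "z \<in> M" for z w
  proof
    assume "w \<in> combinations n (\<lambda>i. s i z)"
    then obtain r where r: "w = (\<lambda>a b. \<Sum>i<n. r i * s i z a b)" by (auto simp: combinations_def)
    have "(\<lambda>c a b. \<Sum>i<n. c i * s i z a b) (restrict r {..<n}) \<in> fibre V z"
      by (rule bij_betw_apply[OF bij[OF z]]) (auto simp: PiE_iff extensional_def)
    then show "(z, w) \<in> V" by (simp add: fibre_def r)
  next
    assume "(z, w) \<in> V"
    then have "w \<in> (\<lambda>c a b. \<Sum>i<n. c i * s i z a b) ` ({..<n} \<rightarrow>\<^sub>E UNIV)"
      using bij_betw_imp_surj_on[OF bij[OF z]] by (simp add: fibre_def)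
    then show "w \<in> combinations n (\<lambda>i. s i z)" by (auto simp: combinations_def)
  qed
  have sV: "V_section V ?N (s i)" if "i < n" for i
    unfolding V_section_def
    using N W_section_subset[OF M(3)[OF that], of ?N] fib combinations_member[OF that, of "\<lambda>i. s i _"] by auto
  have indep: "s m z \<notin> combinations m (\<lambda>i. s i z)" if z: "z \<in> ?N" and m: "m < n" for z m
  proof
    assume "s m z \<in> combinations m (\<lambda>i. s i z)"
    then obtain r where r: "s m z = (\<lambda>a b. \<Sum>i<m. r i * s i z a b)" by (auto simp: combinations_def)
    let ?c = "restrict (\<lambda>i. if i < m then r i else 0) {..<n}"
    let ?d = "restrict (\<lambda>i. if i = m then 1 else 0 :: real) {..<n}"
    have "(\<Sum>i<n. ?c i * s i z a b) = (\<Sum>i<m. r i * s i z a b)" for a b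
    proof -
      have "(\<Sum>i<n. ?c i * s i z a b) = (\<Sum>i<m. ?c i * s i z a b)"
        by (rule sum.mono_neutral_right) (use m in auto)
      then show ?thesis using m by simp
    qed
    moreover have "(\<Sum>i<n. ?d i * s i z a b) = s m z a b" for a b
      using m by (simp add: if_distrib[of "\<lambda>x. x * _"] cong: if_cong)
    ultimately have "(\<lambda>a b. \<Sum>i<n. ?c i * s i z a b) = (\<lambda>a b. \<Sum>i<n. ?d i * s i z a b)"
      using fun_cong[OF fun_cong[OF r]] by simp
    then have "?c = ?d"
      using inj_onD[OF bij_betw_imp_inj_on[OF bij], of z ?c ?d] z by auto
    from fun_cong[OF this, of m] show False using m by simp
  qed
  obtain e where e: "orthogonal_system (D, \<phi>) V ?N n e"
    and se: "\<And>y i. y \<in> ?N \<Longrightarrow> i < n \<Longrightarrow> s i y \<in> combinations n (\<lambda>i. e i y)"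
    using gram_schmidt[OF c(1) V N(1) _ sV indep, of n n] by blast
  have "remainder (D, \<phi>) n e y w = (\<lambda>a b. 0)" if "y \<in> ?N" "(y, w) \<in> V" for y w
  proof (rule remainder_combination[OF e that(1)])
    have "w \<in> combinations n (\<lambda>i. s i y)" using fib that by auto
    then show "w \<in> combinations n (\<lambda>i. e i y)" by (rule combinations_trans) (rule se[OF that(1)])
  qed
  then have "spanning (D, \<phi>) V ?N n e" by (simp add: spanning_def)
  then show ?thesis using e N by blast
qed

lemma V_section_coefficients:
  assumes c: "(D, \<phi>) \<in> A" and e: "orthogonal_system (D, \<phi>) V U n e" and U: "U \<subseteq> D"
    and span: "spanning (D, \<phi>) V U n e" and X: "V_section V U X"
  shows "\<exists>r. (\<forall>i<n. smooth_fun A U (r i)) \<and> (\<forall>y\<in>U. X y = (\<lambda>a b. \<Sum>i<n. r i y * e i y a b))"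
proof -
  note oU = orthogonal_systemD(1)[OF e]
  have "smooth_fun A U (\<lambda>y. form_ip (D, \<phi>) y (X y) (e i y) / form_ip (D, \<phi>) y (e i y) (e i y))" if "i < n" for i
    using orthogonal_systemD(2,3)[OF e that] V_sectionD(2) X
    by (intro smooth_fun_divide oU smooth_fun_form_ip[OF c oU U]) auto
  moreover have "X y = (\<lambda>a b. \<Sum>i<n. form_ip (D, \<phi>) y (X y) (e i y) / form_ip (D, \<phi>) y (e i y) (e i y) * e i y a b)"
    if "y \<in> U" for y
    using span V_sectionD(3)[OF X that] that unfolding spanning_def remainder_zero_iff by blast
  ultimately show ?thesis
    by (intro exI[of _ "\<lambda>i y. form_ip (D, \<phi>) y (X y) (e i y) / form_ip (D, \<phi>) y (e i y) (e i y)"]) blast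
qed

text \<open>A smooth family of quadratic forms is positive on the unit sphere near any point where it is
  positive, by compactness of the sphere.\<close>

lemma pos_def_near:
  assumes U: "open U" "x \<in> U" and g: "W_section A U g" and pos: "pos_def A x (g x)"
  shows "\<exists>N. open N \<and> x \<in> N \<and> N \<subseteq> U \<and> (\<forall>y\<in>N. pos_def A y (g y))"
proof -
  obtain D \<phi> where c: "(D, \<phi>) \<in> A" "x \<in> D" using chart_exists by blast
  let ?k = "coord_vec A (D, \<phi>)"
  let ?N = "D \<inter> U"
  have N: "open ?N" "x \<in> ?N" using chart_homeomorphism(1)[OF c(1)] U c by auto
  define G where "G = (\<lambda>y i j. g y (?k i y) (?k j y))"
  define q where "q = (\<lambda>y v. \<Sum>i\<in>Basis. \<Sum>j\<in>Basis. (v \<bullet> i) * (v \<bullet> j) * G y i j)"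
  have q: "g y (?k v y) (?k v y) = q y v" if "y \<in> ?N" for y v
    using form_chart_expand[OF W_section_form[OF g, of y] c(1), of "?k v y" "?k v y"] that c
    by (simp add: q_def G_def coord_vec_coordinate)
  have k0: "?k 0 y = tzero" if "y \<in> ?N" for y
    using linear_0[OF coord_vec_linear[OF c(1)], of y] that by (auto simp: tzero_def fun_eq_iff)
  have pos_iff: "pos_def A y (g y) \<longleftrightarrow> (\<forall>v\<in>sphere 0 1. 0 < q y v)" if y: "y \<in> ?N" for y
  proof
    assume p: "pos_def A y (g y)"
    show "\<forall>v\<in>sphere 0 1. 0 < q y v"
    proof
      fix v :: 'e assume v: "v \<in> sphere 0 1"
      have "?k v y \<noteq> tzero"
      proof
        assume "?k v y = tzero"
        then have "v \<bullet> b = 0" for b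
          using coord_vec_coordinate[OF c(1), of y v b] y by (simp add: tzero_def)
        then show False using v inner_eq_zero_iff[of v] by auto
      qed
      then show "0 < q y v" using p q[OF y, of v] y c by (auto simp: pos_def_def)
    qed
  next
    assume p: "\<forall>v\<in>sphere 0 1. 0 < q y v"
    show "pos_def A y (g y)"
      unfolding pos_def_def
    proof (intro ballI impI)
      fix a assume a: "a \<in> tangent_space A y" "a \<noteq> tzero"
      then obtain v where v: "a = ?k v y" using tangent_space_chart[OF c(1), of y] y by auto
      have v0: "v \<noteq> 0" using a v k0[OF y] by auto
      have "q y v = norm v * norm v * q y (v /\<^sub>R norm v)"
        using v0 by (simp add: q_def sum_distrib_left field_simps)
      moreover have "0 < q y (v /\<^sub>R norm v)" using p v0 by simp
      ultimately show "0 < g y a a" using v0 q[OF y, of v] v by simp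
    qed
  qed
  have contq: "continuous_on (sphere 0 1) (q x)" unfolding q_def by (intro continuous_intros)
  obtain b :: 'e where b: "b \<in> Basis" using nonempty_Basis by blast
  then have "sphere (0 :: 'e) 1 \<noteq> {}" by (auto intro!: exI[of _ b])
  then obtain v0 where v0: "v0 \<in> sphere 0 1" "\<And>v. v \<in> sphere 0 1 \<Longrightarrow> q x v0 \<le> q x v"
    using continuous_attains_inf[OF compact_sphere _ contq] by blast
  have mu: "0 < q x v0" using pos_iff[OF N(2)] pos v0 by blast
  define \<delta> where "\<delta> = q x v0 / (2 * DIM('e) * DIM('e))"
  have \<delta>: "\<delta> > 0" using mu by (simp add: \<delta>_def)
  have "\<forall>\<^sub>F y in nhds x. \<forall>i\<in>Basis. \<forall>j\<in>Basis. \<bar>G y i j - G x i j\<bar> < \<delta>"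
  proof (intro eventually_ball_finite finite_Basis ballI)
    fix i j :: 'e
    have "vector_field A ?N (?k v)" for v
      by (rule vector_field_subset[OF vector_field_coord[OF c(1)]]) auto
    then have "smooth_fun A ?N (\<lambda>y. G y i j)"
      unfolding G_def using W_section_smooth[OF g N(1)] by auto
    then have "isCont (\<lambda>y. G y i j) x"
      using smooth_fun_continuous_on N continuous_on_eq_continuous_at by blast
    then have "((\<lambda>y. G y i j) \<longlongrightarrow> G x i j) (nhds x)"
      using isCont_def tendsto_at_iff_tendsto_nhds by blast
    then show "\<forall>\<^sub>F y in nhds x. \<bar>G y i j - G x i j\<bar> < \<delta>"
      using tendstoD[OF _ \<delta>, of "\<lambda>y. G y i j" "G x i j" "nhds x"] by (simp add: dist_real_def)
  qed
  then obtain M where M: "open M" "x \<in> M" "\<And>y i j. y \<in> M \<Longrightarrow> i \<in> Basis \<Longrightarrow> j \<in> Basis \<Longrightarrow> \<bar>G y i j - G x i j\<bar> < \<delta>"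
    unfolding eventually_nhds by blast
  have "pos_def A y (g y)" if y: "y \<in> M \<inter> ?N" for y
  proof -
    have "0 < q y v" if v: "v \<in> sphere 0 1" for v
    proof -
      have "norm (\<Sum>i\<in>Basis. \<Sum>j\<in>Basis. (v \<bullet> i) * (v \<bullet> j) * (G y i j - G x i j))
          \<le> card (Basis :: 'e set) * (card (Basis :: 'e set) * \<delta>)"
      proof (intro sum_norm_bound)
        fix i j :: 'e assume ij: "i \<in> Basis" "j \<in> Basis"
        have n: "norm v = 1" using v by simp
        have "\<bar>v \<bullet> i\<bar> \<le> 1" "\<bar>v \<bullet> j\<bar> \<le> 1" using Basis_le_norm[OF ij(1), of v] Basis_le_norm[OF ij(2), of v] n by auto
        then have "\<bar>v \<bullet> i\<bar> * \<bar>v \<bullet> j\<bar> * \<bar>G y i j - G x i j\<bar> \<le> 1 * 1 * \<delta>"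
          using M(3)[of y i j] y ij by (intro mult_mono) auto
        then show "norm ((v \<bullet> i) * (v \<bullet> j) * (G y i j - G x i j)) \<le> \<delta>" by (simp add: abs_mult)
      qed
      also have "\<dots> < q x v0" using mu by (simp add: \<delta>_def)
      finally have "\<bar>q y v - q x v\<bar> < q x v0"
        by (simp add: q_def right_diff_distrib sum_subtractf)
      then show ?thesis using v0(2)[OF v] by linarith
    qed
    then show ?thesis using pos_iff y by blast
  qed
  then show ?thesis using M N by (intro exI[of _ "M \<inter> ?N"]) auto
qed

end

section \<open>Parallel sections of a flat subbundle\<close>

context manifold_connection
begin

lemma W_flag_subset_ker_curvature: "W_flag A nabla k \<subseteq> ker_curvature A nabla"
proof (induction k)
  case 0
  show ?case using S_op_subset by simp
next
  case (Suc k)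
  then show ?case using W_flag_Suc_subset[of k] by (rule order_trans[rotated])
qed

text \<open>The frame \<open>e\<close> turns parallel sections of \<open>V\<close> into solutions of a linear system whose
  coefficients \<open>\<omega>\<close> are the connection coefficients of \<open>V\<close>, which exist because the second fundamental
  form of \<open>V\<close> vanishes. The system is flat because the curvature vanishes on \<open>V\<close>.\<close>

lemma parallel_extension:
  assumes c: "(D, \<phi>) \<in> A" "x \<in> D" and V: "linear_fibres V" and ker: "V \<subseteq> ker_second_form A nabla V"
    and curv: "V \<subseteq> ker_curvature A nabla"
    and N: "x \<in> N" "N \<subseteq> D" and e: "orthogonal_system (D, \<phi>) V N n e" and span: "spanning (D, \<phi>) V N n e"
    and h: "(x, h) \<in> V"
  shows "\<exists>U g. open U \<and> x \<in> U \<and> W_section A U g \<and> parallel_on A nabla U g \<and> g x = h"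
proof -
  let ?k = "coord_vec A (D, \<phi>)"
  note oN = orthogonal_systemD(1)[OF e]
  have eW: "W_section A N (e i)" if "i < n" for i using orthogonal_systemD(2)[OF e that] V_sectionD(2) by blast
  have kN: "vector_field A N (?k v)" for v by (rule vector_field_subset[OF vector_field_coord[OF c(1)] N(2)])
  have kT: "?k v y \<in> tangent_space A y" if "y \<in> N" for v y using that N c by auto
  have VS: "V_section V N (\<lambda>y. W_nabla A nabla y (?k b y) (e i))" if i: "i < n" for b i
    unfolding V_section_def
  proof (intro conjI ballI oN W_section_W_nabla[OF oN kN eW[OF i]])
    fix y assume y: "y \<in> N"
    show "(y, W_nabla A nabla y (?k b y) (e i)) \<in> V"
      using ker V_sectionD(3)[OF orthogonal_systemD(2)[OF e i] y]
      by (intro W_nabla_of_ker_second_form[OF c(1) V e N(2) span orthogonal_systemD(2)[OF e i] y _ kT[OF y]]) auto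
  qed
  define coeffs where "coeffs = (\<lambda>b i r. (\<forall>j<n. smooth_fun A N (r j)) \<and>
      (\<forall>y\<in>N. W_nabla A nabla y (?k b y) (e i) = (\<lambda>a' b'. \<Sum>j<n. r j y * e j y a' b')))"
  define \<omega> where "\<omega> = (\<lambda>b i. SOME r. coeffs b i r)"
  have "coeffs b i (\<omega> b i)" if "i < n" for b i
  proof -
    have "\<exists>r. coeffs b i r" unfolding coeffs_def by (rule V_section_coefficients[OF c(1) e N(2) span VS[OF that]])
    then show ?thesis unfolding \<omega>_def by (rule someI_ex)
  qed
  then have \<omega>: "\<And>b i j. i < n \<Longrightarrow> j < n \<Longrightarrow> smooth_fun A N (\<omega> b i j)"
    and nabla_e: "\<And>b i y. i < n \<Longrightarrow> y \<in> N \<Longrightarrow> W_nabla A nabla y (?k b y) (e i) = (\<lambda>a' b'. \<Sum>j<n. \<omega> b i j y * e j y a' b')"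
    unfolding coeffs_def by blast+
  have second: "W_nabla A nabla y (?k a y) (\<lambda>y. W_nabla A nabla y (?k b y) (e i))
      = (\<lambda>a' b'. \<Sum>l<n. (?k a y (\<omega> b i l) + (\<Sum>j<n. \<omega> b i j y * \<omega> a j l y)) * e l y a' b')"
    if y: "y \<in> N" and i: "i < n" for y a b i
  proof -
    have "W_nabla A nabla y (?k a y) (\<lambda>y. W_nabla A nabla y (?k b y) (e i))
      = W_nabla A nabla y (?k a y) (\<lambda>y a' b'. \<Sum>j<n. \<omega> b i j y * e j y a' b')"
      by (rule W_nabla_cong[OF oN y W_section_sum kT[OF y]]) (use oN eW \<omega> i nabla_e in auto)
    also have "\<dots> = (\<lambda>a' b'. (\<Sum>j<n. ?k a y (\<omega> b i j) * e j y a' b')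
        + (\<Sum>j<n. \<omega> b i j y * W_nabla A nabla y (?k a y) (e j) a' b'))"
      by (rule W_nabla_sum[OF oN y kT[OF y]]) (use eW \<omega> i in auto)
    also have "\<dots> = (\<lambda>a' b'. \<Sum>l<n. (?k a y (\<omega> b i l) + (\<Sum>j<n. \<omega> b i j y * \<omega> a j l y)) * e l y a' b')"
    proof (intro ext)
      fix a' b'
      have "(\<Sum>j<n. \<omega> b i j y * W_nabla A nabla y (?k a y) (e j) a' b')
          = (\<Sum>j<n. \<Sum>l<n. \<omega> b i j y * \<omega> a j l y * e l y a' b')"
        by (intro sum.cong refl) (simp add: nabla_e y sum_distrib_left mult.assoc)
      also have "\<dots> = (\<Sum>l<n. (\<Sum>j<n. \<omega> b i j y * \<omega> a j l y) * e l y a' b')"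
        by (subst sum.swap) (simp add: sum_distrib_right)
      finally show "(\<Sum>j<n. ?k a y (\<omega> b i j) * e j y a' b') + (\<Sum>j<n. \<omega> b i j y * W_nabla A nabla y (?k a y) (e j) a' b')
        = (\<Sum>l<n. (?k a y (\<omega> b i l) + (\<Sum>j<n. \<omega> b i j y * \<omega> a j l y)) * e l y a' b')"
        by (simp add: distrib_right sum.distrib)
    qed
    finally show ?thesis .
  qed
  have flat: "?k a y (\<omega> b i l) - ?k b y (\<omega> a i l) = (\<Sum>j<n. \<omega> a i j y * \<omega> b j l y - \<omega> b i j y * \<omega> a j l y)"
    if y: "y \<in> N" and i: "i < n" and l: "l < n" for y a b i l
  proof -
    define r where "r = (\<lambda>l. (?k a y (\<omega> b i l) + (\<Sum>j<n. \<omega> b i j y * \<omega> a j l y))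
      - (?k b y (\<omega> a i l) + (\<Sum>j<n. \<omega> a i j y * \<omega> b j l y)))"
    have "W_nabla A nabla y tzero (e i) = (\<lambda>a b. 0)"
      using W_nabla_dir_sum[OF oN y eW[OF i] finite.emptyI, of "\<lambda>_. tzero" "\<lambda>_. 0"] by (simp add: tzero_def)
    then have bracket: "W_nabla A nabla y (lie_bracket A (?k a) (?k b) y) (e i) = (\<lambda>a b. 0)"
      using lie_bracket_coord[OF c(1), of y a b] y N by auto
    have "(y, e i y) \<in> ker_curvature A nabla"
      using curv V_sectionD(3)[OF orthogonal_systemD(2)[OF e i] y] by blast
    then have "W_curv y (?k a) (?k b) (e i) = (\<lambda>a b. 0)"
      using oN y kN[of a] kN[of b] unfolding ker_curvature_iff[OF oN y eW[OF i]] by blast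
    then have zero: "W_nabla A nabla y (?k a y) (\<lambda>y. W_nabla A nabla y (?k b y) (e i)) a' b'
        - W_nabla A nabla y (?k b y) (\<lambda>y. W_nabla A nabla y (?k a y) (e i)) a' b' = 0" for a' b'
      unfolding W_curv_def bracket fun_eq_iff by simp
    have "(\<lambda>a' b'. \<Sum>l<n. r l * e l y a' b') = (\<lambda>a' b'. 0)"
      using zero unfolding second[OF y i] r_def by (simp add: left_diff_distrib sum_subtractf)
    then have "r l * form_ip (D, \<phi>) y (e l y) (e l y) = form_ip (D, \<phi>) y (\<lambda>a b. 0) (e l y)"
      using form_ip_combination[OF e y l, of r] by simp
    then have "r l = 0" using orthogonal_systemD(3)[OF e l y] by (simp add: form_ip_def)
    then show ?thesis by (simp add: r_def sum_subtractf)
  qed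
  \<comment> \<open>Transport the system to the image of the chart.\<close>
  define \<Omega> where "\<Omega> = (\<lambda>i k p. \<Sum>b\<in>Basis. \<omega> b i k (inv_into D \<phi> p) *\<^sub>R b)"
  have \<Omega>b: "\<Omega> i k p \<bullet> b = \<omega> b i k (inv_into D \<phi> p)" if "b \<in> Basis" for i k p b
    using that by (simp add: \<Omega>_def inner_sum_left inner_Basis if_distrib[of "\<lambda>x. _ * x"] cong: if_cong)
  have oS: "open (\<phi> ` N)" "\<phi> x \<in> \<phi> ` N"
    using chart_image_open[OF c(1) oN] N by (auto simp: Int_absorb1)
  define r where "r = (\<lambda>i. form_ip (D, \<phi>) x h (e i x) / form_ip (D, \<phi>) x (e i x) (e i x))"
  have r: "h = (\<lambda>a b. \<Sum>i<n. r i * e i x a b)"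
    using span h N(1) unfolding spanning_def remainder_zero_iff r_def by blast
  have Ck\<omega>: "Ck_on m (\<lambda>p. \<omega> b i k (inv_into D \<phi> p)) (\<phi> ` N)" if "i < n" "k < n" for m b i k
    using smooth_funD[OF \<omega>[OF that] c(1)] N(2) by (simp add: Int_absorb1)
  have d\<omega>: "frechet_derivative (\<lambda>p. \<omega> b i k (inv_into D \<phi> p)) (at (\<phi> y)) a = ?k a y (\<omega> b i k)"
    if "i < n" "k < n" "y \<in> N" for a b i k y
    using coord_vec_eq[OF smooth_nearI[OF oN that(3) \<omega>[OF that(1,2)]], of D \<phi> a] by simp
  have "\<exists>R>0. ball (\<phi> x) R \<subseteq> \<phi> ` N \<and> (\<exists>C. \<forall>k<n. C k (\<phi> x) = r k \<and> (\<forall>m. Ck_on m (C k) (ball (\<phi> x) R)) \<and>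
    (\<forall>y\<in>ball (\<phi> x) R. (C k has_derivative (\<lambda>v. - (\<Sum>i<n. C i y * (\<Omega> i k y \<bullet> v)))) (at y)))"
  proof (rule flat_system_solution[OF oS])
    show "Ck_on m (\<lambda>p. \<Omega> i k p \<bullet> b) (\<phi> ` N)" if "i < n" "k < n" "b \<in> Basis" for i k b m
      unfolding \<Omega>b[OF that(3)] by (rule Ck\<omega>[OF that(1,2)])
    fix i k p and a b :: 'e assume i: "i < n" and k: "k < n" and p: "p \<in> \<phi> ` N" and ab: "a \<in> Basis" "b \<in> Basis"
    obtain y where y: "y \<in> N" "p = \<phi> y" using p by auto
    have inv: "inv_into D \<phi> p = y" using y N c by auto
    show "frechet_derivative (\<lambda>y. \<Omega> i k y \<bullet> b) (at p) a - frechet_derivative (\<lambda>y. \<Omega> i k y \<bullet> a) (at p) b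
      = (\<Sum>j<n. (\<Omega> i j p \<bullet> a) * (\<Omega> j k p \<bullet> b) - (\<Omega> i j p \<bullet> b) * (\<Omega> j k p \<bullet> a))"
      unfolding \<Omega>b[OF ab(1)] \<Omega>b[OF ab(2)] inv using d\<omega>[OF i k y(1)] flat[OF y(1) i k] y(2) by simp
  qed
  then obtain R C where R: "R > 0" "ball (\<phi> x) R \<subseteq> \<phi> ` N" and Cx: "\<And>k. k < n \<Longrightarrow> C k (\<phi> x) = r k"
    and CkC: "\<And>k m. k < n \<Longrightarrow> Ck_on m (C k) (ball (\<phi> x) R)"
    and dC: "\<And>k p. k < n \<Longrightarrow> p \<in> ball (\<phi> x) R \<Longrightarrow> (C k has_derivative (\<lambda>v. - (\<Sum>i<n. C i p * (\<Omega> i k p \<bullet> v)))) (at p)"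
    by blast
  define U where "U = N \<inter> \<phi> -` ball (\<phi> x) R"
  have oU: "open U"
    unfolding U_def
    by (rule continuous_open_preimage[OF continuous_on_subset[OF chart_continuous[OF c(1)] N(2)] oN open_ball])
  have U: "x \<in> U" "U \<subseteq> N" "U \<subseteq> D" using N R by (auto simp: U_def)
  have oU': "open (\<phi> ` U)" using chart_image_open[OF c(1) oU] U by (simp add: Int_absorb1)
  have sC: "smooth_fun A U (\<lambda>y. C k (\<phi> y))" if k: "k < n" for k
  proof (rule smooth_fun_chartI[OF c(1) oU U(3)])
    fix m
    have "Ck_on m (C k) (\<phi> ` U)" by (rule Ck_on_subset[OF CkC[OF k]]) (auto simp: U_def)
    moreover have "C k p = C k (\<phi> (inv_into D \<phi> p))" if "p \<in> \<phi> ` U" for p using that U c by auto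
    ultimately show "Ck_on m (\<lambda>p. C k (\<phi> (inv_into D \<phi> p))) (\<phi> ` U)"
      using Ck_on_cong[OF oU', of "C k" "\<lambda>p. C k (\<phi> (inv_into D \<phi> p))"] by blast
  qed
  have kC: "?k a y (\<lambda>y. C k (\<phi> y)) = - (\<Sum>i<n. C i (\<phi> y) * \<omega> a i k y)" if k: "k < n" and y: "y \<in> U" and a: "a \<in> Basis" for k y a
  proof -
    have p: "\<phi> y \<in> ball (\<phi> x) R" and yD: "y \<in> D" using y U by (auto simp: U_def)
    have "?k a y (\<lambda>y. C k (\<phi> y)) = frechet_derivative (\<lambda>p. C k (\<phi> (inv_into D \<phi> p))) (at (\<phi> y)) a"
      by (rule coord_vec_eq[OF smooth_nearI[OF oU y sC[OF k]]])
    also have "frechet_derivative (\<lambda>p. C k (\<phi> (inv_into D \<phi> p))) (at (\<phi> y)) = frechet_derivative (C k) (at (\<phi> y))"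
      by (rule frechet_derivative_cong_open[OF oU']) (use y U c in auto)
    also have "\<dots> = (\<lambda>v. - (\<Sum>i<n. C i (\<phi> y) * (\<Omega> i k (\<phi> y) \<bullet> v)))"
      by (rule frechet_derivative_at[OF dC[OF k p], symmetric])
    finally show ?thesis using \<Omega>b[OF a] yD c by simp
  qed
  define g where "g = (\<lambda>y a b. \<Sum>i<n. C i (\<phi> y) * e i y a b)"
  have eU: "W_section A U (e i)" if "i < n" for i by (rule W_section_subset[OF eW[OF that] U(2)])
  have gU: "W_section A U g" unfolding g_def by (rule W_section_sum) (use oU eU sC in auto)
  have coord: "W_nabla A nabla y (?k a y) g = (\<lambda>a' b'. 0)" if y: "y \<in> U" and a: "a \<in> Basis" for y a
  proof -
    have yN: "y \<in> N" using y U by blast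
    have "W_nabla A nabla y (?k a y) g = (\<lambda>a' b'. (\<Sum>k<n. ?k a y (\<lambda>y. C k (\<phi> y)) * e k y a' b')
        + (\<Sum>i<n. C i (\<phi> y) * W_nabla A nabla y (?k a y) (e i) a' b'))"
      unfolding g_def by (rule W_nabla_sum[OF oU y kT[OF yN]]) (use eU sC in auto)
    also have "\<dots> = (\<lambda>a' b'. 0)"
    proof (intro ext)
      fix a' b'
      have "(\<Sum>i<n. C i (\<phi> y) * W_nabla A nabla y (?k a y) (e i) a' b')
          = (\<Sum>i<n. \<Sum>k<n. C i (\<phi> y) * \<omega> a i k y * e k y a' b')"
        by (intro sum.cong refl) (simp add: nabla_e yN sum_distrib_left mult.assoc)
      also have "\<dots> = (\<Sum>k<n. (\<Sum>i<n. C i (\<phi> y) * \<omega> a i k y) * e k y a' b')"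
        by (subst sum.swap) (simp add: sum_distrib_right)
      finally show "(\<Sum>k<n. ?k a y (\<lambda>y. C k (\<phi> y)) * e k y a' b')
          + (\<Sum>i<n. C i (\<phi> y) * W_nabla A nabla y (?k a y) (e i) a' b') = 0"
        by (simp add: kC[OF _ y a] sum_negf)
    qed
    finally show ?thesis .
  qed
  have "parallel_on A nabla U g"
    unfolding parallel_on_def
  proof (intro ballI)
    fix y u assume y: "y \<in> U" and u: "u \<in> tangent_space A y"
    have yD: "y \<in> D" using y U by blast
    have "u = (\<lambda>f. \<Sum>b\<in>Basis. u (\<lambda>z. \<phi> z \<bullet> b) * ?k b y f)"
      by (rule ext) (rule tangent_rep(2)[OF c(1) yD u])
    then have "W_nabla A nabla y u g = W_nabla A nabla y (\<lambda>f. \<Sum>b\<in>Basis. u (\<lambda>z. \<phi> z \<bullet> b) * ?k b y f) g"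
      by (rule arg_cong)
    also have "\<dots> = (\<lambda>a b. \<Sum>b'\<in>Basis. u (\<lambda>z. \<phi> z \<bullet> b') * W_nabla A nabla y (?k b' y) g a b)"
      by (rule W_nabla_dir_sum[OF oU y gU]) (use yD c in auto)
    also have "\<dots> = (\<lambda>a b. 0)" by (simp add: coord[OF y])
    finally show "W_nabla A nabla y u g = (\<lambda>a b. 0)" .
  qed
  moreover have "g x = h" unfolding g_def r using Cx by simp
  ultimately show ?thesis using oU U gU by blast
qed

end

theorem corollary4:
  fixes A :: "('m::{t2_space,second_countable_topology}, 'e::euclidean_space) atlas"
    and nabla :: "'m conn"
    and x :: 'm
  assumes "smooth_atlas A"
    and "connected (UNIV :: 'm set)"
    and "connection A nabla"
    and "regular_at A nabla x"
  shows "locally_metric_at A nabla x \<longleftrightarrow> (\<exists>h \<in> fibre (W_tilde A nabla) x. pos_def A x h)"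
proof -
  interpret manifold_connection A nabla by unfold_locales (use assms in auto)
  obtain k where k: "W_tilde A nabla = W_flag A nabla k" "W_flag A nabla (Suc k) = W_flag A nabla k"
    using W_tilde_stable .
  show ?thesis
  proof
    assume "locally_metric_at A nabla x"
    then obtain U g where g: "open U" "x \<in> U" "W_section A U g" "pos_def A x (g x)" "parallel_on A nabla U g"
      by (auto simp: locally_metric_at_def metric_on_def)
    have "(x, g x) \<in> W_tilde A nabla"
      unfolding k by (rule V_sectionD(3)[OF parallel_section_in_W_flag[OF g(1,3,5)] g(2)])
    then show "\<exists>h \<in> fibre (W_tilde A nabla) x. pos_def A x h" using g by (auto simp: fibre_def)
  next
    assume "\<exists>h \<in> fibre (W_tilde A nabla) x. pos_def A x h"
    then obtain h where h: "(x, h) \<in> W_flag A nabla k" "pos_def A x h" by (auto simp: fibre_def k)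
    have ker: "W_flag A nabla k \<subseteq> ker_second_form A nabla (W_flag A nabla k)"
      using S_op_subset[of "ker_second_form A nabla (W_flag A nabla k)"] k(2) by simp
    obtain D \<phi> where c: "(D, \<phi>) \<in> A" "x \<in> D" using chart_exists by blast
    obtain U where U: "x \<in> U" "subbundle_over A (W_flag A nabla k) U"
      using assms(4) unfolding regular_at_def k by blast
    obtain N n e where N: "x \<in> N" "N \<subseteq> D" and e: "orthogonal_system (D, \<phi>) (W_flag A nabla k) N n e"
      "spanning (D, \<phi>) (W_flag A nabla k) N n e"
      using subbundle_orthogonal_frame[OF c W_flag_linear U(2,1)] by blast
    obtain U' g where g: "open U'" "x \<in> U'" "W_section A U' g" "parallel_on A nabla U' g" "g x = h"
      using parallel_extension[OF c W_flag_linear ker W_flag_subset_ker_curvature N e h(1)] by blast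
    obtain M where M: "open M" "x \<in> M" "M \<subseteq> U'" "\<forall>y\<in>M. pos_def A y (g y)"
      using pos_def_near[OF g(1,2,3)] g(5) h(2) by auto
    have "metric_on A M g" "parallel_on A nabla M g"
      using M g W_section_subset[OF g(3) M(3)] by (auto simp: metric_on_def parallel_on_def)
    then show "locally_metric_at A nabla x" using M unfolding locally_metric_at_def by blast
  qed
qed

end
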